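(* Let $\mathcal U$ be a domain in $\mathbb R^2$, let $(M^3,g)$ be an oriented Riemannian $3$-manifold, let $f:\mathcal U\to (M^3,g)$ be a front, and let $p\in\mathcal U$ be a non-degenerate singular point of $f$. Then the Gaussian curvature $K$ of $f$ is rationally bounded at $p$ if and only if the limiting normal curvature $\kappa_\nu(p)$ is equal to zero.
   Context: All manifolds and maps are $C^\infty$. Write $\langle\cdot,\cdot\rangle=g$, $|\cdot|$ for the norm, $\nabla$ for the Levi-Civita connection and $\det_g$ for the Riemannian volume form of $(M^3,g)$; $f_u=df(\partial_u)$, $f_v=df(\partial_v)$, $f_{uu}=\nabla_{\partial_u}f_u$. Frontals and fronts: a singular point of $f$ is a point at which $f$ is not an immersion; other points are regular. $f$ is a frontal if around each point there is a unit vector field $\nu$ along $f$ with $\nu\perp df(a)$ for all tangent vectors $a$; it is a front if moreover $\nu$, regarded as a map into $TM^3$, is an immersion. A unit normal vector field $\nu$ is fixed (near $p$). Non-degenerate singular points: put $\lambda=\det_g(f_u,f_v,\nu)$ for a positively oriented local coordinate system $(u,v)$. A singular point $p$ is non-degenerate if $d\lambda(p)\ne0$; then $df(p)$ has rank one. Limiting normal curvature: for a singular point $p$ at which $df(p)$ has rank one, take a positively oriented local coordinate system $(u,v)$ centered at $p$ with $f_v(p)=0$. Then $\kappa_\nu(p):=\langle f_{uu}(p),\nu(p)\rangle/|f_u(p)|^2$, independent of the choice of such coordinates. Gaussian curvature: $K$ is the Gaussian curvature of the induced metric $f^*g$ on the set of regular points. Rational boundedness: on $\mathbb R\times S^1$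 ($S^1=\mathbb R/2\pi\mathbb Z$) let $(r,\theta)\sim(-r,\theta+\pi)$, let $\mathcal M$ be the quotient and $\pi$ the projection, and let $\Phi:\mathcal M\to\mathbb R^2$ be the map with $\Phi(\pi(r,\theta))=(r\cos\theta,r\sin\theta)$. Transplanting by a local coordinate system centered at $p$ gives the blow up $\Phi:\hat\Sigma^2_p\to\Sigma^2$ of a surface $\Sigma^2$ at $p$ (independent of the coordinates). Let $W$ be a neighborhood of $p$ and $\mathcal O$ an open dense subset of $W$. A $C^\infty$ function $\varphi:\mathcal O\to\mathbb R$ is rationally bounded at $p$ if there is a $C^\infty$ function $\rho:\Phi^{-1}(W)\to\mathbb R$ such that (a) $\Phi^{-1}(\mathcal O\setminus\{p\})=\Phi^{-1}(W\setminus\{p\})\cap\rho^{-1}(\mathbb R\setminus\{0\})$; (b) $\rho^{-1}(0)\cap\Phi^{-1}(p)$ is a finite set; (c) there is a $C^\infty$ function $\psi:\Phi^{-1}(W)\to\mathbb R$ with $\psi(q)=\rho(q)\,\varphi(\Phi(q))$ for $q\in\Phi^{-1}(\mathcal O)$. For $\varphi=K$, one takes $W$ a sufficiently small neighborhood of $p$ and $\mathcal O$ the set of regular points of $f$ in $W$. *)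

theory Defs
  imports "HOL-Analysis.Analysis"
begin

section \<open>Smooth maps between open subsets of Euclidean spaces\<close>

primrec Ck_on ::
  "nat \<Rightarrow> 'a::euclidean_space set \<Rightarrow> ('a \<Rightarrow> 'b::real_normed_vector) \<Rightarrow> bool" where
  "Ck_on 0 S f \<longleftrightarrow> continuous_on S f"
| "Ck_on (Suc k) S f \<longleftrightarrow>
     (\<forall>x\<in>S. f differentiable (at x)) \<and>
     (\<forall>b\<in>Basis. Ck_on k S (\<lambda>x. frechet_derivative f (at x) b))"

text \<open>Only used for open \<open>S\<close>: the derivatives are two-sided.\<close>

definition smooth_on ::
  "'a::euclidean_space set \<Rightarrow> ('a \<Rightarrow> 'b::real_normed_vector) \<Rightarrow> bool" where
  "smooth_on S f \<longleftrightarrow> (\<forall>k. Ck_on k S f)"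

definition pd :: "'n::finite \<Rightarrow> (real^'n \<Rightarrow> 'b::real_normed_vector) \<Rightarrow> real^'n \<Rightarrow> 'b" where
  "pd i f x = frechet_derivative f (at x) (axis i 1)"


section \<open>Metrics in coordinates\<close>

text \<open>\<open>christoffel h x k i j\<close> is $\Gamma^k_{ij}$ of the metric with Gram matrix \<open>h\<close>, and
  \<open>riemann h x l k i j\<close> is the coefficient $R^l$ in
  $R(\partial_i,\partial_j)\partial_k = \sum_l R^l \partial_l$, where
  $R(X,Y) = [\nabla_X,\nabla_Y] - \nabla_{[X,Y]}$.\<close>

definition christoffel ::
  "(real^'n::finite \<Rightarrow> real^'n^'n) \<Rightarrow> real^'n \<Rightarrow> 'n \<Rightarrow> 'n \<Rightarrow> 'n \<Rightarrow> real" where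
  "christoffel h x k i j =
     (1/2) * (\<Sum>l\<in>UNIV. matrix_inv (h x) $ k $ l *
        (pd i (\<lambda>y. h y $ j $ l) x + pd j (\<lambda>y. h y $ i $ l) x - pd l (\<lambda>y. h y $ i $ j) x))"

definition riemann ::
  "(real^'n::finite \<Rightarrow> real^'n^'n) \<Rightarrow> real^'n \<Rightarrow> 'n \<Rightarrow> 'n \<Rightarrow> 'n \<Rightarrow> 'n \<Rightarrow> real" where
  "riemann h x l k i j =
     pd i (\<lambda>y. christoffel h y l j k) x - pd j (\<lambda>y. christoffel h y l i k) x
     + (\<Sum>m\<in>UNIV. christoffel h x l i m * christoffel h x m j k
                   - christoffel h x l j m * christoffel h x m i k)"

text \<open>$K = \langle R(\partial_1,\partial_2)\partial_2,\partial_1\rangle / \det h$,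
  which is positive for the round sphere.\<close>

definition metric_curvature :: "(real^2 \<Rightarrow> real^2^2) \<Rightarrow> real^2 \<Rightarrow> real" where
  "metric_curvature h x = (\<Sum>l\<in>UNIV. h x $ l $ 1 * riemann h x l 2 1 2) / det (h x)"


section \<open>Oriented Riemannian 3-manifolds\<close>

text \<open>The points of the manifold are the elements of a Hausdorff, second countable type; its
  oriented smooth structure is an atlas all of whose transition maps have positive Jacobian
  determinant.\<close>

datatype 'm chart = Chart (chart_dom: "'m set") (coord: "'m \<Rightarrow> real^3")

definition chart_inv :: "'m chart \<Rightarrow> real^3 \<Rightarrow> 'm" where
  "chart_inv c = inv_into (chart_dom c) (coord c)"

definition transition :: "'m chart \<Rightarrow> 'm chart \<Rightarrow> real^3 \<Rightarrow> real^3" where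
  "transition c d = coord d \<circ> chart_inv c"

definition jacobian :: "(real^'n::finite \<Rightarrow> real^'n) \<Rightarrow> real^'n \<Rightarrow> real^'n^'n" where
  "jacobian f x = matrix (frechet_derivative f (at x))"

definition topological_chart :: "'m::topological_space chart \<Rightarrow> bool" where
  "topological_chart c \<longleftrightarrow> open (chart_dom c) \<and> open (coord c ` chart_dom c) \<and>
     homeomorphism (chart_dom c) (coord c ` chart_dom c) (coord c) (chart_inv c)"

definition oriented_atlas :: "'m::topological_space chart set \<Rightarrow> bool" where
  "oriented_atlas A \<longleftrightarrow>
     (\<forall>c\<in>A. topological_chart c) \<and> (\<Union>c\<in>A. chart_dom c) = UNIV \<and>
     (\<forall>c\<in>A. \<forall>d\<in>A. smooth_on (coord c ` (chart_dom c \<inter> chart_dom d)) (transition c d) \<and>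
        (\<forall>x\<in>coord c ` (chart_dom c \<inter> chart_dom d). det (jacobian (transition c d) x) > 0))"

text \<open>A metric assigns to each chart \<open>c\<close> the Gram matrix \<open>g c x\<close> of its coordinate vector
  fields at the point with coordinates \<open>x\<close>.\<close>

type_synonym 'm metric_coeffs = "'m chart \<Rightarrow> real^3 \<Rightarrow> real^3^3"

definition riemannian_metric ::
  "'m::topological_space chart set \<Rightarrow> 'm metric_coeffs \<Rightarrow> bool" where
  "riemannian_metric A g \<longleftrightarrow>
     (\<forall>c\<in>A. smooth_on (coord c ` chart_dom c) (g c) \<and>
        (\<forall>x\<in>coord c ` chart_dom c. transpose (g c x) = g c x \<and>
           (\<forall>v. v \<noteq> 0 \<longrightarrow> v \<bullet> (g c x *v v) > 0))) \<and>
     (\<forall>c\<in>A. \<forall>d\<in>A. \<forall>x\<in>coord c ` (chart_dom c \<inter> chart_dom d).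
        g c x = transpose (jacobian (transition c d) x) ** g d (transition c d x)
                  ** jacobian (transition c d) x)"

definition oriented_riemannian_3_manifold ::
  "'m::{t2_space,second_countable_topology} chart set \<Rightarrow> 'm metric_coeffs \<Rightarrow> bool" where
  "oriented_riemannian_3_manifold A g \<longleftrightarrow> oriented_atlas A \<and> riemannian_metric A g"

definition charts_at :: "'m chart set \<Rightarrow> 'm \<Rightarrow> 'm chart set" where
  "charts_at A m = {c\<in>A. m \<in> chart_dom c}"

text \<open>A tangent vector at \<open>m\<close> is given by its components in all charts around \<open>m\<close>, subject to
  the transformation law; its values at other charts are irrelevant.\<close>

type_synonym 'm tvec = "'m chart \<Rightarrow> real^3"

definition tangent_at :: "'m chart set \<Rightarrow> 'm \<Rightarrow> 'm tvec \<Rightarrow> bool" where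
  "tangent_at A m X \<longleftrightarrow> (\<forall>c\<in>charts_at A m. \<forall>d\<in>charts_at A m.
     X d = jacobian (transition c d) (coord c m) *v X c)"

text \<open>For tangent vectors, the inner product and the volume form do not depend on the chart used
  to evaluate them.\<close>

definition chart_at :: "'m chart set \<Rightarrow> 'm \<Rightarrow> 'm chart" where
  "chart_at A m = (SOME c. c \<in> charts_at A m)"

definition inner_at :: "'m chart set \<Rightarrow> 'm metric_coeffs \<Rightarrow> 'm \<Rightarrow> 'm tvec \<Rightarrow> 'm tvec \<Rightarrow> real" where
  "inner_at A g m X Y = (let c = chart_at A m in X c \<bullet> (g c (coord c m) *v Y c))"

definition volume_form ::
  "'m chart set \<Rightarrow> 'm metric_coeffs \<Rightarrow> 'm \<Rightarrow> 'm tvec \<Rightarrow> 'm tvec \<Rightarrow> 'm tvec \<Rightarrow> real" where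
  "volume_form A g m X Y Z =
     (let c = chart_at A m
      in sqrt (det (g c (coord c m))) * det (vector [X c, Y c, Z c] :: real^3^3))"


section \<open>Maps from plane domains, vector fields along them\<close>

definition smooth_map ::
  "'m::topological_space chart set \<Rightarrow> (real^2) set \<Rightarrow> (real^2 \<Rightarrow> 'm) \<Rightarrow> bool" where
  "smooth_map A U f \<longleftrightarrow> continuous_on U f \<and>
     (\<forall>c\<in>A. smooth_on (U \<inter> f -` chart_dom c) (coord c \<circ> f))"

definition dmap :: "(real^2 \<Rightarrow> 'm) \<Rightarrow> real^2 \<Rightarrow> real^2 \<Rightarrow> 'm tvec" where
  "dmap f q a = (\<lambda>c. frechet_derivative (coord c \<circ> f) (at q) a)"

abbreviation partial_map :: "2 \<Rightarrow> (real^2 \<Rightarrow> 'm) \<Rightarrow> real^2 \<Rightarrow> 'm tvec" where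
  "partial_map i f q \<equiv> dmap f q (axis i 1)"

definition smooth_field_along ::
  "'m chart set \<Rightarrow> (real^2 \<Rightarrow> 'm) \<Rightarrow> (real^2) set \<Rightarrow> (real^2 \<Rightarrow> 'm tvec) \<Rightarrow> bool" where
  "smooth_field_along A f N X \<longleftrightarrow> (\<forall>q\<in>N. tangent_at A (f q) (X q)) \<and>
     (\<forall>c\<in>A. smooth_on (N \<inter> f -` chart_dom c) (\<lambda>q. X q c))"

text \<open>The covariant derivative of the field \<open>X\<close> along \<open>f\<close> in direction $\partial_i$, for the
  Levi-Civita connection of \<open>g\<close>.\<close>

definition cov_deriv ::
  "'m metric_coeffs \<Rightarrow> (real^2 \<Rightarrow> 'm) \<Rightarrow> 2 \<Rightarrow> (real^2 \<Rightarrow> 'm tvec) \<Rightarrow> real^2 \<Rightarrow> 'm tvec" where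
  "cov_deriv g f i X q = (\<lambda>c. pd i (\<lambda>y. X y c) q +
     (\<chi> k. \<Sum>a\<in>UNIV. \<Sum>b\<in>UNIV.
        christoffel (g c) (coord c (f q)) k a b * partial_map i f q c $ a * X q c $ b))"


section \<open>Frontals, fronts and their singular points\<close>

definition regular_point :: "'m chart set \<Rightarrow> (real^2 \<Rightarrow> 'm) \<Rightarrow> real^2 \<Rightarrow> bool" where
  "regular_point A f q \<longleftrightarrow> (\<forall>c\<in>charts_at A (f q). inj (\<lambda>a. dmap f q a c))"

definition unit_normal_field ::
  "'m chart set \<Rightarrow> 'm metric_coeffs \<Rightarrow> (real^2 \<Rightarrow> 'm) \<Rightarrow> (real^2) set \<Rightarrow> (real^2 \<Rightarrow> 'm tvec) \<Rightarrow> bool"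
  where
  "unit_normal_field A g f N \<nu> \<longleftrightarrow> smooth_field_along A f N \<nu> \<and>
     (\<forall>q\<in>N. inner_at A g (f q) (\<nu> q) (\<nu> q) = 1 \<and>
        (\<forall>a. inner_at A g (f q) (\<nu> q) (dmap f q a) = 0))"

text \<open>A field \<open>X\<close> along \<open>f\<close> as a map into the tangent bundle, whose charts send a vector
  \<open>V\<close> at \<open>m\<close> to \<open>(coord c m, V c)\<close>.\<close>

definition field_immersion_at ::
  "'m chart set \<Rightarrow> (real^2 \<Rightarrow> 'm) \<Rightarrow> (real^2 \<Rightarrow> 'm tvec) \<Rightarrow> real^2 \<Rightarrow> bool" where
  "field_immersion_at A f X q \<longleftrightarrow> (\<forall>c\<in>charts_at A (f q).
     inj (frechet_derivative (\<lambda>y. (coord c (f y), X y c)) (at q)))"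

definition front ::
  "'m::topological_space chart set \<Rightarrow> 'm metric_coeffs \<Rightarrow> (real^2) set \<Rightarrow> (real^2 \<Rightarrow> 'm) \<Rightarrow> bool" where
  "front A g U f \<longleftrightarrow> smooth_map A U f \<and>
     (\<forall>q\<in>U. \<exists>N \<nu>. open N \<and> q \<in> N \<and> N \<subseteq> U \<and> unit_normal_field A g f N \<nu> \<and>
        (\<forall>y\<in>N. field_immersion_at A f \<nu> y))"

definition signed_area_density ::
  "'m chart set \<Rightarrow> 'm metric_coeffs \<Rightarrow> (real^2 \<Rightarrow> 'm) \<Rightarrow> (real^2 \<Rightarrow> 'm tvec) \<Rightarrow> real^2 \<Rightarrow> real" where
  "signed_area_density A g f \<nu> q =
     volume_form A g (f q) (partial_map 1 f q) (partial_map 2 f q) (\<nu> q)"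

text \<open>Uses the standard coordinates of the plane. Another positively oriented coordinate system
  multiplies the signed area density by a positive function, which does not affect
  non-degeneracy, as the density vanishes at singular points.\<close>

definition nondegenerate_singular_point ::
  "'m chart set \<Rightarrow> 'm metric_coeffs \<Rightarrow> (real^2 \<Rightarrow> 'm) \<Rightarrow> (real^2 \<Rightarrow> 'm tvec) \<Rightarrow> real^2 \<Rightarrow> bool" where
  "nondegenerate_singular_point A g f \<nu> p \<longleftrightarrow> \<not> regular_point A f p \<and>
     frechet_derivative (signed_area_density A g f \<nu>) (at p) \<noteq> (\<lambda>_. 0)"

text \<open>A local coordinate system centered at \<open>p\<close> is represented by its inverse
  \<open>\<phi> : (u,v) \<mapsto> \<phi>(u,v)\<close>, so that \<open>f\<close> in these coordinates is \<open>f \<circ> \<phi>\<close>.\<close>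

definition positive_coordinates ::
  "(real^2) set \<Rightarrow> real^2 \<Rightarrow> (real^2) set \<Rightarrow> (real^2 \<Rightarrow> real^2) \<Rightarrow> bool" where
  "positive_coordinates U p V \<phi> \<longleftrightarrow> open V \<and> 0 \<in> V \<and> smooth_on V \<phi> \<and> inj_on \<phi> V \<and> \<phi> ` V \<subseteq> U \<and>
     \<phi> 0 = p \<and> (\<forall>x\<in>V. det (jacobian \<phi> x) > 0)"

definition adapted_coordinates ::
  "'m chart set \<Rightarrow> (real^2) set \<Rightarrow> (real^2 \<Rightarrow> 'm) \<Rightarrow> real^2 \<Rightarrow> (real^2 \<Rightarrow> real^2) \<Rightarrow> bool" where
  "adapted_coordinates A U f p \<phi> \<longleftrightarrow> (\<exists>V. positive_coordinates U p V \<phi>) \<and>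
     (\<forall>c\<in>charts_at A (f p). partial_map 2 (f \<circ> \<phi>) 0 c = 0)"

text \<open>Any two coordinate systems as above give the same value at a point where the differential
  has rank one.\<close>

definition limiting_normal_curvature ::
  "'m chart set \<Rightarrow> 'm metric_coeffs \<Rightarrow> (real^2) set \<Rightarrow> (real^2 \<Rightarrow> 'm) \<Rightarrow> (real^2 \<Rightarrow> 'm tvec) \<Rightarrow>
     real^2 \<Rightarrow> real" where
  "limiting_normal_curvature A g U f \<nu> p =
     (let F = f \<circ> (SOME \<phi>. adapted_coordinates A U f p \<phi>)
      in inner_at A g (f p) (cov_deriv g F 1 (partial_map 1 F) 0) (\<nu> p)
         / inner_at A g (f p) (partial_map 1 F 0) (partial_map 1 F 0))"

definition induced_metric ::
  "'m chart set \<Rightarrow> 'm metric_coeffs \<Rightarrow> (real^2 \<Rightarrow> 'm) \<Rightarrow> real^2 \<Rightarrow> real^2^2" where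
  "induced_metric A g f q = (\<chi> i j. inner_at A g (f q) (partial_map i f q) (partial_map j f q))"

definition gaussian_curvature ::
  "'m chart set \<Rightarrow> 'm metric_coeffs \<Rightarrow> (real^2 \<Rightarrow> 'm) \<Rightarrow> real^2 \<Rightarrow> real" where
  "gaussian_curvature A g f = metric_curvature (induced_metric A g f)"


section \<open>Blow up of the plane at a point, rational boundedness\<close>

text \<open>The quotient of $\mathbf{R} \times S^1$ by $(r,\theta) \sim (-r,\theta+\pi)$, as a quotient
  of the plane: the first disjunct is equality in $\mathbf{R} \times S^1$.\<close>

definition moebius_rel :: "real \<times> real \<Rightarrow> real \<times> real \<Rightarrow> bool" where
  "moebius_rel x y \<longleftrightarrow>
     (fst y = fst x \<and> (\<exists>k::int. snd y = snd x + 2 * pi * of_int k)) \<or>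
     (fst y = - fst x \<and> (\<exists>k::int. snd y = snd x + pi + 2 * pi * of_int k))"

lemma moebius_rel_iff:
  "moebius_rel x y \<longleftrightarrow>
     (\<exists>k::int. snd y = snd x + pi * of_int k \<and> fst y = (if even k then fst x else - fst x))"
proof
  assume "moebius_rel x y"
  then consider (1) k :: int where "fst y = fst x" "snd y = snd x + 2 * pi * of_int k"
    | (2) k :: int where "fst y = - fst x" "snd y = snd x + pi + 2 * pi * of_int k"
    unfolding moebius_rel_def by blast
  then show "\<exists>k::int. snd y = snd x + pi * of_int k \<and>
      fst y = (if even k then fst x else - fst x)"
  proof cases
    case 1
    then show ?thesis by (intro exI[of _ "2 * k"]) (simp add: algebra_simps)
  next
    case 2
    then show ?thesis by (intro exI[of _ "2 * k + 1"]) (simp add: algebra_simps)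
  qed
next
  assume "\<exists>k::int. snd y = snd x + pi * of_int k \<and>
      fst y = (if even k then fst x else - fst x)"
  then obtain k :: int where k: "snd y = snd x + pi * of_int k"
    "fst y = (if even k then fst x else - fst x)" by blast
  show "moebius_rel x y"
  proof (cases "even k")
    case True
    then obtain j where "k = 2 * j" by (elim evenE)
    with k show ?thesis unfolding moebius_rel_def
      by (intro disjI1 conjI exI[of _ j]) (simp_all add: algebra_simps)
  next
    case False
    then obtain j where "k = 2 * j + 1" by (elim oddE)
    with k show ?thesis unfolding moebius_rel_def
      by (intro disjI2 conjI exI[of _ j]) (simp_all add: algebra_simps)
  qed
qed

lemma moebius_rel_equivp: "equivp moebius_rel"
proof (rule equivpI)
  show "reflp moebius_rel"
    by (rule reflpI) (auto simp: moebius_rel_iff intro!: exI[of _ 0])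
  show "symp moebius_rel"
  proof (rule sympI)
    fix x y assume "moebius_rel x y"
    then obtain k :: int where k: "snd y = snd x + pi * of_int k"
      "fst y = (if even k then fst x else - fst x)" unfolding moebius_rel_iff by blast
    then show "moebius_rel y x" unfolding moebius_rel_iff
      by (intro exI[of _ "- k"]) auto
  qed
  show "transp moebius_rel"
  proof (rule transpI)
    fix x y z assume "moebius_rel x y" "moebius_rel y z"
    then obtain k l :: int where "snd y = snd x + pi * of_int k"
      "fst y = (if even k then fst x else - fst x)" "snd z = snd y + pi * of_int l"
      "fst z = (if even l then fst y else - fst y)" unfolding moebius_rel_iff by blast
    then show "moebius_rel x z" unfolding moebius_rel_iff
      by (intro exI[of _ "k + l"]) (auto simp: algebra_simps)
  qed
qed

quotient_type moebius = "real \<times> real" / moebius_rel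
  by (rule moebius_rel_equivp)

definition moebius_proj :: "real \<times> real \<Rightarrow> moebius" where
  "moebius_proj = abs_moebius"

lift_definition blow_down_0 :: "moebius \<Rightarrow> real^2"
  is "\<lambda>x. vector [fst x * cos (snd x), fst x * sin (snd x)]"
proof -
  fix x y assume "moebius_rel x y"
  then consider (1) k :: int where "fst y = fst x" "snd y = snd x + 2 * pi * of_int k"
    | (2) k :: int where "fst y = - fst x" "snd y = snd x + pi + 2 * pi * of_int k"
    unfolding moebius_rel_def by blast
  then have "fst x * cos (snd x) = fst y * cos (snd y) \<and> fst x * sin (snd x) = fst y * sin (snd y)"
  proof cases
    case 1
    then show ?thesis
      by (simp add: cos_add sin_add cos_int_2pin sin_int_2pin)
  next
    case 2
    then show ?thesis
      by (simp add: cos_add sin_add cos_int_2pin sin_int_2pin)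
  qed
  then show "(vector [fst x * cos (snd x), fst x * sin (snd x)] :: real^2) =
      vector [fst y * cos (snd y), fst y * sin (snd y)]" by simp
qed

lemma blow_down_0_proj:
  "blow_down_0 (moebius_proj (r, \<theta>)) = vector [r * cos \<theta>, r * sin \<theta>]"
  unfolding moebius_proj_def by transfer simp

text \<open>The blow up at \<open>p\<close>, transplanted by the coordinates \<open>x \<mapsto> x - p\<close>.\<close>

definition blow_down :: "real^2 \<Rightarrow> moebius \<Rightarrow> real^2" where
  "blow_down p q = p + blow_down_0 q"

text \<open>The projection from the plane is a covering map, so smoothness on an open set of the
  quotient is smoothness of the composition with it.\<close>

definition moebius_smooth_on :: "moebius set \<Rightarrow> (moebius \<Rightarrow> real) \<Rightarrow> bool" where
  "moebius_smooth_on S \<rho> \<longleftrightarrow> smooth_on (moebius_proj -` S) (\<rho> \<circ> moebius_proj)"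

definition rationally_bounded ::
  "real^2 \<Rightarrow> (real^2) set \<Rightarrow> (real^2) set \<Rightarrow> (real^2 \<Rightarrow> real) \<Rightarrow> bool" where
  "rationally_bounded p W D \<phi> \<longleftrightarrow>
     open W \<and> p \<in> W \<and> open D \<and> D \<subseteq> W \<and> W \<subseteq> closure D \<and> smooth_on D \<phi> \<and>
     (\<exists>\<rho>. moebius_smooth_on (blow_down p -` W) \<rho> \<and>
        blow_down p -` (D - {p}) = blow_down p -` (W - {p}) \<inter> \<rho> -` (UNIV - {0}) \<and>
        finite (\<rho> -` {0} \<inter> blow_down p -` {p}) \<and>
        (\<exists>\<psi>. moebius_smooth_on (blow_down p -` W) \<psi> \<and>
           (\<forall>q\<in>blow_down p -` D. \<psi> q = \<rho> q * \<phi> (blow_down p q))))"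

text \<open>If the condition holds for some neighborhood \<open>W\<close>, it holds for all smaller ones, by
  restriction of \<open>\<rho>\<close> and \<open>\<psi>\<close>; hence "sufficiently small" is an existential quantifier.\<close>

definition curvature_rationally_bounded ::
  "'m chart set \<Rightarrow> 'm metric_coeffs \<Rightarrow> (real^2) set \<Rightarrow> (real^2 \<Rightarrow> 'm) \<Rightarrow> real^2 \<Rightarrow> bool" where
  "curvature_rationally_bounded A g U f p \<longleftrightarrow>
     (\<exists>W \<subseteq> U. rationally_bounded p W {q\<in>W. regular_point A f q} (gaussian_curvature A g f))"

end

theory Submission
  imports Defs
begin

text \<open>Near \<open>p\<close> the limiting tangent planes $\nu^\perp$ form a smooth plane bundle even across the
  singular set. Choose a smooth orthonormal frame $e_1, e_2$ of it, with connection form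
  $\omega = \langle\nabla e_1, e_2\rangle$. With $f_j = \sum_k a_{jk} e_k$, the torsion-free
  condition is the first structure equation, so $K = -\kappa/\delta$ at regular points, where
  $\kappa = \partial_1\omega_2 - \partial_2\omega_1$ and $\delta = \det a$ are smooth, and
  $\delta$ differs from the signed area density by a nonvanishing factor. Since
  $d\delta(p) \ne 0$, the quotient is rationally bounded iff $\kappa(p) = 0$: if so, divide
  numerator and denominator by the radius in polar coordinates; otherwise
  $K$ blows up along almost every ray.
  For a null vector $b$ of $df(p)$ the ambient curvature drops out of $\kappa(p)$, which becomes a
  multiple of the determinant of $\nabla_a\nu, \nabla_b\nu$ in $\nu^\perp$. Here
  $\nabla_b\nu$ is nonzero (front) and orthogonal to $f_a$ (symmetry of the second fundamental
  form), so this vanishes iff $\langle\nabla_a\nu, f_a\rangle = 0$, which is $\kappa_\nu(p) = 0$.\<close>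

section \<open>Smooth maps\<close>

text \<open>The frame components and omega come from smooth ambient data instead, and a division
  occurs only in the final quotient of kappa by delta. On the blow-up, numerator and denominator
  divided by the radius both change sign when a point is rewritten with the opposite radius and
  direction, so neither is a function on the Moebius strip. Multiplying both by the divided
  denominator repairs this, and the denominator becomes a square. The ambient connection is handled
  in one chart around \<open>f p\<close> through Christoffel symbols of the first kind, which
  involve no inverse matrix. Two choices in the definitions have to be bridged. A front comes with
  some normal field, possibly not the given one, so the immersion property is transferred between
  normals. The limiting normal curvature is evaluated in coordinates picked by choice, so its
  formula is derived for arbitrary adapted coordinates.\<close>

abbreviation dd :: "('a::real_normed_vector \<Rightarrow> 'b::real_normed_vector) \<Rightarrow> 'a \<Rightarrow> 'a \<Rightarrow> 'b" where
  "dd f x \<equiv> frechet_derivative f (at x)"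

lemma dd_eqI: "(f has_derivative f') (at x) \<Longrightarrow> dd f x = f'"
  by (metis frechet_derivative_at)

lemma has_derivative_dd: "f differentiable (at x) \<Longrightarrow> (f has_derivative dd f x) (at x)"
  by (simp add: frechet_derivative_works)

text \<open>\<open>frechet_derivative\<close> is a choice among all derivatives. Functions that
  agree near \<open>x\<close> have the same derivatives there, hence the same choice, even where
  neither is differentiable.\<close>

lemma dd_cong:
  assumes "open S" "x \<in> S" "\<And>y. y \<in> S \<Longrightarrow> f y = g y"
  shows "dd f x = dd g x"
proof -
  have "(f has_derivative h) (at x) \<longleftrightarrow> (g has_derivative h) (at x)" for h
    using assms by (metis has_derivative_transform_within_open)
  then show ?thesis by (simp add: frechet_derivative_def)
qed

lemma differentiable_cong:
  assumes "open S" "x \<in> S" "\<And>y. y \<in> S \<Longrightarrow> f y = g y"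
  shows "f differentiable (at x) \<longleftrightarrow> g differentiable (at x)"
proof -
  have "(f has_derivative h) (at x) \<longleftrightarrow> (g has_derivative h) (at x)" for h
    using assms by (metis has_derivative_transform_within_open)
  then show ?thesis by (simp add: differentiable_def)
qed

lemma Ck_on_cong:
  assumes "open S" "\<And>y. y \<in> S \<Longrightarrow> f y = g y"
  shows "Ck_on k S f \<longleftrightarrow> Ck_on k S g"
  using assms
proof (induction k arbitrary: f g)
  case 0
  then show ?case by (auto intro: continuous_on_eq)
next
  case (Suc k)
  have "Ck_on k S (\<lambda>x. dd f x b) \<longleftrightarrow> Ck_on k S (\<lambda>x. dd g x b)" for b
    using Suc.prems by (intro Suc.IH) (auto dest!: dd_cong[of S _ f g])
  moreover have "f differentiable (at x) \<longleftrightarrow> g differentiable (at x)" if "x \<in> S" for x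
    using Suc.prems that by (intro differentiable_cong[of S]) auto
  ultimately show ?case by simp
qed

lemma Ck_on_subset: "Ck_on k S f \<Longrightarrow> T \<subseteq> S \<Longrightarrow> Ck_on k T f"
  by (induction k arbitrary: f) (auto intro: continuous_on_subset)

lemma Ck_on_Suc_imp: "Ck_on (Suc k) S f \<Longrightarrow> Ck_on k S f"
proof (induction k arbitrary: f)
  case 0
  then show ?case
    by (auto intro!: continuous_at_imp_continuous_on differentiable_imp_continuous_within)
next
  case (Suc k)
  then show ?case by simp
qed

lemma Ck_on_SucI:
  assumes "open S" "\<And>x. x \<in> S \<Longrightarrow> (f has_derivative f' x) (at x)"
    "\<And>b. b \<in> Basis \<Longrightarrow> Ck_on k S (\<lambda>x. f' x b)"
  shows "Ck_on (Suc k) S f"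
proof -
  have "Ck_on k S (\<lambda>x. dd f x b)" if "b \<in> Basis" for b
    using assms(3)[OF that] by (subst Ck_on_cong[OF assms(1)]) (auto simp: dd_eqI[OF assms(2)])
  then show ?thesis using assms(2) by (auto simp: differentiable_def)
qed

lemma Ck_on_SucD:
  assumes "Ck_on (Suc k) S f"
  shows "\<And>x. x \<in> S \<Longrightarrow> (f has_derivative dd f x) (at x)"
    and "\<And>b. b \<in> Basis \<Longrightarrow> Ck_on k S (\<lambda>x. dd f x b)"
  using assms by (auto intro: has_derivative_dd)

lemma Ck_on_const: "Ck_on k S (\<lambda>x. c)"
  by (induction k arbitrary: c) auto

lemma Ck_on_add:
  assumes "open S" "Ck_on k S f" "Ck_on k S g"
  shows "Ck_on k S (\<lambda>x. f x + g x)"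
  using assms
proof (induction k arbitrary: f g)
  case (Suc k)
  note D = Ck_on_SucD[OF Suc.prems(2)] Ck_on_SucD[OF Suc.prems(3)]
  show ?case
    by (rule Ck_on_SucI[OF \<open>open S\<close> has_derivative_add]) (auto intro: D Suc.IH \<open>open S\<close>)
qed (auto intro: continuous_on_add)

lemma (in bounded_linear) Ck_on_linear:
  assumes "open S" "Ck_on k S g"
  shows "Ck_on k S (\<lambda>x. f (g x))"
  using assms
proof (induction k arbitrary: g)
  case (Suc k)
  note D = Ck_on_SucD[OF Suc.prems(2)]
  show ?case
    by (rule Ck_on_SucI[OF \<open>open S\<close> has_derivative]) (auto intro: D Suc.IH \<open>open S\<close>)
qed (auto intro: continuous_on)

lemma (in bounded_bilinear) Ck_on_bilinear:
  assumes "open S" "Ck_on k S f" "Ck_on k S g"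
  shows "Ck_on k S (\<lambda>x. prod (f x) (g x))"
  using assms
proof (induction k arbitrary: f g)
  case (Suc k)
  note D = Ck_on_SucD[OF Suc.prems(2)] Ck_on_SucD[OF Suc.prems(3)]
  note C = Ck_on_Suc_imp[OF Suc.prems(2)] Ck_on_Suc_imp[OF Suc.prems(3)]
  show ?case
    by (rule Ck_on_SucI[OF \<open>open S\<close> FDERIV])
      (auto intro!: Ck_on_add intro: D C Suc.IH \<open>open S\<close>)
qed (auto intro: continuous_on)

lemma Ck_on_sum:
  assumes "open S" "\<And>i. i \<in> I \<Longrightarrow> Ck_on k S (f i)"
  shows "Ck_on k S (\<lambda>x. \<Sum>i\<in>I. f i x)"
  using assms(2)
  by (induction I rule: infinite_finite_induct) (auto intro: Ck_on_const Ck_on_add assms(1))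

lemma Ck_on_ident: "open S \<Longrightarrow> Ck_on k S (\<lambda>x. x)"
proof (cases k)
  case (Suc n)
  assume "open S"
  then show ?thesis unfolding Suc
    by (intro Ck_on_SucI[where f' = "\<lambda>x v. v"]) (auto intro: Ck_on_const)
qed (auto intro: continuous_on_id)

lemma linear_euclidean_sum:
  fixes a :: "'a::euclidean_space"
  assumes "linear l"
  shows "l a = (\<Sum>e\<in>Basis. (a \<bullet> e) *\<^sub>R l e)"
proof -
  have "l a = l (\<Sum>e\<in>Basis. (a \<bullet> e) *\<^sub>R e)" by (simp add: euclidean_representation)
  also have "\<dots> = (\<Sum>e\<in>Basis. (a \<bullet> e) *\<^sub>R l e)"
    using assms by (simp add: linear_sum linear_cmul)
  finally show ?thesis .
qed

text \<open>The chain rule produces the derivative of \<open>g\<close> in a direction that varies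
  with \<open>x\<close>. Expanding this direction in the basis leaves products with partial
  derivatives of \<open>g\<close>, to which the induction applies.\<close>

lemma Ck_on_compose:
  fixes f :: "'a::euclidean_space \<Rightarrow> 'b::euclidean_space" and g :: "'b \<Rightarrow> 'c::real_normed_vector"
  assumes "open S" "open T" "Ck_on k S f" "Ck_on k T g" "f ` S \<subseteq> T"
  shows "Ck_on k S (\<lambda>x. g (f x))"
  using assms
proof (induction k arbitrary: g)
  case 0
  then show ?case by (auto intro: continuous_on_compose2[of T g S f])
next
  case (Suc k)
  note Df = Ck_on_SucD[OF Suc.prems(3)] and Dg = Ck_on_SucD[OF Suc.prems(4)]
  have fS: "f x \<in> T" if "x \<in> S" for x using that Suc.prems by auto
  have der: "((\<lambda>x. g (f x)) has_derivative
      (\<lambda>v. \<Sum>e\<in>Basis. (dd f x v \<bullet> e) *\<^sub>R dd g (f x) e)) (at x)" if "x \<in> S" for x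
  proof -
    have "((\<lambda>x. g (f x)) has_derivative (\<lambda>v. dd g (f x) (dd f x v))) (at x)"
      by (rule has_derivative_compose[OF Df(1) Dg(1)]) (use that fS in auto)
    moreover have "dd g (f x) w = (\<Sum>e\<in>Basis. (w \<bullet> e) *\<^sub>R dd g (f x) e)" for w
      by (rule linear_euclidean_sum) (use Dg(1)[OF fS[OF that]] in \<open>simp add: has_derivative_linear\<close>)
    ultimately show ?thesis by (metis (no_types, lifting) ext)
  qed
  have "Ck_on k S (\<lambda>x. dd g (f x) e)" if "e \<in> Basis" for e
    by (rule Suc.IH) (use Suc.prems that in \<open>auto intro: Ck_on_Suc_imp simp del: Ck_on.simps(2) dest: Ck_on_SucD(2)\<close>)
  then show ?case
    by (intro Ck_on_SucI[OF \<open>open S\<close> der] Ck_on_sum[OF \<open>open S\<close>]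
        bounded_bilinear.Ck_on_bilinear[OF bounded_bilinear_scaleR \<open>open S\<close>]
        bounded_linear.Ck_on_linear[OF bounded_linear_inner_left \<open>open S\<close>] Df(2))
qed

text \<open>The induction closes because the derivative of \<open>inverse\<close> is a polynomial in
  \<open>inverse\<close>; likewise the derivative of \<open>sqrt\<close> below is a function of
  \<open>sqrt\<close>.\<close>

lemma Ck_on_inverse: "Ck_on k {x::real. x \<noteq> 0} inverse"
proof (induction k)
  case 0
  then show ?case by (auto intro!: continuous_intros)
next
  case (Suc k)
  have o: "open {x::real. x \<noteq> 0}" by (simp add: open_Collect_neq)
  show ?case
  proof (rule Ck_on_SucI[OF o])
    show "(inverse has_derivative (\<lambda>h. - (inverse x * h * inverse x))) (at x)"
      if "x \<in> {x::real. x \<noteq> 0}" for x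
      using that by (auto intro!: derivative_eq_intros)
    show "Ck_on k {x. x \<noteq> 0} (\<lambda>x::real. - (inverse x * b * inverse x))" if "b \<in> Basis" for b :: real
      by (intro bounded_linear.Ck_on_linear[OF bounded_linear_minus[OF bounded_linear_ident]]
          bounded_bilinear.Ck_on_bilinear[OF bounded_bilinear_mult] o Suc Ck_on_const)
  qed
qed

lemma Ck_on_sqrt: "Ck_on k {x::real. x > 0} sqrt"
proof (induction k)
  case 0
  then show ?case by (auto intro!: continuous_intros)
next
  case (Suc k)
  have o: "open {x::real. x > 0}" by (simp add: open_Collect_less)
  show ?case
  proof (rule Ck_on_SucI[OF o])
    show "(sqrt has_derivative (\<lambda>h. inverse (sqrt x) * (h / 2))) (at x)"
      if "x \<in> {x::real. x > 0}" for x
      using that by (auto intro!: derivative_eq_intros simp: field_simps)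
    have "Ck_on k {x::real. x > 0} (\<lambda>x. inverse (sqrt x))"
      by (rule Ck_on_compose[OF o _ Suc Ck_on_inverse]) (auto simp: open_Collect_neq)
    then show "Ck_on k {x. x > 0} (\<lambda>x::real. inverse (sqrt x) * (b / 2))" if "b \<in> Basis" for b :: real
      by (intro bounded_bilinear.Ck_on_bilinear[OF bounded_bilinear_mult] o Ck_on_const)
  qed
qed

text \<open>The induction carries both functions at once, since each is the derivative of the other
  up to sign.\<close>

lemma Ck_on_sin_cos: "Ck_on k UNIV (sin :: real \<Rightarrow> real) \<and> Ck_on k UNIV (cos :: real \<Rightarrow> real)"
proof (induction k)
  case 0
  then show ?case by (auto intro!: continuous_intros)
next
  case (Suc k)
  have s: "Ck_on (Suc k) UNIV (sin :: real \<Rightarrow> real)"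
    by (rule Ck_on_SucI[where f' = "\<lambda>x h. cos x * h"])
      (auto intro!: derivative_eq_intros bounded_bilinear.Ck_on_bilinear[OF bounded_bilinear_mult]
        Ck_on_const simp: Suc mult.commute)
  have c: "Ck_on (Suc k) UNIV (cos :: real \<Rightarrow> real)"
    by (rule Ck_on_SucI[where f' = "\<lambda>x h. - (sin x * h)"])
      (auto intro!: derivative_eq_intros bounded_bilinear.Ck_on_bilinear[OF bounded_bilinear_mult]
        bounded_linear.Ck_on_linear[OF bounded_linear_minus[OF bounded_linear_ident]]
        Ck_on_const simp: Suc mult.commute simp del: Basis_real_def)
  show ?case using s c by simp
qed

section \<open>Closure properties of smooth maps\<close>

lemma smooth_on_subset: "smooth_on S f \<Longrightarrow> T \<subseteq> S \<Longrightarrow> smooth_on T f"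
  by (auto simp: smooth_on_def intro: Ck_on_subset)

lemma smooth_on_cong:
  "open S \<Longrightarrow> (\<And>y. y \<in> S \<Longrightarrow> f y = g y) \<Longrightarrow> smooth_on S f \<longleftrightarrow> smooth_on S g"
  unfolding smooth_on_def using Ck_on_cong by blast

lemma smooth_on_imp_continuous_on: "smooth_on S f \<Longrightarrow> continuous_on S f"
  unfolding smooth_on_def by (metis Ck_on.simps(1))

lemma smooth_on_imp_differentiable: "smooth_on S f \<Longrightarrow> x \<in> S \<Longrightarrow> f differentiable (at x)"
  unfolding smooth_on_def by (metis Ck_on.simps(2))

lemma smooth_on_has_derivative: "smooth_on S f \<Longrightarrow> x \<in> S \<Longrightarrow> (f has_derivative dd f x) (at x)"
  by (intro has_derivative_dd smooth_on_imp_differentiable)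

lemma smooth_on_const: "smooth_on S (\<lambda>x. c)"
  by (simp add: smooth_on_def Ck_on_const)

lemma smooth_on_ident: "open S \<Longrightarrow> smooth_on S (\<lambda>x. x)"
  by (simp add: smooth_on_def Ck_on_ident)

lemma smooth_on_add:
  "open S \<Longrightarrow> smooth_on S f \<Longrightarrow> smooth_on S g \<Longrightarrow> smooth_on S (\<lambda>x. f x + g x)"
  by (simp add: smooth_on_def Ck_on_add)

lemma (in bounded_linear) smooth_on_linear:
  "open S \<Longrightarrow> smooth_on S g \<Longrightarrow> smooth_on S (\<lambda>x. f (g x))"
  by (simp add: smooth_on_def Ck_on_linear)

lemma (in bounded_bilinear) smooth_on_bilinear:
  "open S \<Longrightarrow> smooth_on S f \<Longrightarrow> smooth_on S g \<Longrightarrow> smooth_on S (\<lambda>x. prod (f x) (g x))"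
  by (simp add: smooth_on_def Ck_on_bilinear)

lemma smooth_on_sum:
  "open S \<Longrightarrow> (\<And>i. i \<in> I \<Longrightarrow> smooth_on S (f i)) \<Longrightarrow> smooth_on S (\<lambda>x. \<Sum>i\<in>I. f i x)"
  by (simp add: smooth_on_def Ck_on_sum)

lemmas smooth_on_minus = bounded_linear.smooth_on_linear[OF bounded_linear_minus[OF bounded_linear_ident]]
lemmas smooth_on_nth = bounded_linear.smooth_on_linear[OF bounded_linear_vec_nth]
lemmas smooth_on_mult = bounded_bilinear.smooth_on_bilinear[OF bounded_bilinear_mult]
lemmas smooth_on_scaleR = bounded_bilinear.smooth_on_bilinear[OF bounded_bilinear_scaleR]
lemmas smooth_on_inner = bounded_bilinear.smooth_on_bilinear[OF bounded_bilinear_inner]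

lemma smooth_on_diff:
  "open S \<Longrightarrow> smooth_on S f \<Longrightarrow> smooth_on S g \<Longrightarrow> smooth_on S (\<lambda>x. f x - g x)"
  using smooth_on_add[of S f "\<lambda>x. - g x"] smooth_on_minus by fastforce

lemma bounded_bilinear_matrix_vector_mult:
  "bounded_bilinear (\<lambda>A x. (A :: real^'n^'m) *v x)"
  unfolding bilinear_conv_bounded_bilinear[symmetric] bilinear_def
  by (auto intro!: linearI simp: matrix_vector_mult_add_rdistrib matrix_vector_right_distrib
      scaleR_matrix_vector_assoc matrix_vector_mult_scaleR)

lemmas smooth_on_matrix_vector_mult =
  bounded_bilinear.smooth_on_bilinear[OF bounded_bilinear_matrix_vector_mult]

lemma smooth_on_power: "open S \<Longrightarrow> smooth_on S f \<Longrightarrow> smooth_on S (\<lambda>x. (f x :: real) ^ n)"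
  by (induction n) (auto intro: smooth_on_const smooth_on_mult)

lemma smooth_on_compose:
  fixes f :: "'a::euclidean_space \<Rightarrow> 'b::euclidean_space" and g :: "'b \<Rightarrow> 'c::real_normed_vector"
  assumes "open S" "open T" "smooth_on S f" "smooth_on T g" "\<And>x. x \<in> S \<Longrightarrow> f x \<in> T"
  shows "smooth_on S (\<lambda>x. g (f x))"
  using assms unfolding smooth_on_def by (blast intro: Ck_on_compose)

lemma smooth_on_inverse:
  assumes "open S" "smooth_on S f" "\<And>x. x \<in> S \<Longrightarrow> f x \<noteq> (0::real)"
  shows "smooth_on S (\<lambda>x. inverse (f x))"
  by (rule smooth_on_compose[OF assms(1) _ assms(2), of "{x. x \<noteq> 0}"])
    (use assms in \<open>auto simp: open_Collect_neq smooth_on_def Ck_on_inverse\<close>)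

lemma smooth_on_divide:
  assumes "open S" "smooth_on S f" "smooth_on S g" "\<And>x. x \<in> S \<Longrightarrow> g x \<noteq> (0::real)"
  shows "smooth_on S (\<lambda>x. f x / g x)"
  unfolding divide_inverse by (intro smooth_on_mult smooth_on_inverse assms)

lemma smooth_on_sqrt:
  assumes "open S" "smooth_on S f" "\<And>x. x \<in> S \<Longrightarrow> f x > (0::real)"
  shows "smooth_on S (\<lambda>x. sqrt (f x))"
  by (rule smooth_on_compose[OF assms(1) _ assms(2), of "{x. x > 0}"])
    (use assms in \<open>auto simp: open_Collect_less smooth_on_def Ck_on_sqrt\<close>)

lemma smooth_on_sin: "open S \<Longrightarrow> smooth_on S f \<Longrightarrow> smooth_on S (\<lambda>x. sin (f x :: real))"
  by (rule smooth_on_compose[of S UNIV]) (auto simp: smooth_on_def Ck_on_sin_cos)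

lemma smooth_on_cos: "open S \<Longrightarrow> smooth_on S f \<Longrightarrow> smooth_on S (\<lambda>x. cos (f x :: real))"
  by (rule smooth_on_compose[of S UNIV]) (auto simp: smooth_on_def Ck_on_sin_cos)

lemma linear_dd: "f differentiable (at x) \<Longrightarrow> linear (dd f x)"
  by (simp add: linear_frechet_derivative)

lemma smooth_on_dd:
  assumes "open S" "smooth_on S f"
  shows "smooth_on S (\<lambda>x. dd f x v)"
proof -
  have "smooth_on S (\<lambda>x. dd f x b)" if "b \<in> Basis" for b
    using assms(2) that unfolding smooth_on_def by (metis Ck_on.simps(2))
  then have "smooth_on S (\<lambda>x. \<Sum>e\<in>Basis. (v \<bullet> e) *\<^sub>R dd f x e)"
    by (intro smooth_on_sum smooth_on_scaleR smooth_on_const assms)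
  then show ?thesis
    by (subst smooth_on_cong[OF assms(1)])
      (auto intro: linear_euclidean_sum linear_dd smooth_on_imp_differentiable[OF assms(2)])
qed

lemmas smooth_intros = smooth_on_const smooth_on_ident smooth_on_add smooth_on_diff smooth_on_minus
  smooth_on_nth smooth_on_mult smooth_on_scaleR smooth_on_inner smooth_on_matrix_vector_mult
  smooth_on_power smooth_on_sin smooth_on_cos smooth_on_dd

section \<open>Sum, product and chain rules\<close>

lemma dd_add:
  "f differentiable (at x) \<Longrightarrow> g differentiable (at x) \<Longrightarrow> dd (\<lambda>x. f x + g x) x v = dd f x v + dd g x v"
  by (subst dd_eqI[OF has_derivative_add[OF has_derivative_dd has_derivative_dd]]) auto

lemma dd_diff:
  "f differentiable (at x) \<Longrightarrow> g differentiable (at x) \<Longrightarrow> dd (\<lambda>x. f x - g x) x v = dd f x v - dd g x v"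
  by (subst dd_eqI[OF has_derivative_diff[OF has_derivative_dd has_derivative_dd]]) auto

lemma (in bounded_linear) dd_linear:
  "g differentiable (at x) \<Longrightarrow> dd (\<lambda>x. f (g x)) x v = f (dd g x v)"
  by (subst dd_eqI[OF has_derivative[OF has_derivative_dd]]) auto

lemma (in bounded_bilinear) dd_bilinear:
  "f differentiable (at x) \<Longrightarrow> g differentiable (at x) \<Longrightarrow>
    dd (\<lambda>x. prod (f x) (g x)) x v = prod (f x) (dd g x v) + prod (dd f x v) (g x)"
  by (subst dd_eqI[OF FDERIV[OF has_derivative_dd has_derivative_dd]]) auto

lemma (in bounded_bilinear) differentiable_bilinear:
  "f differentiable (at x) \<Longrightarrow> g differentiable (at x) \<Longrightarrow> (\<lambda>x. prod (f x) (g x)) differentiable (at x)"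
  unfolding differentiable_def using FDERIV by blast

lemmas dd_mult = bounded_bilinear.dd_bilinear[OF bounded_bilinear_mult]
lemmas dd_inner = bounded_bilinear.dd_bilinear[OF bounded_bilinear_inner]
lemmas dd_matrix_vector_mult = bounded_bilinear.dd_bilinear[OF bounded_bilinear_matrix_vector_mult]

lemma dd_compose:
  "f differentiable (at x) \<Longrightarrow> g differentiable (at (f x)) \<Longrightarrow> dd (\<lambda>x. g (f x)) x v = dd g (f x) (dd f x v)"
  by (subst dd_eqI[OF has_derivative_compose[OF has_derivative_dd has_derivative_dd]]) auto

section \<open>Symmetry of second derivatives\<close>

lemma second_difference_eq:
  fixes f :: "'a::euclidean_space \<Rightarrow> real"
  assumes sm: "smooth_on (ball x r) f" and t: "t > 0" "t * (norm a + norm b) < r"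
  shows "\<exists>s s'. 0 < s \<and> s < t \<and> 0 < s' \<and> s' < t \<and>
    f (x + t *\<^sub>R a + t *\<^sub>R b) - f (x + t *\<^sub>R a) - f (x + t *\<^sub>R b) + f x =
    t * (t * dd (\<lambda>y. dd f y a) (x + s *\<^sub>R a + s' *\<^sub>R b) b)"
proof -
  have inb: "x + s *\<^sub>R a + s' *\<^sub>R b \<in> ball x r" if "0 \<le> s" "s \<le> t" "0 \<le> s'" "s' \<le> t" for s s'
  proof -
    have "norm (s *\<^sub>R a + s' *\<^sub>R b) \<le> s * norm a + s' * norm b"
      using norm_triangle_ineq[of "s *\<^sub>R a" "s' *\<^sub>R b"] that by simp
    also have "\<dots> \<le> t * norm a + t * norm b"
      using that by (intro add_mono mult_right_mono) auto
    also have "\<dots> < r" using t by (simp add: distrib_left)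
    finally have "dist (x + s *\<^sub>R a + s' *\<^sub>R b) x < r" by (simp add: dist_norm add.assoc)
    then show ?thesis by (simp add: dist_commute)
  qed
  \<comment> \<open>The mean value theorem is applied twice: along \<open>a\<close> to the
    difference of \<open>f\<close> on two parallel segments, then along \<open>b\<close>. The result
    is an exact mixed derivative at an intermediate point.\<close>
  have d1: "((\<lambda>s. f (x + s *\<^sub>R a + t *\<^sub>R b) - f (x + s *\<^sub>R a)) has_real_derivative
      dd f (x + s *\<^sub>R a + t *\<^sub>R b) a - dd f (x + s *\<^sub>R a) a) (at s)" if s: "0 \<le> s" "s \<le> t" for s
  proof -
    have "((\<lambda>s. f (x + s *\<^sub>R a + c *\<^sub>R b)) has_real_derivative dd f (x + s *\<^sub>R a + c *\<^sub>R b) a) (at s)"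
      if c: "0 \<le> c" "c \<le> t" for c
    proof -
      have h: "(f has_derivative dd f (x + s *\<^sub>R a + c *\<^sub>R b)) (at (x + s *\<^sub>R a + c *\<^sub>R b))"
        using smooth_on_has_derivative[OF sm inb] s c by auto
      have "((\<lambda>s. f (x + s *\<^sub>R a + c *\<^sub>R b)) has_derivative (\<lambda>h. dd f (x + s *\<^sub>R a + c *\<^sub>R b) (h *\<^sub>R a))) (at s)"
        by (rule has_derivative_compose[where f = "\<lambda>s. x + s *\<^sub>R a + c *\<^sub>R b", OF _ h]) (auto intro!: derivative_eq_intros)
      then show ?thesis
        using linear_cmul[OF has_derivative_linear[OF h]]
        by (simp add: has_field_derivative_def mult_commute_abs)
    qed
    from DERIV_diff[OF this[of t] this[of 0]] t s show ?thesis by simp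
  qed
  obtain s where s: "0 < s" "s < t" and e1:
    "f (x + t *\<^sub>R a + t *\<^sub>R b) - f (x + t *\<^sub>R a) - (f (x + t *\<^sub>R b) - f x) =
      t * (dd f (x + s *\<^sub>R a + t *\<^sub>R b) a - dd f (x + s *\<^sub>R a) a)"
    using MVT2[OF \<open>t > 0\<close> d1] by auto
  have d2: "((\<lambda>s'. dd f (x + s *\<^sub>R a + s' *\<^sub>R b) a) has_real_derivative
      dd (\<lambda>y. dd f y a) (x + s *\<^sub>R a + s' *\<^sub>R b) b) (at s')" if s': "0 \<le> s'" "s' \<le> t" for s'
  proof -
    let ?z = "x + s *\<^sub>R a + s' *\<^sub>R b"
    have h: "((\<lambda>y. dd f y a) has_derivative dd (\<lambda>y. dd f y a) ?z) (at ?z)"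
      using smooth_on_has_derivative[OF smooth_on_dd[OF _ sm] inb] s s' by auto
    have "((\<lambda>s'. dd f (x + s *\<^sub>R a + s' *\<^sub>R b) a) has_derivative (\<lambda>h. dd (\<lambda>y. dd f y a) ?z (h *\<^sub>R b))) (at s')"
      by (rule has_derivative_compose[where f = "\<lambda>s'. x + s *\<^sub>R a + s' *\<^sub>R b", OF _ h]) (auto intro!: derivative_eq_intros)
    then show ?thesis
      using linear_cmul[OF has_derivative_linear[OF h]]
      by (simp add: has_field_derivative_def mult_commute_abs)
  qed
  obtain s' where "0 < s'" "s' < t"
    "dd f (x + s *\<^sub>R a + t *\<^sub>R b) a - dd f (x + s *\<^sub>R a) a = t * dd (\<lambda>y. dd f y a) (x + s *\<^sub>R a + s' *\<^sub>R b) b"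
    using MVT2[OF \<open>t > 0\<close> d2] by auto
  with s e1 show ?thesis by (intro exI[of _ s] exI[of _ s']) simp
qed

text \<open>The second difference over a small parallelogram is symmetric in \<open>a\<close> and
  \<open>b\<close>. It equals \<open>t * t\<close> times either mixed derivative at some point
  nearby, so the two mixed derivatives share a value arbitrarily close to \<open>x\<close>, and
  continuity forbids a gap between them at \<open>x\<close>.\<close>

lemma dd_commute_real:
  fixes f :: "'a::euclidean_space \<Rightarrow> real"
  assumes S: "open S" "x \<in> S" and sm: "smooth_on S f"
  shows "dd (\<lambda>y. dd f y a) x b = dd (\<lambda>y. dd f y b) x a"
proof (rule ccontr)
  define P where "P = (\<lambda>z. dd (\<lambda>y. dd f y a) z b)"
  define Q where "Q = (\<lambda>z. dd (\<lambda>y. dd f y b) z a)"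
  assume "\<not> ?thesis"
  then have e: "\<bar>P x - Q x\<bar> / 2 > 0" (is "?e > 0") by (simp add: P_def Q_def)
  have "continuous (at x) P" "continuous (at x) Q"
    using smooth_on_imp_continuous_on[OF smooth_on_dd[OF S(1) smooth_on_dd[OF S(1) sm]]] S
    unfolding P_def Q_def by (simp_all add: continuous_on_eq_continuous_at)
  then obtain d1 d2 where d: "d1 > 0" "d2 > 0"
    and dP: "\<forall>z. dist z x < d1 \<longrightarrow> dist (P z) (P x) < ?e"
    and dQ: "\<forall>z. dist z x < d2 \<longrightarrow> dist (Q z) (Q x) < ?e"
    using e unfolding continuous_at_eps_delta by blast
  obtain r0 where r0: "r0 > 0" "ball x r0 \<subseteq> S" using S by (meson openE)
  define r where "r = min r0 (min d1 d2)"
  have r: "r > 0" "ball x r \<subseteq> S" "r \<le> d1" "r \<le> d2" using r0 d by (auto simp: r_def)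
  \<comment> \<open>The summand 1 keeps the denominator positive when \<open>a\<close> and
    \<open>b\<close> both vanish.\<close>
  define t where "t = r / (2 * (norm a + norm b + 1))"
  have t: "t > 0" using r by (auto simp: t_def intro!: divide_pos_pos add_nonneg_pos)
  have t1: "t * (norm a + norm b) < r"
  proof -
    have "norm a + norm b + 1 > 0" by (intro add_nonneg_pos) auto
    then have "t * (norm a + norm b + 1) = r / 2" by (simp add: t_def field_simps)
    then show ?thesis using t r by (simp add: algebra_simps)
  qed
  have smr: "smooth_on (ball x r) f" using smooth_on_subset[OF sm r(2)] .
  obtain s s' where s: "0 < s" "s < t" "0 < s'" "s' < t" and
    1: "f (x + t *\<^sub>R a + t *\<^sub>R b) - f (x + t *\<^sub>R a) - f (x + t *\<^sub>R b) + f x =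
    t * (t * P (x + s *\<^sub>R a + s' *\<^sub>R b))"
    using second_difference_eq[OF smr t t1] unfolding P_def by auto
  obtain q q' where q: "0 < q" "q < t" "0 < q'" "q' < t" and
    2: "f (x + t *\<^sub>R b + t *\<^sub>R a) - f (x + t *\<^sub>R b) - f (x + t *\<^sub>R a) + f x =
    t * (t * Q (x + q *\<^sub>R b + q' *\<^sub>R a))"
    using second_difference_eq[OF smr t, of b a] t1 unfolding Q_def by (auto simp: add.commute)
  have near: "dist (x + s *\<^sub>R v + s' *\<^sub>R w) x < r"
    if "0 < s" "s < t" "0 < s'" "s' < t" "norm v + norm w = norm a + norm b" for s s' v w
  proof -
    have "dist (x + s *\<^sub>R v + s' *\<^sub>R w) x = norm (s *\<^sub>R v + s' *\<^sub>R w)"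
      by (simp add: dist_norm add.assoc)
    also have "\<dots> \<le> s * norm v + s' * norm w"
      using norm_triangle_ineq[of "s *\<^sub>R v" "s' *\<^sub>R w"] that by simp
    also have "\<dots> \<le> t * norm v + t * norm w"
      using that by (intro add_mono mult_right_mono) auto
    also have "\<dots> < r" using t1 that by (simp add: distrib_left[symmetric])
    finally show ?thesis .
  qed
  have "t * (t * P (x + s *\<^sub>R a + s' *\<^sub>R b)) = t * (t * Q (x + q *\<^sub>R b + q' *\<^sub>R a))"
    using 1 2 by (simp add: algebra_simps)
  then have "P (x + s *\<^sub>R a + s' *\<^sub>R b) = Q (x + q *\<^sub>R b + q' *\<^sub>R a)" using t by simp
  moreover have "dist (P (x + s *\<^sub>R a + s' *\<^sub>R b)) (P x) < ?e"
    by (intro dP[rule_format]) (use near[OF s, of a b] r in auto)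
  moreover have "dist (Q (x + q *\<^sub>R b + q' *\<^sub>R a)) (Q x) < ?e"
    by (intro dQ[rule_format]) (use near[OF q, of b a] r in auto)
  ultimately show False unfolding dist_real_def by argo
qed

lemma dd_commute:
  fixes f :: "'a::euclidean_space \<Rightarrow> 'b::euclidean_space"
  assumes S: "open S" "x \<in> S" and sm: "smooth_on S f"
  shows "dd (\<lambda>y. dd f y a) x b = dd (\<lambda>y. dd f y b) x a"
proof (rule euclidean_eqI)
  fix e :: 'b assume "e \<in> Basis"
  have smd: "smooth_on S (\<lambda>y. dd f y v)" for v by (intro smooth_on_dd S sm)
  have comp: "dd (\<lambda>y. h y \<bullet> e) y v = dd h y v \<bullet> e" if "y \<in> S" "smooth_on S h" for h y v
    using that by (intro bounded_linear.dd_linear[OF bounded_linear_inner_left])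
      (auto intro: smooth_on_imp_differentiable)
  have second: "dd (\<lambda>y. dd f y v) x w \<bullet> e = dd (\<lambda>y. dd (\<lambda>y. f y \<bullet> e) y v) x w" for v w
  proof -
    have "dd (\<lambda>y. dd f y v) x w \<bullet> e = dd (\<lambda>y. dd f y v \<bullet> e) x w"
      using comp[OF S(2) smd] by simp
    also have "dd (\<lambda>y. dd f y v \<bullet> e) x = dd (\<lambda>y. dd (\<lambda>y. f y \<bullet> e) y v) x"
      by (rule dd_cong[OF S]) (simp add: comp sm)
    finally show ?thesis .
  qed
  show "dd (\<lambda>y. dd f y a) x b \<bullet> e = dd (\<lambda>y. dd f y b) x a \<bullet> e"
    unfolding second
    by (rule dd_commute_real[OF S]) (intro smooth_on_inner smooth_on_const S sm)
qed

section \<open>Hadamard's lemma\<close>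

lemma Ck_on_integral_ray:
  fixes h :: "'a::euclidean_space \<Rightarrow> real"
  assumes "smooth_on (ball p r) h"
  shows "Ck_on k (ball p r) (\<lambda>x. integral (cbox 0 1) (\<lambda>t::real. t ^ j * h (p + t *\<^sub>R (x - p))))"
  using assms
proof (induction k arbitrary: h j)
  have ray: "p + t *\<^sub>R (x - p) \<in> ball p r" if "x \<in> ball p r" "t \<in> cbox 0 1" for t :: real and x
  proof -
    have "norm (t *\<^sub>R (x - p)) \<le> norm (x - p)"
      using that by (simp add: mult_left_le_one_le)
    then show ?thesis using that by (simp add: dist_norm norm_minus_commute)
  qed
  have cont: "continuous_on (ball p r \<times> cbox 0 1) (\<lambda>(x, t). h (p + t *\<^sub>R (x - p)))"
    if "smooth_on (ball p r) h" for h :: "'a \<Rightarrow> real"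
    unfolding split_beta
    by (rule continuous_on_compose2[OF smooth_on_imp_continuous_on[OF that]])
      (use ray in \<open>auto intro!: continuous_intros\<close>)
  have cont1: "continuous_on (cbox 0 1) (\<lambda>t. h (p + t *\<^sub>R (x - p)))"
    if "smooth_on (ball p r) h" "x \<in> ball p r" for h :: "'a \<Rightarrow> real" and x
    by (rule continuous_on_compose2[OF smooth_on_imp_continuous_on[OF that(1)]])
      (use ray that(2) in \<open>auto intro!: continuous_intros\<close>)
  \<comment> \<open>Differentiating along the ray brings out a factor \<open>t\<close>. The power
    \<open>t ^ j\<close> absorbs it, so the derivative is again an integral of this type, with
    \<open>Suc j\<close>.\<close>
  have der: "((\<lambda>x. integral (cbox 0 1) (\<lambda>t. t ^ j * h (p + t *\<^sub>R (x - p)))) has_derivative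
      (\<lambda>v. integral (cbox 0 1) (\<lambda>t. t ^ Suc j * dd h (p + t *\<^sub>R (x - p)) v))) (at x)"
    if sm: "smooth_on (ball p r) h" and x: "x \<in> ball p r" for h :: "'a \<Rightarrow> real" and x j
  proof -
    \<comment> \<open>\<open>leibniz_rule\<close> expects the derivative as a bounded linear map
      that depends continuously on both variables; the expansion in the basis makes this continuity
      visible.\<close>
    define fx where "fx = (\<lambda>x t. \<Sum>e\<in>Basis. (t ^ Suc j * dd h (p + t *\<^sub>R (x - p)) e) *\<^sub>R blinfun_inner_right e)"
    have fxv: "blinfun_apply (fx x t) v = t ^ Suc j * dd h (p + t *\<^sub>R (x - p)) v"
      if "x \<in> ball p r" "t \<in> cbox 0 1" for x v and t :: real
    proof -
      have "linear (dd h (p + t *\<^sub>R (x - p)))"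
        by (intro linear_dd smooth_on_imp_differentiable[OF sm] ray that)
      from linear_euclidean_sum[OF this, of v] show ?thesis
        by (simp add: fx_def blinfun.sum_left blinfun.scaleR_left sum_distrib_left algebra_simps)
          (auto intro!: sum.cong simp: inner_commute)
    qed
    have "((\<lambda>x. integral (cbox 0 1) (\<lambda>t. t ^ j * h (p + t *\<^sub>R (x - p)))) has_derivative
        blinfun_apply (integral (cbox 0 1) (fx x))) (at x within ball p r)"
    proof (rule leibniz_rule[OF _ _ _ x convex_ball])
      show "((\<lambda>x. t ^ j * h (p + t *\<^sub>R (x - p))) has_derivative blinfun_apply (fx x t)) (at x within ball p r)"
        if "x \<in> ball p r" "t \<in> cbox 0 1" for x t
      proof -
        have d: "(h has_derivative dd h (p + t *\<^sub>R (x - p))) (at (p + t *\<^sub>R (x - p)))"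
          by (intro smooth_on_has_derivative[OF sm] ray that)
        have "((\<lambda>x. h (p + t *\<^sub>R (x - p))) has_derivative (\<lambda>v. dd h (p + t *\<^sub>R (x - p)) (t *\<^sub>R v))) (at x)"
          by (rule has_derivative_compose[where f = "\<lambda>x. p + t *\<^sub>R (x - p)", OF _ d]) (auto intro!: derivative_eq_intros)
        then have "((\<lambda>x. t ^ j * h (p + t *\<^sub>R (x - p))) has_derivative
          (\<lambda>v. t ^ j * dd h (p + t *\<^sub>R (x - p)) (t *\<^sub>R v))) (at x)"
          by (rule has_derivative_mult_right)
        also have "(\<lambda>v. t ^ j * dd h (p + t *\<^sub>R (x - p)) (t *\<^sub>R v)) = blinfun_apply (fx x t)"
          using linear_cmul[OF has_derivative_linear[OF d]] fxv[OF that] by (auto simp: algebra_simps)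
        finally show ?thesis by (rule has_derivative_at_withinI)
      qed
      show "(\<lambda>t. t ^ j * h (p + t *\<^sub>R (x - p))) integrable_on cbox 0 1" if "x \<in> ball p r" for x
        by (intro integrable_continuous continuous_intros cont1[OF sm that])
      show "continuous_on (ball p r \<times> cbox 0 1) (\<lambda>(x, t). fx x t)"
        unfolding fx_def split_beta
        by (intro continuous_intros
            cont[OF smooth_on_dd[OF open_ball sm], unfolded split_beta])
    qed
    moreover have "blinfun_apply (integral (cbox 0 1) (fx x)) v =
      integral (cbox 0 1) (\<lambda>t. t ^ Suc j * dd h (p + t *\<^sub>R (x - p)) v)" for v
    proof -
      have "continuous_on (cbox 0 1) (fx x)" unfolding fx_def
        by (intro continuous_intros cont1[OF smooth_on_dd[OF open_ball sm] x])
      then have i: "fx x integrable_on cbox 0 1" by (rule integrable_continuous)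
      have "blinfun_apply (integral (cbox 0 1) (fx x)) v = integral (cbox 0 1) (\<lambda>t. blinfun_apply (fx x t) v)"
        using integral_linear[OF i blinfun.bounded_linear_left[of v]] by (simp add: o_def)
      also have "\<dots> = integral (cbox 0 1) (\<lambda>t. t ^ Suc j * dd h (p + t *\<^sub>R (x - p)) v)"
        by (rule integral_cong) (use fxv x in auto)
      finally show ?thesis .
    qed
    ultimately show ?thesis using at_within_open[OF x open_ball]
      by (metis (no_types, lifting) ext)
  qed
  {
    case (0 h j)
    show ?case
      unfolding Ck_on.simps
      by (rule has_derivative_continuous_on, rule has_derivative_at_withinI, rule der[OF 0])
  next
    case (Suc k h j)
    show ?case
      by (rule Ck_on_SucI[OF open_ball der[OF Suc.prems]])
        (assumption, intro Suc.IH smooth_on_dd open_ball Suc.prems)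
  }
qed

text \<open>Integrate the derivative of \<open>h\<close> along the segment from \<open>p\<close> to
  \<open>x\<close> and split \<open>x - p\<close> into its coordinates: \<open>A\<close> and
  \<open>B\<close> are partial derivatives averaged over the segment.\<close>

lemma hadamard:
  fixes h :: "real^2 \<Rightarrow> real"
  assumes sm: "smooth_on (ball p r) h" and h0: "h p = 0"
  obtains A B where "smooth_on (ball p r) A" "smooth_on (ball p r) B"
    "\<And>x. x \<in> ball p r \<Longrightarrow> h x = (x - p) $ 1 * A x + (x - p) $ 2 * B x"
proof
  \<comment> \<open>The factor \<open>t ^ 0\<close> is there to match
    \<open>Ck_on_integral_ray\<close>.\<close>
  let ?A = "\<lambda>v x. integral (cbox 0 1) (\<lambda>t::real. t ^ 0 * dd h (p + t *\<^sub>R (x - p)) v)"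
  show "smooth_on (ball p r) (?A (axis 1 1))" "smooth_on (ball p r) (?A (axis 2 1))"
    unfolding smooth_on_def by (intro allI Ck_on_integral_ray smooth_on_dd open_ball sm)+
  fix x assume x: "x \<in> ball p r"
  have ray: "p + t *\<^sub>R (x - p) \<in> ball p r" if "t \<in> cbox 0 1" for t :: real
  proof -
    have "norm (t *\<^sub>R (x - p)) \<le> norm (x - p)"
      using that by (simp add: mult_left_le_one_le)
    then show ?thesis using x by (simp add: dist_norm norm_minus_commute)
  qed
  have cont: "continuous_on (cbox 0 1) (\<lambda>t. dd h (p + t *\<^sub>R (x - p)) v)" for v
    by (rule continuous_on_compose2[OF smooth_on_imp_continuous_on[OF smooth_on_dd[OF open_ball sm]]])
      (use ray in \<open>auto intro!: continuous_intros\<close>)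
  have decomp: "dd h (p + t *\<^sub>R (x - p)) (x - p) =
      (x - p) $ 1 * dd h (p + t *\<^sub>R (x - p)) (axis 1 1) + (x - p) $ 2 * dd h (p + t *\<^sub>R (x - p)) (axis 2 1)"
    if "t \<in> cbox 0 1" for t :: real
  proof -
    have l: "linear (dd h (p + t *\<^sub>R (x - p)))"
      by (intro linear_dd smooth_on_imp_differentiable[OF sm] ray that)
    have "x - p = (x - p) $ 1 *\<^sub>R axis 1 1 + (x - p) $ 2 *\<^sub>R (axis 2 1 :: real^2)"
      by (simp add: vec_eq_iff forall_2 axis_def)
    then have "dd h (p + t *\<^sub>R (x - p)) (x - p) =
      dd h (p + t *\<^sub>R (x - p)) ((x - p) $ 1 *\<^sub>R axis 1 1 + (x - p) $ 2 *\<^sub>R axis 2 1)" by metis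
    then show ?thesis using l by (simp add: linear_add linear_cmul)
  qed
  have "((\<lambda>t. dd h (p + t *\<^sub>R (x - p)) (x - p)) has_integral h (p + 1 *\<^sub>R (x - p)) - h (p + 0 *\<^sub>R (x - p))) {0..1}"
  proof (rule fundamental_theorem_of_calculus)
    fix t :: real assume t: "t \<in> {0..1}"
    have d: "(h has_derivative dd h (p + t *\<^sub>R (x - p))) (at (p + t *\<^sub>R (x - p)))"
      using t by (intro smooth_on_has_derivative[OF sm] ray) auto
    have "((\<lambda>t. h (p + t *\<^sub>R (x - p))) has_derivative (\<lambda>s. dd h (p + t *\<^sub>R (x - p)) (s *\<^sub>R (x - p)))) (at t)"
      by (rule has_derivative_compose[where f = "\<lambda>t. p + t *\<^sub>R (x - p)", OF _ d]) (auto intro!: derivative_eq_intros)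
    then show "((\<lambda>t. h (p + t *\<^sub>R (x - p))) has_vector_derivative dd h (p + t *\<^sub>R (x - p)) (x - p)) (at t within {0..1})"
      using linear_cmul[OF has_derivative_linear[OF d]]
      by (simp add: has_vector_derivative_def has_derivative_at_withinI)
  qed simp
  then have "h x = integral (cbox 0 1) (\<lambda>t. dd h (p + t *\<^sub>R (x - p)) (x - p))"
    by (simp add: h0 integral_unique cbox_interval)
  also have "\<dots> = integral (cbox 0 1) (\<lambda>t. (x - p) $ 1 * dd h (p + t *\<^sub>R (x - p)) (axis 1 1)
       + (x - p) $ 2 * dd h (p + t *\<^sub>R (x - p)) (axis 2 1))"
    by (rule integral_cong) (rule decomp)
  also have "\<dots> = (x - p) $ 1 * ?A (axis 1 1) x + (x - p) $ 2 * ?A (axis 2 1) x"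
    by (subst integral_add)
      (use cont in \<open>auto intro!: integrable_continuous_interval continuous_intros simp: cbox_interval\<close>)
  finally show "h x = (x - p) $ 1 * ?A (axis 1 1) x + (x - p) $ 2 * ?A (axis 2 1) x" .
qed

section \<open>Curvature of a plane metric from a coframe\<close>

text \<open>The quarter turn. In an orthonormal frame of a plane bundle with connection form
  \<open>w\<close>, a section with components \<open>v\<close> has covariant derivative
  \<open>dv + w rot v\<close>; this is the shape of the field \<open>b\<close> in the locale
  below.\<close>

definition rot :: "real^2 \<Rightarrow> real^2" where
  "rot v = vector [- v $ 2, v $ 1]"

lemma rot_nth [simp]: "rot v $ 1 = - v $ 2" "rot v $ 2 = v $ 1"
  by (simp_all add: rot_def)

lemma bounded_linear_rot: "bounded_linear rot"
  unfolding linear_conv_bounded_linear[symmetric]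
  by (intro linearI) (simp_all add: vec_eq_iff forall_2)

definition wedge :: "real^2 \<Rightarrow> real^2 \<Rightarrow> real" where
  "wedge v w = v $ 1 * w $ 2 - v $ 2 * w $ 1"

lemma smooth_on_wedge:
  "open S \<Longrightarrow> smooth_on S f \<Longrightarrow> smooth_on S g \<Longrightarrow> smooth_on S (\<lambda>y. wedge (f y) (g y))"
  unfolding wedge_def by (intro smooth_intros)

lemma wedge_zero_if_orthogonal:
  assumes "wedge v w \<noteq> 0" "v \<bullet> z = 0" "w \<bullet> z = 0"
  shows "z = (0 :: real^2)"
proof -
  have "wedge v w * z $ 1 = 0" "wedge v w * z $ 2 = 0"
    using assms(2,3) by (simp_all add: wedge_def inner_vec_def sum_2) algebra+
  then show ?thesis using assms(1) by (simp add: vec_eq_iff forall_2)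
qed

lemma matrix_inv_mult_eq:
  fixes h :: "real^'n^'n"
  assumes "det h \<noteq> 0"
  shows "h *v (matrix_inv h *v v) = v"
proof -
  have "h ** matrix_inv h = mat 1"
    using someI_ex[OF assms[folded invertible_det_nz, unfolded invertible_def]]
    by (simp add: matrix_inv_def)
  then show ?thesis by (simp add: matrix_vector_mul_assoc)
qed

text \<open>A frame \<open>a\<close> of an oriented Euclidean plane bundle with connection form \<open>w\<close>; the
  assumption \<open>torsion\<close> is the first structure equation, and the conclusion below is
  $d\omega = - K\,dA$.\<close>

locale coframe =
  fixes S :: "(real^2) set" and a :: "2 \<Rightarrow> real^2 \<Rightarrow> real^2" and w :: "2 \<Rightarrow> real^2 \<Rightarrow> real"
    and b :: "2 \<Rightarrow> 2 \<Rightarrow> real^2 \<Rightarrow> real^2" and h :: "real^2 \<Rightarrow> real^2^2"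
  assumes open_S: "open S"
    and smooth_a: "\<And>i. smooth_on S (a i)"
    and smooth_w: "\<And>i. smooth_on S (w i)"
    and b_def: "\<And>i j q. b i j q = pd i (a j) q + w i q *\<^sub>R rot (a j q)"
    and torsion: "\<And>i j q. q \<in> S \<Longrightarrow> b i j q = b j i q"
    and h_eq: "\<And>i j q. q \<in> S \<Longrightarrow> h q $ i $ j = a i q \<bullet> a j q"
begin

lemma a_diff: "q \<in> S \<Longrightarrow> a i differentiable (at q)"
  and w_diff: "q \<in> S \<Longrightarrow> w i differentiable (at q)"
  using smooth_a smooth_w by (auto intro: smooth_on_imp_differentiable)

lemma smooth_b: "smooth_on S (b i j)"
  unfolding b_def[abs_def] pd_def
  by (intro smooth_intros smooth_a smooth_w open_S bounded_linear.smooth_on_linear[OF bounded_linear_rot])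

text \<open>Metric compatibility of the connection \<open>b\<close>: the terms with \<open>w\<close>
  cancel because \<open>rot\<close> is skew.\<close>

lemma pd_h:
  assumes "q \<in> S"
  shows "pd i (\<lambda>y. h y $ j $ l) q = b i j q \<bullet> a l q + a j q \<bullet> b i l q"
proof -
  have "pd i (\<lambda>y. h y $ j $ l) q = pd i (\<lambda>y. a j y \<bullet> a l y) q"
    unfolding pd_def by (subst dd_cong[OF open_S assms h_eq]) auto
  also have "\<dots> = a j q \<bullet> pd i (a l) q + pd i (a j) q \<bullet> a l q"
    unfolding pd_def by (intro dd_inner a_diff assms)
  also have "\<dots> = b i j q \<bullet> a l q + a j q \<bullet> b i l q"
    by (simp add: b_def inner_vec_def sum_2 algebra_simps)
  finally show ?thesis .
qed

lemma det_h: "q \<in> S \<Longrightarrow> det (h q) = (wedge (a 1 q) (a 2 q))\<^sup>2"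
  by (simp add: det_2 h_eq wedge_def inner_vec_def sum_2 power2_eq_square algebra_simps)

text \<open>The connection \<open>b\<close> is metric by \<open>pd_h\<close> and torsion free, so
  the Koszul formula identifies it with the Levi-Civita connection of \<open>h\<close> carried over
  by the frame. A vector is determined by its inner products with \<open>a 1\<close> and
  \<open>a 2\<close>, since their wedge is nonzero.\<close>

lemma christoffel_frame:
  assumes q: "q \<in> S" and nz: "wedge (a 1 q) (a 2 q) \<noteq> 0"
  shows "(\<Sum>k\<in>UNIV. christoffel h q k i j *\<^sub>R a k q) = b i j q"
proof -
  define v where "v = (\<chi> l. b i j q \<bullet> a l q)"
  define u where "u = matrix_inv (h q) *v v"
  have "christoffel h q k i j = u $ k" for k
  proof -
    have "pd i (\<lambda>y. h y $ j $ l) q + pd j (\<lambda>y. h y $ i $ l) q - pd l (\<lambda>y. h y $ i $ j) q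
        = 2 * (b i j q \<bullet> a l q)" for l
      unfolding pd_h[OF q] using torsion[OF q, of j i] torsion[OF q, of l i] torsion[OF q, of l j]
      by (simp add: inner_commute)
    then show ?thesis
      by (simp add: christoffel_def u_def v_def matrix_vector_mult_def sum_distrib_left algebra_simps)
  qed
  moreover have "h q *v u = v"
    unfolding u_def by (rule matrix_inv_mult_eq) (simp add: det_h q nz)
  ultimately have "(\<Sum>k\<in>UNIV. (a l q \<bullet> a k q) * christoffel h q k i j) = b i j q \<bullet> a l q" for l
    by (simp add: vec_eq_iff v_def matrix_vector_mult_def h_eq[OF q])
  then have "a l q \<bullet> ((\<Sum>k\<in>UNIV. christoffel h q k i j *\<^sub>R a k q) - b i j q) = 0" for l
    by (simp add: inner_diff_right inner_sum_right mult.commute inner_commute[of "b i j q"])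
  from wedge_zero_if_orthogonal[OF nz this this] show ?thesis by simp
qed

text \<open>Through \<open>christoffel_frame\<close> the curvature tensor of \<open>h\<close> is
  carried over to the plane bundle, whose connection is given by rotations. Rotations of a plane
  commute, so only the exterior derivative of \<open>w\<close> survives, acting as a multiple of the
  quarter turn.\<close>

lemma metric_curvature_coframe:
  assumes q: "q \<in> S" and nz: "wedge (a 1 q) (a 2 q) \<noteq> 0"
  shows "metric_curvature h q = - (pd 1 (w 2) q - pd 2 (w 1) q) / wedge (a 1 q) (a 2 q)"
proof -
  \<comment> \<open>The frame relation will be differentiated at \<open>q\<close>, so it is needed
    on an open set around \<open>q\<close>.\<close>
  define T where "T = {y\<in>S. wedge (a 1 y) (a 2 y) \<noteq> 0}"
  have sm_wedge: "smooth_on S (\<lambda>y. wedge (a 1 y) (a 2 y))"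
    by (intro smooth_on_wedge smooth_a open_S)
  have "open (S \<inter> (\<lambda>y. wedge (a 1 y) (a 2 y)) -` (- {0}))"
    by (intro continuous_open_preimage smooth_on_imp_continuous_on sm_wedge open_S) auto
  also have "S \<inter> (\<lambda>y. wedge (a 1 y) (a 2 y)) -` (- {0}) = T" by (auto simp: T_def)
  finally have T: "open T" .
  have qT: "q \<in> T" and TS: "T \<subseteq> S" using q nz by (auto simp: T_def)
  define G where "G = (\<lambda>k i j y. christoffel h y k i j)"
  have frame: "G 1 i j y *\<^sub>R a 1 y + G 2 i j y *\<^sub>R a 2 y = b i j y" if "y \<in> T" for i j y
    using christoffel_frame[of y i j] that by (simp add: T_def G_def sum_2)
  \<comment> \<open>Cramer's rule exhibits the Christoffel symbols as quotients of smooth functions,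
    so their smoothness does not have to be traced through \<open>matrix_inv\<close>.\<close>
  have "wedge (b i j y) (a 2 y) = G 1 i j y * wedge (a 1 y) (a 2 y)"
    "wedge (a 1 y) (b i j y) = G 2 i j y * wedge (a 1 y) (a 2 y)" if "y \<in> T" for i j y
    unfolding frame[OF that, of i j, symmetric] by (simp_all add: wedge_def algebra_simps)
  then have G1: "G 1 i j y = wedge (b i j y) (a 2 y) / wedge (a 1 y) (a 2 y)"
    and G2: "G 2 i j y = wedge (a 1 y) (b i j y) / wedge (a 1 y) (a 2 y)" if "y \<in> T" for i j y
    using that by (simp_all add: T_def)
  have smT: "smooth_on T (a i)" "smooth_on T (b i j)" for i j
    using smooth_a smooth_b TS by (auto intro: smooth_on_subset)
  have smG: "smooth_on T (G k i j)" for k i j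
  proof -
    have "smooth_on T (G 1 i j)"
      by (subst smooth_on_cong[OF T G1], assumption)
        (intro smooth_on_divide smooth_on_wedge smT T; simp add: T_def)
    moreover have "smooth_on T (G 2 i j)"
      by (subst smooth_on_cong[OF T G2], assumption)
        (intro smooth_on_divide smooth_on_wedge smT T; simp add: T_def)
    ultimately show ?thesis using exhaust_2[of k] by auto
  qed
  have dG: "G k i j differentiable (at q)" for k i j
    by (rule smooth_on_imp_differentiable[OF smG qT])
  note da = a_diff[OF q] and dw = w_diff[OF q]
  have scaleR: "pd m (\<lambda>y. f y *\<^sub>R g y) q = f q *\<^sub>R pd m g q + pd m f q *\<^sub>R g q"
    if "f differentiable (at q)" "g differentiable (at q)"
    for m and f :: "real^2 \<Rightarrow> real" and g :: "real^2 \<Rightarrow> real^2"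
    unfolding pd_def using bounded_bilinear.dd_bilinear[OF bounded_bilinear_scaleR that] .
  have dsc: "(\<lambda>y. f y *\<^sub>R g y) differentiable (at q)"
    if "f differentiable (at q)" "g differentiable (at q)"
    for f :: "real^2 \<Rightarrow> real" and g :: "real^2 \<Rightarrow> real^2"
    using that by (rule bounded_bilinear.differentiable_bilinear[OF bounded_bilinear_scaleR])
  \<comment> \<open>The derivative of \<open>b\<close> is computed in two ways: here through the
    Christoffel symbols, in \<open>e2\<close> through the connection form.\<close>
  have e1: "pd m (b i j) q = G 1 i j q *\<^sub>R pd m (a 1) q + pd m (G 1 i j) q *\<^sub>R a 1 q
      + (G 2 i j q *\<^sub>R pd m (a 2) q + pd m (G 2 i j) q *\<^sub>R a 2 q)" for m i j
  proof -
    have "pd m (b i j) q = pd m (\<lambda>y. G 1 i j y *\<^sub>R a 1 y + G 2 i j y *\<^sub>R a 2 y) q"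
      unfolding pd_def by (subst dd_cong[OF T qT frame[symmetric]]) auto
    also have "\<dots> = pd m (\<lambda>y. G 1 i j y *\<^sub>R a 1 y) q + pd m (\<lambda>y. G 2 i j y *\<^sub>R a 2 y) q"
      unfolding pd_def by (intro dd_add dsc dG da)
    finally show ?thesis by (simp add: scaleR dG da)
  qed
  have drot: "(\<lambda>y. rot (a j y)) differentiable (at q)"
    "pd m (\<lambda>y. rot (a j y)) q = rot (pd m (a j) q)" for m j
    using bounded_linear.dd_linear[OF bounded_linear_rot da, of j "axis m 1"]
      differentiable_compose[OF bounded_linear_imp_differentiable[OF bounded_linear_rot] da, of j]
    by (auto simp: pd_def)
  have e2: "pd m (b i j) q = pd m (pd i (a j)) q + (w i q *\<^sub>R rot (pd m (a j) q) + pd m (w i) q *\<^sub>R rot (a j q))"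
    for m i j
  proof -
    have dpd: "pd i (a j) differentiable (at q)"
      unfolding pd_def[abs_def]
      by (rule smooth_on_imp_differentiable[OF smooth_on_dd[OF open_S smooth_a] q])
    have "pd m (b i j) q = pd m (\<lambda>y. pd i (a j) y + w i y *\<^sub>R rot (a j y)) q"
      by (simp add: b_def[abs_def])
    also have "\<dots> = pd m (pd i (a j)) q + pd m (\<lambda>y. w i y *\<^sub>R rot (a j y)) q"
      unfolding pd_def[of m] by (intro dd_add dpd dsc dw drot)
    finally show ?thesis by (simp add: scaleR dw drot)
  qed
  have comm: "pd 1 (pd 2 (a 2)) q = pd 2 (pd 1 (a 2)) q"
    unfolding pd_def[abs_def] by (rule dd_commute[OF open_S q smooth_a])
  have R: "riemann h q l 2 1 2 = pd 1 (G l 2 2) q - pd 2 (G l 1 2) q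
      + (G l 1 1 q * G 1 2 2 q - G l 2 1 q * G 1 1 2 q + (G l 1 2 q * G 2 2 2 q - G l 2 2 q * G 2 1 2 q))" for l
    by (simp add: riemann_def G_def sum_2)
  have F: "G 1 i j q * a 1 q $ n + G 2 i j q * a 2 q $ n = b i j q $ n" for i j n
    using arg_cong[OF frame[OF qT, of i j], of "\<lambda>v. v $ n"] by simp
  define k where "k = pd 1 (w 2) q - pd 2 (w 1) q"
  have eq2: "pd m (b i j) q $ n = G 1 i j q * pd m (a 1) q $ n + pd m (G 1 i j) q * a 1 q $ n
      + (G 2 i j q * pd m (a 2) q $ n + pd m (G 2 i j) q * a 2 q $ n)" for m i j n
    unfolding e1 by simp
  \<comment> \<open>The quadratic Christoffel terms of \<open>riemann\<close> are absorbed by the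
    frame relation. What is left pairs \<open>b\<close> with derivatives of \<open>a\<close>, and by
    \<open>bp\<close> each difference is \<open>w\<close> times a rotated frame vector.\<close>
  have R1: "riemann h q 1 2 1 2 * a 1 q $ n + riemann h q 2 2 1 2 * a 2 q $ n =
      pd 1 (b 2 2) q $ n - pd 2 (b 1 2) q $ n
      + G 1 2 2 q * (b 1 1 q $ n - pd 1 (a 1) q $ n) + G 2 2 2 q * (b 1 2 q $ n - pd 1 (a 2) q $ n)
      - G 1 1 2 q * (b 2 1 q $ n - pd 2 (a 1) q $ n) - G 2 1 2 q * (b 2 2 q $ n - pd 2 (a 2) q $ n)" for n
    unfolding R eq2 F[symmetric, of _ _ n] by (simp add: algebra_simps)
  have bp: "b m j q $ n - pd m (a j) q $ n = w m q * rot (a j q) $ n" for m j n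
    by (simp add: b_def)
  have rotF: "G 1 i j q * rot (a 1 q) $ n + G 2 i j q * rot (a 2 q) $ n = rot (b i j q) $ n" for i j n
    using F[of i j 1] F[of i j 2] exhaust_2[of n] by auto
  have R2: "riemann h q 1 2 1 2 * a 1 q $ n + riemann h q 2 2 1 2 * a 2 q $ n =
      pd 1 (b 2 2) q $ n - pd 2 (b 1 2) q $ n + w 1 q * rot (b 2 2 q) $ n - w 2 q * rot (b 1 2 q) $ n" for n
    unfolding R1 bp rotF[symmetric] by (simp add: algebra_simps)
  \<comment> \<open>The second derivatives of \<open>a 2\<close> cancel by \<open>comm\<close>, the
    terms with one derivative of \<open>a 2\<close> cancel in pairs, and so do the two terms with
    \<open>w 1 q * w 2 q\<close>.\<close>
  have RA: "riemann h q 1 2 1 2 * a 1 q $ n + riemann h q 2 2 1 2 * a 2 q $ n = k * rot (a 2 q) $ n" for n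
    unfolding R2 e2 k_def comm using exhaust_2[of n]
    by (elim disjE) (simp_all add: b_def algebra_simps)
  have "(\<Sum>l\<in>UNIV. h q $ l $ 1 * riemann h q l 2 1 2) = - k * wedge (a 1 q) (a 2 q)"
  proof -
    have "(\<Sum>l\<in>UNIV. h q $ l $ 1 * riemann h q l 2 1 2) =
      a 1 q $ 1 * (riemann h q 1 2 1 2 * a 1 q $ 1 + riemann h q 2 2 1 2 * a 2 q $ 1) +
      a 1 q $ 2 * (riemann h q 1 2 1 2 * a 1 q $ 2 + riemann h q 2 2 1 2 * a 2 q $ 2)"
      by (simp add: sum_2 h_eq[OF q] inner_vec_def algebra_simps)
    then show ?thesis unfolding RA by (simp add: wedge_def algebra_simps)
  qed
  then show ?thesis
    using nz by (simp add: metric_curvature_def det_h[OF q] k_def power2_eq_square)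
qed

end

section \<open>Rational boundedness of quotients\<close>

lemma finite_if_subsingleton:
  assumes "\<And>x y. x \<in> A \<Longrightarrow> y \<in> A \<Longrightarrow> x = y"
  shows "finite A"
proof (cases "A = {}")
  case False
  then obtain x where "x \<in> A" by blast
  then have "A \<subseteq> {x}" using assms by blast
  then show ?thesis by (rule finite_subset) simp
qed simp

text \<open>The lift of the blow-down to the covering plane, written with axis vectors so that the
  rules for sums and scalar multiples yield smoothness and derivatives.\<close>

definition polar :: "real^2 \<Rightarrow> real \<times> real \<Rightarrow> real^2" where
  "polar p x = p + ((fst x * cos (snd x)) *\<^sub>R axis 1 1 + (fst x * sin (snd x)) *\<^sub>R axis 2 1)"

lemma blow_down_proj: "blow_down p (moebius_proj x) = polar p x"
proof -
  obtain r t where x: "x = (r, t)" by fastforce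
  show ?thesis unfolding x blow_down_def blow_down_0_proj polar_def
    by (simp add: vec_eq_iff forall_2 axis_def)
qed

lemma polar_eq_center_iff: "polar p x = p \<longleftrightarrow> fst x = 0"
proof -
  have "polar p x = p \<longleftrightarrow> fst x * cos (snd x) = 0 \<and> fst x * sin (snd x) = 0"
    by (simp add: polar_def vec_eq_iff forall_2 axis_def)
  also have "\<dots> \<longleftrightarrow> fst x = 0"
    using sin_zero_abs_cos_one[of "snd x"] by auto
  finally show ?thesis .
qed

lemma smooth_on_polar: "open S \<Longrightarrow> smooth_on S (polar p)"
  unfolding polar_def[abs_def]
  by (intro smooth_intros bounded_linear.smooth_on_linear[OF bounded_linear_fst]
      bounded_linear.smooth_on_linear[OF bounded_linear_snd])

lemma continuous_on_polar: "continuous_on S (polar p)"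
  unfolding polar_def[abs_def] by (intro continuous_intros)

lemma open_polar_vimage: "open W \<Longrightarrow> open (polar p -` W)"
  by (rule open_vimage[OF _ continuous_on_polar])

section \<open>Points and functions on the Moebius strip\<close>

lemma surj_moebius_proj: "\<exists>x. q = moebius_proj x"
  unfolding moebius_proj_def by (metis Quotient3_abs_rep Quotient3_moebius)

lemma moebius_proj_eq_iff: "moebius_proj x = moebius_proj y \<longleftrightarrow> moebius_rel x y"
  unfolding moebius_proj_def by (rule moebius.abs_eq_iff)

text \<open>Full turns and the flip account for both disjuncts of \<open>moebius_rel\<close>, so
  invariance under them lets a function descend. The functions \<open>\<rho>\<close> and
  \<open>\<psi>\<close> of a rationally bounded quotient are built this way.\<close>

lemma moebius_lift:
  assumes "\<And>r t k. f (r, t + 2 * pi * of_int k) = f (r, t)" "\<And>r t. f (- r, t + pi) = f (r, t)"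
  obtains F where "\<And>x. F (moebius_proj x) = f x"
proof
  have resp: "f x = f y" if "moebius_rel x y" for x y
    using that unfolding moebius_rel_def
  proof (elim disjE conjE exE)
    fix k :: int assume "fst y = fst x" "snd y = snd x + 2 * pi * of_int k"
    then show "f x = f y" using assms(1)[of "fst x" "snd x" k] by (metis prod.collapse)
  next
    fix k :: int assume "fst y = - fst x" "snd y = snd x + pi + 2 * pi * of_int k"
    then show "f x = f y"
      using assms(1)[of "- fst x" "snd x + pi" k] assms(2)[of "fst x" "snd x"] by (metis prod.collapse)
  qed
  fix x
  have "moebius_proj (rep_moebius (moebius_proj x)) = moebius_proj x"
    unfolding moebius_proj_def by (metis Quotient3_abs_rep Quotient3_moebius)
  then show "(f \<circ> rep_moebius) (moebius_proj x) = f x"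
    unfolding moebius_proj_eq_iff by (simp add: resp)
qed

lemma moebius_smooth_on_blow_down:
  "moebius_smooth_on (blow_down p -` W) F \<longleftrightarrow> smooth_on (polar p -` W) (F \<circ> moebius_proj)"
proof -
  have "moebius_proj -` (blow_down p -` W) = polar p -` W" by (auto simp: blow_down_proj)
  then show ?thesis by (simp add: moebius_smooth_on_def)
qed

text \<open>A nonzero linear form vanishes on a single line through the origin, and the two
  directions of a line are the same point of the exceptional circle. Both directions of the
  equivalence use this to bound the number of exceptional directions.\<close>

lemma moebius_rel_if_same_direction:
  assumes "c * cos s + d * sin s = 0" "c * cos t + d * sin t = 0" "c \<noteq> 0 \<or> d \<noteq> (0::real)"
  shows "moebius_rel (0, s) (0, t)"
proof -
  have "c * sin (t - s) = 0" "d * sin (t - s) = 0"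
    using assms(1,2) unfolding sin_diff by algebra+
  then have "sin (t - s) = 0" using assms(3) by auto
  then obtain k :: int where "t - s = of_int k * pi" by (auto simp: sin_zero_iff_int2)
  then show ?thesis unfolding moebius_rel_iff by (intro exI[of _ k]) (auto simp: algebra_simps)
qed

text \<open>The exceptional circle has angular length \<open>pi\<close>, not \<open>2 * pi\<close>.
  Injectivity turns its finite subsets into finite sets of angles.\<close>

lemma inj_on_moebius_proj_circle: "inj_on (\<lambda>t. moebius_proj (0, t)) {0..<pi}"
proof (rule inj_onI)
  fix s t assume s: "s \<in> {0..<pi}" and t: "t \<in> {0..<pi}" and "moebius_proj (0, s) = moebius_proj (0, t)"
  then obtain k :: int where k: "t = s + pi * of_int k"
    by (auto simp: moebius_proj_eq_iff moebius_rel_iff)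
  then have "pi * of_int k < pi * 1" "pi * (-1) < pi * of_int k"
    using s t unfolding atLeastLessThan_iff by linarith+
  then have "of_int k < (1::real)" "(-1::real) < of_int k"
    unfolding mult_less_cancel_left_pos[OF pi_gt_zero] by blast+
  then have "k = 0" by linarith
  then show "s = t" using k by simp
qed

lemma dd_axis:
  assumes "linear (l :: real^2 \<Rightarrow> real)"
  shows "l v = v $ 1 * l (axis 1 1) + v $ 2 * l (axis 2 1)"
proof -
  have "v = v $ 1 *\<^sub>R axis 1 1 + v $ 2 *\<^sub>R (axis 2 1 :: real^2)"
    by (simp add: vec_eq_iff forall_2 axis_def)
  then have "l v = l (v $ 1 *\<^sub>R axis 1 1 + v $ 2 *\<^sub>R axis 2 1)" by simp
  then show ?thesis using assms by (simp add: linear_add linear_cmul)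
qed

text \<open>Approaching \<open>p\<close> along a generic ray, \<open>\<phi>\<close> grows like \<open>k p\<close> over the distance to \<open>p\<close>,
  while \<open>\<rho>\<close> has a nonzero limit.\<close>

lemma rationally_bounded_imp_numerator_zero:
  assumes r: "r > 0" and sm: "smooth_on (ball p r) d" "smooth_on (ball p r) k"
    and d0: "d p = 0" and nz: "dd d p \<noteq> (\<lambda>_. 0)"
    and rb: "rationally_bounded p W D \<phi>"
    and D: "\<And>q. q \<in> W \<Longrightarrow> q \<in> ball p r \<Longrightarrow> q \<in> D \<longleftrightarrow> d q \<noteq> 0"
    and eq: "\<And>q. q \<in> D \<Longrightarrow> q \<in> ball p r \<Longrightarrow> \<phi> q * d q = k q"
  shows "k p = 0"
proof -
  from rb obtain \<rho> \<psi> where W: "open W" "p \<in> W"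
    and sm\<rho>: "moebius_smooth_on (blow_down p -` W) \<rho>"
    and fin: "finite (\<rho> -` {0} \<inter> blow_down p -` {p})"
    and sm\<psi>: "moebius_smooth_on (blow_down p -` W) \<psi>"
    and \<psi>: "\<forall>q\<in>blow_down p -` D. \<psi> q = \<rho> q * \<phi> (blow_down p q)"
    unfolding rationally_bounded_def by (elim conjE exE) (rule that)
  have pr: "p \<in> ball p r" using r by simp
  have dd: "(d has_derivative dd d p) (at p)" by (rule smooth_on_has_derivative[OF sm(1) pr])
  note lin = has_derivative_linear[OF dd]
  define c1 where "c1 = dd d p (axis 1 1)"
  define c2 where "c2 = dd d p (axis 2 1)"
  have c: "c1 \<noteq> 0 \<or> c2 \<noteq> 0"
  proof (rule ccontr)
    assume "\<not> ?thesis"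
    then have "dd d p v = 0" for v
      using dd_axis[OF lin, of v] by (simp add: c1_def c2_def)
    then show False using nz by auto
  qed
  \<comment> \<open>Two kinds of directions have to be avoided: those in which the derivative of
    \<open>d\<close> vanishes, and those where \<open>\<rho>\<close> vanishes on the exceptional
    circle. Both sets are finite, so some angle escapes them.\<close>
  define B1 where "B1 = {t\<in>{0..<pi}. c1 * cos t + c2 * sin t = 0}"
  define B2 where "B2 = {t\<in>{0..<pi}. moebius_proj (0, t) \<in> \<rho> -` {0} \<inter> blow_down p -` {p}}"
  have "s = t" if "s \<in> B1" "t \<in> B1" for s t
  proof -
    have "moebius_proj (0, s) = moebius_proj (0, t)"
      using moebius_rel_if_same_direction[OF _ _ c, of s t] that
      by (simp add: B1_def moebius_proj_eq_iff)
    then show ?thesis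
      by (rule inj_onD[OF inj_on_moebius_proj_circle]) (use that in \<open>auto simp: B1_def\<close>)
  qed
  then have "finite B1" by (rule finite_if_subsingleton)
  moreover have "finite B2"
    unfolding B2_def by (rule finite_subset[OF _ finite_vimage_IntI[OF fin inj_on_moebius_proj_circle]]) auto
  moreover have "infinite {0..<pi}" by (simp add: infinite_Ico)
  ultimately have "\<not> {0..<pi} \<subseteq> B1 \<union> B2" by (meson finite_UnI finite_subset)
  then obtain t where "t \<in> {0..<pi}" "t \<notin> B1" "t \<notin> B2" by blast
  then have t: "c1 * cos t + c2 * sin t \<noteq> 0"
    "moebius_proj (0, t) \<notin> \<rho> -` {0} \<inter> blow_down p -` {p}"
    unfolding B1_def B2_def by blast+
  have \<rho>0: "\<rho> (moebius_proj (0, t)) \<noteq> 0"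
    using t(2) by (simp add: blow_down_proj polar_eq_center_iff)
  have p0: "polar p (0, t) = p" by (simp add: polar_eq_center_iff)
  have ray: "((\<lambda>s. polar p (s, t)) \<longlongrightarrow> p) (at 0)"
    unfolding polar_def by (auto intro!: tendsto_eq_intros)
  have lift: "((\<lambda>s. F (moebius_proj (s, t))) \<longlongrightarrow> F (moebius_proj (0, t))) (at 0)"
    if "moebius_smooth_on (blow_down p -` W) F" for F
  proof -
    have "continuous_on (polar p -` W) (F \<circ> moebius_proj)"
      using that unfolding moebius_smooth_on_blow_down by (rule smooth_on_imp_continuous_on)
    then have "isCont (F \<circ> moebius_proj) (0, t)"
      using open_polar_vimage[OF W(1), of p] W(2) p0
      by (simp add: continuous_on_eq_continuous_at del: o_apply)
    moreover have "((\<lambda>s. (s, t)) \<longlongrightarrow> (0, t)) (at 0)" by (intro tendsto_intros)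
    ultimately have "((\<lambda>s. (F \<circ> moebius_proj) (s, t)) \<longlongrightarrow> (F \<circ> moebius_proj) (0, t)) (at 0)"
      by (rule isCont_tendsto_compose)
    then show ?thesis by (simp only: o_apply)
  qed
  have "((\<lambda>s. d (polar p (s, t))) has_derivative
      (\<lambda>h. dd d (polar p (0, t)) ((h * cos t) *\<^sub>R axis 1 1 + (h * sin t) *\<^sub>R axis 2 1))) (at 0)"
  proof (rule has_derivative_compose[where f = "\<lambda>s. polar p (s, t)"])
    show "((\<lambda>s. polar p (s, t)) has_derivative (\<lambda>h. (h * cos t) *\<^sub>R axis 1 1 + (h * sin t) *\<^sub>R axis 2 1)) (at 0)"
      unfolding polar_def by (auto intro!: derivative_eq_intros)
    show "(d has_derivative dd d (polar p (0, t))) (at (polar p (0, t)))"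
      using dd by (simp add: p0)
  qed
  then have "((\<lambda>s. d (polar p (s, t))) has_real_derivative (c1 * cos t + c2 * sin t)) (at 0)"
    unfolding has_field_derivative_def p0
    by (rule has_derivative_eq_rhs) (auto simp: linear_add[OF lin] linear_cmul[OF lin] c1_def c2_def algebra_simps)
  \<comment> \<open>The nonzero limit keeps \<open>d\<close> away from zero on the ray near
    \<open>p\<close>, so that this part of the ray lies in \<open>D\<close>.\<close>
  then have "((\<lambda>s. d (polar p (s, t)) / s) \<longlongrightarrow> c1 * cos t + c2 * sin t) (at 0)"
    by (simp add: DERIV_def p0 d0)
  then have ev1: "\<forall>\<^sub>F s in at 0. d (polar p (s, t)) / s \<noteq> 0"
    using t(1) by (rule tendsto_imp_eventually_ne)
  have ev2: "\<forall>\<^sub>F s in at 0. polar p (s, t) \<in> W \<inter> ball p r"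
    using ray by (rule topological_tendstoD) (use W r in auto)
  have lim: "((\<lambda>s. f (polar p (s, t))) \<longlongrightarrow> f p) (at 0)" if "smooth_on (ball p r) f" for f :: "real^2 \<Rightarrow> real"
  proof -
    have "isCont f p"
      using smooth_on_imp_continuous_on[OF that] pr by (simp add: continuous_on_eq_continuous_at)
    then show ?thesis using ray by (rule isCont_tendsto_compose)
  qed
  \<comment> \<open>No quotient is formed: \<open>\<psi>\<close> times \<open>d\<close> equals
    \<open>\<rho>\<close> times \<open>k\<close> along the ray. The left side tends to 0 with
    \<open>d\<close>, the right side to a nonzero multiple of \<open>k p\<close>.\<close>
  have L: "((\<lambda>s. \<psi> (moebius_proj (s, t)) * d (polar p (s, t))) \<longlongrightarrow> \<psi> (moebius_proj (0, t)) * d p) (at 0)"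
    by (intro tendsto_mult lift sm\<psi> lim sm)
  have R: "((\<lambda>s. \<rho> (moebius_proj (s, t)) * k (polar p (s, t))) \<longlongrightarrow> \<rho> (moebius_proj (0, t)) * k p) (at 0)"
    by (intro tendsto_mult lift sm\<rho> lim sm)
  have "\<forall>\<^sub>F s in at 0. \<psi> (moebius_proj (s, t)) * d (polar p (s, t)) = \<rho> (moebius_proj (s, t)) * k (polar p (s, t))"
    using ev1 ev2
  proof eventually_elim
    case (elim s)
    then have q: "polar p (s, t) \<in> D" using D by auto
    then have "\<psi> (moebius_proj (s, t)) = \<rho> (moebius_proj (s, t)) * \<phi> (polar p (s, t))"
      using bspec[OF \<psi>, of "moebius_proj (s, t)"] by (simp add: blow_down_proj)
    then show ?case using eq[OF q] elim by (simp add: mult.assoc)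
  qed
  then have "((\<lambda>s. \<psi> (moebius_proj (s, t)) * d (polar p (s, t))) \<longlongrightarrow> \<rho> (moebius_proj (0, t)) * k p) (at 0)"
    using R by (simp add: tendsto_cong)
  then have "\<psi> (moebius_proj (0, t)) * d p = \<rho> (moebius_proj (0, t)) * k p"
    using L tendsto_unique trivial_limit_at by blast
  then show ?thesis using d0 \<rho>0 by simp
qed

text \<open>By Hadamard's lemma both functions are divisible by the radius in polar coordinates,
  with smooth quotients \<open>l\<close> and \<open>m\<close>, and \<open>\<phi>\<close> is
  \<open>m / l\<close> where \<open>d\<close> is nonzero. On the exceptional circle \<open>l\<close>
  is the derivative of \<open>d\<close> in the given direction.\<close>

lemma rationally_bounded_if_numerator_zero:
  assumes r: "r > 0" and sm: "smooth_on (ball p r) d" "smooth_on (ball p r) k"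
    and d0: "d p = 0" and k0: "k p = 0" and nz: "dd d p \<noteq> (\<lambda>_. 0)"
    and D: "\<And>q. q \<in> ball p r \<Longrightarrow> q \<in> D \<longleftrightarrow> d q \<noteq> 0"
    and eq: "\<And>q. q \<in> D \<Longrightarrow> q \<in> ball p r \<Longrightarrow> \<phi> q * d q = k q"
  shows "\<exists>W. W \<subseteq> ball p r \<and> rationally_bounded p W (W \<inter> D) \<phi>"
proof -
  have pr: "p \<in> ball p r" using r by simp
  obtain A1 B1 where AB1: "smooth_on (ball p r) A1" "smooth_on (ball p r) B1"
    "\<And>x. x \<in> ball p r \<Longrightarrow> d x = (x - p) $ 1 * A1 x + (x - p) $ 2 * B1 x"
    using hadamard[OF sm(1) d0] by blast
  obtain A2 B2 where AB2: "smooth_on (ball p r) A2" "smooth_on (ball p r) B2"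
    "\<And>x. x \<in> ball p r \<Longrightarrow> k x = (x - p) $ 1 * A2 x + (x - p) $ 2 * B2 x"
    using hadamard[OF sm(2) k0] by blast
  obtain e where e: "dd d p e \<noteq> 0" using nz by auto
  \<comment> \<open>\<open>A1 p\<close> and \<open>B1 p\<close> are the partial derivatives of
    \<open>d\<close> at \<open>p\<close>.\<close>
  have AB0: "A1 p \<noteq> 0 \<or> B1 p \<noteq> 0"
  proof -
    have "dd d p e = dd (\<lambda>x. (x - p) $ 1 * A1 x + (x - p) $ 2 * B1 x) p e"
      by (subst dd_cong[OF open_ball pr AB1(3)]) auto
    also have "\<dots> = e $ 1 * A1 p + e $ 2 * B1 p"
    proof (subst dd_eqI)
      show "((\<lambda>x. (x - p) $ 1 * A1 x + (x - p) $ 2 * B1 x) has_derivative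
        (\<lambda>v. v $ 1 * A1 p + v $ 2 * B1 p)) (at p)"
        using smooth_on_has_derivative[OF AB1(1) pr] smooth_on_has_derivative[OF AB1(2) pr]
        by (auto intro!: derivative_eq_intros bounded_linear.has_derivative[OF bounded_linear_vec_nth])
    qed simp
    finally show ?thesis using e by auto
  qed
  \<comment> \<open>Shrinking to a ball on which the derivative of \<open>d\<close> along
    \<open>e\<close> has no zero ensures that \<open>d\<close> vanishes on no open subset. This
    gives the density required of \<open>W \<inter> D\<close>.\<close>
  have "isCont (\<lambda>q. dd d q e) p"
    using smooth_on_imp_continuous_on[OF smooth_on_dd[OF open_ball sm(1)]] pr
    by (simp add: continuous_on_eq_continuous_at)
  then obtain s0 where s0: "s0 > 0" "\<And>q. dist p q < s0 \<Longrightarrow> dd d q e \<noteq> 0"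
    using continuous_at_avoid[of p "\<lambda>q. dd d q e" 0] e by auto
  define s where "s = min s0 r"
  define W where "W = ball p s"
  have s: "s > 0" and W: "W \<subseteq> ball p r" "open W" "p \<in> W" and ndW: "\<And>q. q \<in> W \<Longrightarrow> dd d q e \<noteq> 0"
    using s0 r by (auto simp: W_def s_def)
  have Wd: "q \<in> W \<inter> D \<longleftrightarrow> q \<in> W \<and> d q \<noteq> 0" for q using D W(1) by auto
  have "open (W \<inter> d -` (- {0}))"
    by (intro continuous_open_preimage smooth_on_imp_continuous_on smooth_on_subset[OF sm(1) W(1)] W) auto
  moreover have "W \<inter> d -` (- {0}) = W \<inter> D" using Wd by auto
  ultimately have oD: "open (W \<inter> D)" by simp
  have cl: "W \<subseteq> closure (W \<inter> D)"
  proof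
    fix q assume q: "q \<in> W"
    show "q \<in> closure (W \<inter> D)"
    proof (rule ccontr)
      assume n: "q \<notin> closure (W \<inter> D)"
      define T where "T = W - closure (W \<inter> D)"
      have T: "open T" "q \<in> T" using q n W by (auto simp: T_def)
      have "dd d q = dd (\<lambda>_. 0 :: real) q"
        by (rule dd_cong[OF T]) (use Wd closure_subset[of "W \<inter> D"] in \<open>unfold T_def, blast\<close>)
      then show False using ndW[OF q] by simp
    qed
  qed
  have "smooth_on (W \<inter> D) (\<lambda>q. k q / d q)"
    by (rule smooth_on_divide[OF oD]) (use sm W Wd in \<open>auto intro: smooth_on_subset\<close>)
  then have smphi: "smooth_on (W \<inter> D) \<phi>"
  proof (subst smooth_on_cong[OF oD])
    fix q assume q: "q \<in> W \<inter> D"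
    then have "d q \<noteq> 0" using Wd by blast
    moreover have "\<phi> q * d q = k q" using q W by (intro eq) auto
    ultimately show "\<phi> q = k q / d q" by (simp add: field_simps)
  qed
  define l where "l = (\<lambda>x. cos (snd x) * A1 (polar p x) + sin (snd x) * B1 (polar p x))"
  define m where "m = (\<lambda>x. cos (snd x) * A2 (polar p x) + sin (snd x) * B2 (polar p x))"
  have polar_nth: "(polar p x - p) $ 1 = fst x * cos (snd x)" "(polar p x - p) $ 2 = fst x * sin (snd x)" for x
    by (simp_all add: polar_def axis_def)
  have dl: "d (polar p x) = fst x * l x" and km: "k (polar p x) = fst x * m x" if "polar p x \<in> W" for x
    using AB1(3)[of "polar p x"] AB2(3)[of "polar p x"] that W(1)
    unfolding polar_nth by (auto simp: l_def m_def algebra_simps)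
  have per: "l (u, t + 2 * pi * of_int j) = l (u, t)" "m (u, t + 2 * pi * of_int j) = m (u, t)"
    "l (- u, t + pi) = - l (u, t)" "m (- u, t + pi) = - m (u, t)" for u t and j :: int
    by (simp_all add: l_def m_def polar_def cos_add sin_add cos_int_2pin sin_int_2pin)
  \<comment> \<open>Both \<open>l\<close> and \<open>m\<close> are odd under the flip and do not
    descend to the strip. The products \<open>l\<^sup>2\<close> and \<open>l * m\<close> are even,
    and their ratio is still \<open>m / l\<close>.\<close>
  obtain \<rho> where \<rho>: "\<And>x. \<rho> (moebius_proj x) = (l x)\<^sup>2"
    by (rule moebius_lift[of "\<lambda>x. (l x)\<^sup>2"]) (auto simp: per)
  obtain \<psi> where \<psi>: "\<And>x. \<psi> (moebius_proj x) = l x * m x"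
    by (rule moebius_lift[of "\<lambda>x. l x * m x"]) (auto simp: per)
  define V where "V = polar p -` W"
  have V: "open V" unfolding V_def by (rule open_polar_vimage[OF W(2)])
  have smV: "smooth_on V (\<lambda>x. f (polar p x))" if "smooth_on (ball p r) f" for f :: "real^2 \<Rightarrow> real"
    by (rule smooth_on_compose[OF V open_ball smooth_on_polar[OF V] that]) (use W in \<open>auto simp: V_def\<close>)
  have sml: "smooth_on V l" "smooth_on V m"
    unfolding l_def m_def
    by (intro smooth_intros smV AB1 AB2 V bounded_linear.smooth_on_linear[OF bounded_linear_snd])+
  have sm\<rho>: "moebius_smooth_on (blow_down p -` W) \<rho>"
    unfolding moebius_smooth_on_blow_down o_def \<rho> V_def[symmetric] by (intro smooth_intros sml V)
  have sm\<psi>: "moebius_smooth_on (blow_down p -` W) \<psi>"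
    unfolding moebius_smooth_on_blow_down o_def \<psi> V_def[symmetric] by (intro smooth_intros sml V)
  have a: "blow_down p -` (W \<inter> D - {p}) = blow_down p -` (W - {p}) \<inter> \<rho> -` (UNIV - {0})"
  proof (rule set_eqI)
    fix q :: moebius
    obtain x where q: "q = moebius_proj x" using surj_moebius_proj by blast
    have "d (polar p x) = 0 \<longleftrightarrow> polar p x = p \<or> l x = 0" if "polar p x \<in> W"
      by (simp add: dl[OF that] polar_eq_center_iff)
    then have "polar p x \<in> W \<inter> D - {p} \<longleftrightarrow> polar p x \<in> W - {p} \<and> l x \<noteq> 0"
      using Wd[of "polar p x"] by blast
    then show "q \<in> blow_down p -` (W \<inter> D - {p}) \<longleftrightarrow> q \<in> blow_down p -` (W - {p}) \<inter> \<rho> -` (UNIV - {0})"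
      by (simp add: q blow_down_proj \<rho>)
  qed
  \<comment> \<open>On the exceptional circle \<open>l\<close> is the linear form with coefficients
    \<open>A1 p\<close> and \<open>B1 p\<close>, which has only one zero up to
    identification.\<close>
  have "q = q'" if "q \<in> \<rho> -` {0} \<inter> blow_down p -` {p}" "q' \<in> \<rho> -` {0} \<inter> blow_down p -` {p}" for q q'
  proof -
    obtain x x' where q: "q = moebius_proj x" "q' = moebius_proj x'" using surj_moebius_proj by blast
    have "fst x = 0" "fst x' = 0" "l x = 0" "l x' = 0" "polar p x = p" "polar p x' = p"
      using that by (auto simp: q blow_down_proj polar_eq_center_iff \<rho>)
    then show ?thesis
      using moebius_rel_if_same_direction[of "A1 p" "snd x" "B1 p" "snd x'"] AB0
      unfolding q moebius_proj_eq_iff by (cases x, cases x') (simp add: l_def mult.commute)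
  qed
  then have b: "finite (\<rho> -` {0} \<inter> blow_down p -` {p})"
    by (rule finite_if_subsingleton)
  have c: "\<psi> q = \<rho> q * \<phi> (blow_down p q)" if "q \<in> blow_down p -` (W \<inter> D)" for q
  proof -
    obtain x where q: "q = moebius_proj x" using surj_moebius_proj by blast
    then have x: "polar p x \<in> W \<inter> D" using that by (simp add: blow_down_proj)
    then have "d (polar p x) \<noteq> 0" using Wd by blast
    moreover have "\<phi> (polar p x) * d (polar p x) = k (polar p x)" using eq x W by auto
    ultimately show ?thesis using dl[of x] km[of x] x
      by (simp add: q blow_down_proj \<rho> \<psi> power2_eq_square algebra_simps)
  qed
  show ?thesis
    unfolding rationally_bounded_def
    by (intro exI[of _ W] exI[of _ \<rho>] exI[of _ \<psi>] conjI ballI W oD cl smphi sm\<rho> sm\<psi> a b c Int_lower1)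
qed

section \<open>Covariant derivatives along a frontal in a chart\<close>

lemma linear_dd_smooth: "smooth_on S f \<Longrightarrow> x \<in> S \<Longrightarrow> linear (dd f x)"
  by (intro linear_dd smooth_on_imp_differentiable)

text \<open>\<open>first_kind\<close> is the Christoffel symbol of the first kind, as a trilinear form, and
  \<open>cov X x v Z\<close> is $\langle\nabla_v X, Z\rangle$ for a field \<open>X\<close> along \<open>F\<close>.\<close>

locale frontal_chart =
  fixes G :: "real^3 \<Rightarrow> real^3^3" and Y :: "(real^3) set"
    and F n :: "real^2 \<Rightarrow> real^3" and W :: "(real^2) set"
  assumes open_Y: "open Y" and smooth_G: "smooth_on Y G"
    and G_sym: "\<And>y. y \<in> Y \<Longrightarrow> transpose (G y) = G y"
    and G_pos: "\<And>y v. y \<in> Y \<Longrightarrow> v \<noteq> 0 \<Longrightarrow> v \<bullet> (G y *v v) > 0"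
    and open_W: "open W" and smooth_F: "smooth_on W F" and F_in: "\<And>x. x \<in> W \<Longrightarrow> F x \<in> Y"
    and smooth_n: "smooth_on W n"
    and unit_n: "\<And>x. x \<in> W \<Longrightarrow> n x \<bullet> (G (F x) *v n x) = 1"
    and normal_n: "\<And>x v. x \<in> W \<Longrightarrow> n x \<bullet> (G (F x) *v dd F x v) = 0"
begin

definition ip :: "real^2 \<Rightarrow> real^3 \<Rightarrow> real^3 \<Rightarrow> real" where
  "ip x u v = u \<bullet> (G (F x) *v v)"

definition first_kind :: "real^2 \<Rightarrow> real^3 \<Rightarrow> real^3 \<Rightarrow> real^3 \<Rightarrow> real" where
  "first_kind x u v z = (v \<bullet> (dd G (F x) u *v z) + u \<bullet> (dd G (F x) v *v z) - u \<bullet> (dd G (F x) z *v v)) / 2"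

definition cov :: "(real^2 \<Rightarrow> real^3) \<Rightarrow> real^2 \<Rightarrow> real^2 \<Rightarrow> real^3 \<Rightarrow> real" where
  "cov X x v z = ip x (dd X x v) z + first_kind x (dd F x v) (X x) z"

lemma ip_linear:
  "ip x (u + v) z = ip x u z + ip x v z" "ip x z (u + v) = ip x z u + ip x z v"
  "ip x (u - v) z = ip x u z - ip x v z" "ip x z (u - v) = ip x z u - ip x z v"
  "ip x (c *\<^sub>R u) z = c * ip x u z" "ip x z (c *\<^sub>R u) = c * ip x z u"
  "ip x 0 z = 0" "ip x z 0 = 0"
  by (simp_all add: ip_def inner_add_left inner_add_right inner_diff_left inner_diff_right
      matrix_vector_right_distrib matrix_vector_mult_diff_distrib matrix_vector_mult_scaleR)

lemma ip_commute: "x \<in> W \<Longrightarrow> ip x u v = ip x v u"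
  unfolding ip_def using G_sym[OF F_in, of x]
  by (metis dot_lmul_matrix inner_commute transpose_matrix_vector)

lemma ip_pos: "x \<in> W \<Longrightarrow> u \<noteq> 0 \<Longrightarrow> ip x u u > 0"
  unfolding ip_def by (intro G_pos F_in)

lemma linear_dG: "x \<in> W \<Longrightarrow> linear (dd G (F x))"
  by (intro linear_dd_smooth[OF smooth_G] F_in)

lemma dG_sym: "x \<in> W \<Longrightarrow> u \<bullet> (dd G (F x) w *v v) = v \<bullet> (dd G (F x) w *v u)"
proof -
  assume x: "x \<in> W"
  have lt: "bounded_linear (transpose :: real^3^3 \<Rightarrow> real^3^3)"
    unfolding linear_conv_bounded_linear[symmetric]
    by (intro linearI) (simp_all add: transpose_def vec_eq_iff)
  have "transpose (dd G (F x) w) = dd (\<lambda>y. transpose (G y)) (F x) w"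
    by (rule bounded_linear.dd_linear[OF lt, symmetric])
      (intro smooth_on_imp_differentiable[OF smooth_G] F_in x)
  also have "dd (\<lambda>y. transpose (G y)) (F x) = dd G (F x)"
    by (rule dd_cong[OF open_Y F_in[OF x]]) (rule G_sym)
  finally show ?thesis by (metis dot_lmul_matrix inner_commute transpose_matrix_vector)
qed

lemma first_kind_linear:
  assumes "x \<in> W"
  shows "first_kind x (u + u') v z = first_kind x u v z + first_kind x u' v z"
    "first_kind x v (u + u') z = first_kind x v u z + first_kind x v u' z"
    "first_kind x v z (u + u') = first_kind x v z u + first_kind x v z u'"
    "first_kind x (c *\<^sub>R u) v z = c * first_kind x u v z"
    "first_kind x v (c *\<^sub>R u) z = c * first_kind x v u z"
    "first_kind x v z (c *\<^sub>R u) = c * first_kind x v z u"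
    "first_kind x 0 v z = 0"
  using linear_dG[OF assms]
  by (simp_all add: first_kind_def linear_add linear_cmul linear_0 inner_add_left inner_add_right
      matrix_vector_right_distrib matrix_vector_mult_add_rdistrib matrix_vector_mult_scaleR
      scaleR_matrix_vector_assoc[symmetric] field_simps)

text \<open>Metric compatibility of the Levi-Civita connection; vanishing torsion follows in
  \<open>first_kind_torsion_free\<close>. Both rest on the symmetry of the derivatives of
  \<open>G\<close>.\<close>

lemma first_kind_compat:
  "x \<in> W \<Longrightarrow> first_kind x u v z + first_kind x u z v = v \<bullet> (dd G (F x) u *v z)"
  unfolding first_kind_def using dG_sym[of x z u v] by (simp add: field_simps)

lemma first_kind_torsion_free: "x \<in> W \<Longrightarrow> first_kind x u v z = first_kind x v u z"
  unfolding first_kind_def using dG_sym[of x u z v] by simp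

lemma GF_diff: "x \<in> W \<Longrightarrow> (\<lambda>x. G (F x)) differentiable (at x)"
  by (rule differentiable_compose[of G F])
    (auto intro: smooth_on_imp_differentiable[OF smooth_G] smooth_on_imp_differentiable[OF smooth_F] F_in)

lemma F_diff: "x \<in> W \<Longrightarrow> F differentiable (at x)"
  by (rule smooth_on_imp_differentiable[OF smooth_F])

lemma dd_ip_raw:
  assumes x: "x \<in> W" and X: "X differentiable (at x)" and Z: "Z differentiable (at x)"
  shows "dd (\<lambda>x. ip x (X x) (Z x)) x v =
    ip x (X x) (dd Z x v) + X x \<bullet> (dd G (F x) (dd F x v) *v Z x) + ip x (dd X x v) (Z x)"
proof -
  have GZ: "(\<lambda>x. G (F x) *v Z x) differentiable (at x)"
    by (intro bounded_bilinear.differentiable_bilinear[OF bounded_bilinear_matrix_vector_mult] GF_diff x Z)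
  have "dd (\<lambda>x. ip x (X x) (Z x)) x v = X x \<bullet> dd (\<lambda>x. G (F x) *v Z x) x v + dd X x v \<bullet> (G (F x) *v Z x)"
    unfolding ip_def by (rule dd_inner[OF X GZ])
  also have "dd (\<lambda>x. G (F x) *v Z x) x v = G (F x) *v dd Z x v + dd (\<lambda>x. G (F x)) x v *v Z x"
    by (rule dd_matrix_vector_mult[OF GF_diff[OF x] Z])
  also have "dd (\<lambda>x. G (F x)) x v = dd G (F x) (dd F x v)"
    by (intro dd_compose F_diff x smooth_on_imp_differentiable[OF smooth_G] F_in)
  finally show ?thesis by (simp add: ip_def inner_add_right)
qed

lemma dd_ip:
  assumes x: "x \<in> W" and X: "X differentiable (at x)" and Z: "Z differentiable (at x)"
  shows "dd (\<lambda>x. ip x (X x) (Z x)) x v = cov X x v (Z x) + cov Z x v (X x)"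
  unfolding dd_ip_raw[OF assms] cov_def first_kind_compat[OF x, symmetric]
  by (simp add: ip_commute[OF x])

text \<open>Differentiate a constant inner product. This yields the skewness of connection
  coefficients in an orthonormal frame, and it moves the derivative from a tangent field to the
  normal.\<close>

lemma cov_const_ip:
  assumes x: "x \<in> W" and sm: "smooth_on W X" "smooth_on W Z"
    and eq: "\<And>y. y \<in> W \<Longrightarrow> ip y (X y) (Z y) = c"
  shows "cov X x v (Z x) = - cov Z x v (X x)"
proof -
  have "dd (\<lambda>x. ip x (X x) (Z x)) x v = dd (\<lambda>_. c) x v"
    by (subst dd_cong[OF open_W x eq]) auto
  then have "cov X x v (Z x) + cov Z x v (X x) = 0"
    using dd_ip[OF x, of X Z v] sm x by (simp add: smooth_on_imp_differentiable)
  then show ?thesis by simp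
qed

lemma cov_torsion_free:
  assumes x: "x \<in> W"
  shows "cov (\<lambda>y. dd F y u) x v z = cov (\<lambda>y. dd F y v) x u z"
  unfolding cov_def dd_commute[OF open_W x smooth_F, of u v]
  by (simp add: first_kind_torsion_free[OF x, of "dd F x v"])

lemma cov_linear:
  assumes "x \<in> W"
  shows "cov X x v (z + z') = cov X x v z + cov X x v z'" "cov X x v (c *\<^sub>R z) = c * cov X x v z"
    "cov X x v 0 = 0"
proof -
  show "cov X x v (z + z') = cov X x v z + cov X x v z'" "cov X x v (c *\<^sub>R z) = c * cov X x v z" for z c
    using assms by (simp_all add: cov_def ip_linear first_kind_linear algebra_simps)
  from this(2)[of 0 0] show "cov X x v 0 = 0" by simp
qed

lemma cov_linear_dir:
  assumes "x \<in> W" "X differentiable (at x)"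
  shows "cov X x (u + v) z = cov X x u z + cov X x v z" "cov X x (c *\<^sub>R v) z = c * cov X x v z"
  using linear_dd[OF F_diff[OF assms(1)]] linear_dd[OF assms(2)]
  by (simp_all add: cov_def linear_add linear_cmul ip_linear first_kind_linear[OF assms(1)] algebra_simps)

section \<open>Smoothness and derivatives of the connection terms\<close>

lemma smooth_ip:
  "smooth_on W X \<Longrightarrow> smooth_on W Z \<Longrightarrow> smooth_on W (\<lambda>x. ip x (X x) (Z x))"
  unfolding ip_def
  by (intro smooth_on_inner smooth_on_matrix_vector_mult open_W
      smooth_on_compose[OF open_W open_Y smooth_F smooth_G F_in])

lemma dG_Basis: "x \<in> W \<Longrightarrow> dd G (F x) u = (\<Sum>e\<in>Basis. (u \<bullet> e) *\<^sub>R dd G (F x) e)"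
  by (intro linear_euclidean_sum linear_dG)

lemma smooth_dGF: "smooth_on W (\<lambda>x. dd G (F x) e)"
  by (rule smooth_on_compose[OF open_W open_Y smooth_F smooth_on_dd[OF open_Y smooth_G] F_in])

lemma smooth_dG: "smooth_on W X \<Longrightarrow> smooth_on W (\<lambda>x. dd G (F x) (X x))"
  by (subst smooth_on_cong[OF open_W dG_Basis], assumption)
    (intro smooth_on_sum smooth_on_scaleR smooth_on_inner smooth_on_const smooth_dGF open_W)

lemma smooth_first_kind:
  "smooth_on W A \<Longrightarrow> smooth_on W X \<Longrightarrow> smooth_on W Z \<Longrightarrow>
    smooth_on W (\<lambda>x. first_kind x (A x) (X x) (Z x))"
  unfolding first_kind_def divide_inverse by (intro smooth_intros smooth_dG open_W)

lemma smooth_cov: "smooth_on W X \<Longrightarrow> smooth_on W Z \<Longrightarrow> smooth_on W (\<lambda>x. cov X x v (Z x))"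
  unfolding cov_def
  by (intro smooth_on_add smooth_ip smooth_first_kind smooth_on_dd smooth_F open_W)

text \<open>The product rule also yields a second derivative of \<open>G\<close>, contracted with
  \<open>dd F x v\<close> and \<open>A x\<close>. The assumption \<open>cases\<close> kills this
  term, and with it every second derivative of the ambient metric.\<close>

lemma dd_dG:
  assumes x: "x \<in> W" and A: "smooth_on W A" and cases: "dd F x v = 0 \<or> A x = 0"
  shows "dd (\<lambda>x. dd G (F x) (A x)) x v = dd G (F x) (dd A x v)"
proof -
  have dA: "A differentiable (at x)" by (rule smooth_on_imp_differentiable[OF A x])
  have d1: "(\<lambda>x. A x \<bullet> e) differentiable (at x)" for e
    by (intro smooth_on_imp_differentiable[OF _ x] smooth_on_inner smooth_on_const A open_W)
  have d2: "(\<lambda>x. dd G (F x) e) differentiable (at x)" for e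
    by (rule smooth_on_imp_differentiable[OF smooth_dGF x])
  have h: "dd (\<lambda>x. dd G (F x) e) x v = dd (\<lambda>y. dd G y e) (F x) (dd F x v)" for e
    by (intro dd_compose F_diff x smooth_on_imp_differentiable[OF smooth_on_dd[OF open_Y smooth_G]] F_in)
  have lin: "linear (dd (\<lambda>y. dd G y e) (F x))" for e
    by (intro linear_dd_smooth[OF smooth_on_dd[OF open_Y smooth_G]] F_in x)
  have z: "(A x \<bullet> e) *\<^sub>R dd (\<lambda>x. dd G (F x) e) x v = 0" for e
    using cases h linear_0[OF lin] by auto
  have t: "((\<lambda>x. (A x \<bullet> e) *\<^sub>R dd G (F x) e) has_derivative
      (\<lambda>v. (A x \<bullet> e) *\<^sub>R dd (\<lambda>x. dd G (F x) e) x v + (dd A x v \<bullet> e) *\<^sub>R dd G (F x) e)) (at x)" for e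
    using bounded_bilinear.FDERIV[OF bounded_bilinear_scaleR has_derivative_dd[OF d1] has_derivative_dd[OF d2], of e e]
      bounded_linear.dd_linear[OF bounded_linear_inner_left dA, of e] by simp
  have "dd (\<lambda>x. dd G (F x) (A x)) x v = dd (\<lambda>x. \<Sum>e\<in>Basis. (A x \<bullet> e) *\<^sub>R dd G (F x) e) x v"
    by (subst dd_cong[OF open_W x dG_Basis]) auto
  also have "\<dots> = (\<Sum>e\<in>Basis. (A x \<bullet> e) *\<^sub>R dd (\<lambda>x. dd G (F x) e) x v + (dd A x v \<bullet> e) *\<^sub>R dd G (F x) e)"
    by (subst dd_eqI[OF has_derivative_sum[OF t]]) auto
  also have "\<dots> = dd G (F x) (dd A x v)"
    unfolding z by (simp add: dG_Basis[OF x, of "dd A x v"])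
  finally show ?thesis .
qed

lemma dd_trilinear:
  assumes x: "x \<in> W" and M: "smooth_on W M" and sm: "smooth_on W X" "smooth_on W Z"
  shows "dd (\<lambda>x. X x \<bullet> (M x *v Z x)) x v =
    X x \<bullet> (M x *v dd Z x v) + X x \<bullet> (dd M x v *v Z x) + dd X x v \<bullet> ((M x :: real^3^3) *v (Z x :: real^3))"
proof -
  have d: "M differentiable (at x)" "X differentiable (at x)" "Z differentiable (at x)"
    using assms by (auto intro: smooth_on_imp_differentiable)
  show ?thesis
    by (subst dd_inner[OF d(2) bounded_bilinear.differentiable_bilinear[OF bounded_bilinear_matrix_vector_mult d(1,3)]])
      (simp add: dd_matrix_vector_mult[OF d(1,3)] inner_add_right)
qed

text \<open>Left unsimplified so that the two lemmas after it can evaluate the derivatives of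
  \<open>dd G\<close> by the two cases of \<open>dd_dG\<close>.\<close>

lemma dd_first_kind_raw:
  assumes x: "x \<in> W" and sm: "smooth_on W A" "smooth_on W X" "smooth_on W Z"
  shows "dd (\<lambda>x. first_kind x (A x) (X x) (Z x)) x v =
    ((X x \<bullet> (dd G (F x) (A x) *v dd Z x v) + X x \<bullet> (dd (\<lambda>x. dd G (F x) (A x)) x v *v Z x)
        + dd X x v \<bullet> (dd G (F x) (A x) *v Z x))
     + (A x \<bullet> (dd G (F x) (X x) *v dd Z x v) + A x \<bullet> (dd (\<lambda>x. dd G (F x) (X x)) x v *v Z x)
        + dd A x v \<bullet> (dd G (F x) (X x) *v Z x))
     - (A x \<bullet> (dd G (F x) (Z x) *v dd X x v) + A x \<bullet> (dd (\<lambda>x. dd G (F x) (Z x)) x v *v X x)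
        + dd A x v \<bullet> (dd G (F x) (Z x) *v X x))) / 2"
proof -
  note sG = smooth_dG[OF sm(1)] smooth_dG[OF sm(2)] smooth_dG[OF sm(3)]
  have s: "smooth_on W (\<lambda>x. X x \<bullet> (dd G (F x) (A x) *v Z x))"
    "smooth_on W (\<lambda>x. A x \<bullet> (dd G (F x) (X x) *v Z x))"
    "smooth_on W (\<lambda>x. A x \<bullet> (dd G (F x) (Z x) *v X x))"
    by (intro smooth_on_inner smooth_on_matrix_vector_mult sG sm open_W)+
  note d = s[THEN smooth_on_imp_differentiable, OF x]
  have "dd (\<lambda>x. first_kind x (A x) (X x) (Z x)) x v = dd (\<lambda>x. X x \<bullet> (dd G (F x) (A x) *v Z x)
      + A x \<bullet> (dd G (F x) (X x) *v Z x) - A x \<bullet> (dd G (F x) (Z x) *v X x)) x v / 2"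
    unfolding first_kind_def
    by (rule bounded_linear.dd_linear[OF bounded_linear_divide])
      (intro smooth_on_imp_differentiable[OF _ x] smooth_on_add smooth_on_diff s open_W)
  also have "dd (\<lambda>x. X x \<bullet> (dd G (F x) (A x) *v Z x)
      + A x \<bullet> (dd G (F x) (X x) *v Z x) - A x \<bullet> (dd G (F x) (Z x) *v X x)) x v
    = dd (\<lambda>x. X x \<bullet> (dd G (F x) (A x) *v Z x)) x v + dd (\<lambda>x. A x \<bullet> (dd G (F x) (X x) *v Z x)) x v
      - dd (\<lambda>x. A x \<bullet> (dd G (F x) (Z x) *v X x)) x v"
    by (subst dd_diff[OF smooth_on_imp_differentiable[OF smooth_on_add[OF open_W s(1,2)] x] d(3)])
      (simp add: dd_add[OF d(1,2)])
  finally show ?thesis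
    by (simp only: dd_trilinear[OF x sG(1) sm(2,3)] dd_trilinear[OF x sG(2) sm(1,3)]
        dd_trilinear[OF x sG(3) sm(1,2)])
qed

text \<open>In a null direction of the differential the base point \<open>F x\<close> does not move
  to first order, so only the three vector arguments are differentiated.\<close>

lemma dd_first_kind_singular:
  assumes x: "x \<in> W" and sm: "smooth_on W A" "smooth_on W X" "smooth_on W Z" and v: "dd F x v = 0"
  shows "dd (\<lambda>x. first_kind x (A x) (X x) (Z x)) x v =
    first_kind x (dd A x v) (X x) (Z x) + first_kind x (A x) (dd X x v) (Z x)
      + first_kind x (A x) (X x) (dd Z x v)"
  unfolding dd_first_kind_raw[OF x sm] using v
  by (simp add: dd_dG x sm first_kind_def field_simps)

text \<open>Each term contains \<open>A\<close> as a linear factor, so where \<open>A\<close>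
  vanishes only its own derivative survives the product rule.\<close>

lemma dd_first_kind_zero:
  assumes x: "x \<in> W" and sm: "smooth_on W A" "smooth_on W X" "smooth_on W Z" and A: "A x = 0"
  shows "dd (\<lambda>x. first_kind x (A x) (X x) (Z x)) x v = first_kind x (dd A x v) (X x) (Z x)"
  unfolding dd_first_kind_raw[OF x sm] using A linear_0[OF linear_dG[OF x]]
  by (simp add: dd_dG x sm first_kind_def field_simps)

text \<open>The Gram-Schmidt step; the field \<open>m\<close> may be zero.\<close>

lemma orthonormal_extension:
  assumes p: "p \<in> W" and m: "smooth_on W m" "\<And>x. x \<in> W \<Longrightarrow> ip x (m x) (n x) = 0"
    "\<And>x. x \<in> W \<Longrightarrow> m x = 0 \<or> ip x (m x) (m x) = 1"
  obtains V e where "open V" "p \<in> V" "V \<subseteq> W" "smooth_on V e" "\<And>x. x \<in> V \<Longrightarrow> ip x (e x) (n x) = 0"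
    "\<And>x. x \<in> V \<Longrightarrow> ip x (e x) (m x) = 0" "\<And>x. x \<in> V \<Longrightarrow> ip x (e x) (e x) = 1"
proof -
  \<comment> \<open>Two vectors do not span 3-space. A constant vector outside their span, with its
    components along \<open>n\<close> and \<open>m\<close> removed, is nonzero at \<open>p\<close>
    and hence near \<open>p\<close>.\<close>
  have "dim (span {n p, m p}) \<le> card {n p, m p}" by (simp add: dim_le_card')
  also have "\<dots> \<le> 2" by (simp add: card_insert_if)
  finally have le: "dim (span {n p, m p}) \<le> 2" .
  have "span {n p, m p} \<noteq> UNIV"
  proof
    assume "span {n p, m p} = UNIV"
    then have "dim (UNIV :: (real^3) set) \<le> 2" using le by metis
    then show False by (simp add: dim_UNIV)
  qed
  then obtain w where w: "w \<notin> span {n p, m p}" by blast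
  define u where "u = (\<lambda>x. w - ip x w (n x) *\<^sub>R n x - ip x w (m x) *\<^sub>R m x)"
  have smu: "smooth_on W u" unfolding u_def
    by (intro smooth_intros smooth_ip smooth_n m open_W)
  have up: "u p \<noteq> 0"
  proof
    assume "u p = 0"
    then have "w = ip p w (n p) *\<^sub>R n p + ip p w (m p) *\<^sub>R m p" by (simp add: u_def algebra_simps)
    also have "\<dots> \<in> span {n p, m p}" by (intro span_add span_mul span_base) auto
    finally show False using w by simp
  qed
  define V where "V = W \<inter> u -` (- {0})"
  have V: "open V" "p \<in> V" "V \<subseteq> W"
    using p up unfolding V_def
    by (auto intro!: continuous_open_preimage smooth_on_imp_continuous_on smu open_W)
  have un: "ip x (u x) (n x) = 0" "ip x (u x) (m x) = 0" if "x \<in> W" for x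
    using that unit_n[OF that] m(2)[OF that] m(3)[OF that] ip_commute[OF that, of "n x" "m x"]
    by (auto simp: u_def ip_linear ip_def[symmetric])
  have pos: "ip x (u x) (u x) > 0" if "x \<in> V" for x
    using that by (intro ip_pos) (auto simp: V_def)
  define e where "e = (\<lambda>x. inverse (sqrt (ip x (u x) (u x))) *\<^sub>R u x)"
  have "smooth_on V (\<lambda>x. ip x (u x) (u x))" by (rule smooth_on_subset[OF smooth_ip[OF smu smu] V(3)])
  then have sme: "smooth_on V e" unfolding e_def
    using pos by (intro smooth_on_scaleR smooth_on_inverse smooth_on_sqrt smooth_on_subset[OF smu] V)
      (auto simp: less_le)
  show ?thesis
  proof
    show "open V" "p \<in> V" "V \<subseteq> W" "smooth_on V e" by fact+
    fix x assume x: "x \<in> V"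
    then have xW: "x \<in> W" using V by blast
    show "ip x (e x) (n x) = 0" "ip x (e x) (m x) = 0" using un[OF xW] by (simp_all add: e_def ip_linear)
    show "ip x (e x) (e x) = 1" using pos[OF x]
      by (simp add: e_def ip_linear field_simps real_sqrt_mult_self flip: power2_eq_square)
  qed
qed

lemma frontal_chart_subset: "open V \<Longrightarrow> V \<subseteq> W \<Longrightarrow> frontal_chart G Y F n V"
  using open_Y smooth_G G_sym G_pos F_in unit_n normal_n
    smooth_on_subset[OF smooth_F] smooth_on_subset[OF smooth_n]
  by unfold_locales (auto 0 3)

end

section \<open>Adapted orthonormal frames\<close>

text \<open>The rows of the matrix with columns \<open>u\<close> and \<open>w\<close> are
  proportional, so a nonzero row, turned by a right angle, lies in the kernel.\<close>

lemma wedge_zero_kernel: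
  assumes "wedge u w = 0"
  shows "\<exists>v::real^2. v \<noteq> 0 \<and> v $ 1 * u $ 1 + v $ 2 * w $ 1 = 0 \<and> v $ 1 * u $ 2 + v $ 2 * w $ 2 = 0"
proof -
  consider "u = 0" "w = 0" | "vector [w $ 1, - u $ 1] \<noteq> (0 :: real^2)" | "vector [w $ 2, - u $ 2] \<noteq> (0 :: real^2)"
    by (force simp: vec_eq_iff forall_2)
  then show ?thesis
  proof cases
    case 1
    then show ?thesis by (intro exI[of _ "axis 1 1"]) (simp add: axis_eq_0_iff)
  next
    case 2
    then show ?thesis using assms
      by (intro exI[of _ "vector [w $ 1, - u $ 1]"]) (simp add: wedge_def mult.commute)
  next
    case 3
    then show ?thesis using assms
      by (intro exI[of _ "vector [w $ 2, - u $ 2]"]) (simp add: wedge_def mult.commute)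
  qed
qed

locale framed_chart = frontal_chart +
  fixes e1 e2 :: "real^2 \<Rightarrow> real^3"
  assumes smooth_e1: "smooth_on W e1" and smooth_e2: "smooth_on W e2"
    and orth_raw: "\<And>x. x \<in> W \<Longrightarrow> ip x (e1 x) (e1 x) = 1" "\<And>x. x \<in> W \<Longrightarrow> ip x (e2 x) (e2 x) = 1"
      "\<And>x. x \<in> W \<Longrightarrow> ip x (e2 x) (e1 x) = 0" "\<And>x. x \<in> W \<Longrightarrow> ip x (e1 x) (n x) = 0"
      "\<And>x. x \<in> W \<Longrightarrow> ip x (e2 x) (n x) = 0"
begin

lemma orth:
  assumes "x \<in> W"
  shows "ip x (e1 x) (e1 x) = 1" "ip x (e2 x) (e2 x) = 1" "ip x (n x) (n x) = 1"
    "ip x (e2 x) (e1 x) = 0" "ip x (e1 x) (n x) = 0" "ip x (e2 x) (n x) = 0"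
    "ip x (e1 x) (e2 x) = 0" "ip x (n x) (e1 x) = 0" "ip x (n x) (e2 x) = 0"
  using orth_raw[OF assms] unit_n[OF assms] ip_commute[OF assms] by (simp_all add: ip_def)

lemma ip_n_dF [simp]: "x \<in> W \<Longrightarrow> ip x (n x) (dd F x v) = 0"
  using normal_n by (simp add: ip_def)

lemma ip_dF_n [simp]: "x \<in> W \<Longrightarrow> ip x (dd F x v) (n x) = 0"
  using ip_n_dF ip_commute by metis

text \<open>For the matrix \<open>Q\<close> with the frame as rows, orthonormality says that
  \<open>Q ** (G ** transpose Q)\<close> is the identity. One-sided inverses of square matrices are
  two-sided; transposing gives the expansion.\<close>

lemma expand:
  assumes x: "x \<in> W"
  shows "u = ip x u (e1 x) *\<^sub>R e1 x + ip x u (e2 x) *\<^sub>R e2 x + ip x u (n x) *\<^sub>R n x"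
proof -
  define Q where "Q = (vector [e1 x, e2 x, n x] :: real^3^3)"
  have row: "Q $ 1 = e1 x" "Q $ 2 = e2 x" "Q $ 3 = n x" by (simp_all add: Q_def)
  have "(Q ** (G (F x) ** transpose Q)) $ i $ j = ip x (Q $ i) (Q $ j)" for i j
    by (simp add: ip_def matrix_matrix_mult_def matrix_vector_mult_def inner_vec_def transpose_def)
  then have "Q ** (G (F x) ** transpose Q) = mat 1"
    using orth[OF x] by (simp add: vec_eq_iff forall_3 row mat_def)
  then have inv: "(G (F x) ** transpose Q) ** Q = mat 1"
    by (simp add: matrix_left_right_inverse)
  have tinv: "transpose Q ** (Q ** G (F x)) = mat 1"
  proof -
    have "transpose ((G (F x) ** transpose Q) ** Q) = transpose Q ** (Q ** transpose (G (F x)))"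
      by (simp add: matrix_transpose_mul)
    then show ?thesis using inv G_sym[OF F_in[OF x]] by (simp add: transpose_mat)
  qed
  have "u = transpose Q *v (Q *v (G (F x) *v u))"
    using tinv by (simp add: matrix_vector_mul_assoc)
  also have "\<dots> = ip x u (e1 x) *\<^sub>R e1 x + ip x u (e2 x) *\<^sub>R e2 x + ip x u (n x) *\<^sub>R n x"
  proof -
    have c: "(Q *v (G (F x) *v u)) $ i = ip x u (Q $ i)" for i
      unfolding ip_commute[OF x, of u] by (simp add: ip_def matrix_vector_mul_component)
    have "(transpose Q *v z) = z $ 1 *\<^sub>R Q $ 1 + z $ 2 *\<^sub>R Q $ 2 + z $ 3 *\<^sub>R Q $ 3" for z
      by (simp add: vec_eq_iff matrix_vector_mult_def transpose_def sum_3)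
    then show ?thesis by (simp add: c row)
  qed
  finally show ?thesis .
qed

lemma ip_expand:
  assumes x: "x \<in> W"
  shows "ip x u v = ip x u (e1 x) * ip x v (e1 x) + ip x u (e2 x) * ip x v (e2 x) + ip x u (n x) * ip x v (n x)"
proof -
  have "ip x u v = ip x u (ip x v (e1 x) *\<^sub>R e1 x + ip x v (e2 x) *\<^sub>R e2 x + ip x v (n x) *\<^sub>R n x)"
    using expand[OF x, of v] by simp
  then show ?thesis by (simp only: ip_linear) (simp add: mult.commute)
qed

lemma cov_expand:
  assumes x: "x \<in> W"
  shows "cov X x v u = ip x u (e1 x) * cov X x v (e1 x) + ip x u (e2 x) * cov X x v (e2 x)
    + ip x u (n x) * cov X x v (n x)"
proof -
  have "cov X x v u = cov X x v (ip x u (e1 x) *\<^sub>R e1 x + ip x u (e2 x) *\<^sub>R e2 x + ip x u (n x) *\<^sub>R n x)"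
    using expand[OF x, of u] by simp
  then show ?thesis by (simp only: cov_linear[OF x])
qed

lemmas frame_smooth = smooth_e1 smooth_e2 smooth_n

lemma cov_skew:
  assumes "x \<in> W"
  shows "cov e1 x v (e1 x) = 0" "cov e2 x v (e2 x) = 0" "cov n x v (n x) = 0"
    "cov e2 x v (e1 x) = - cov e1 x v (e2 x)" "cov e1 x v (n x) = - cov n x v (e1 x)"
    "cov e2 x v (n x) = - cov n x v (e2 x)"
  using cov_const_ip[OF assms smooth_e1 smooth_e1 orth(1), of v]
    cov_const_ip[OF assms smooth_e2 smooth_e2 orth(2), of v]
    cov_const_ip[OF assms smooth_n smooth_n orth(3), of v]
    cov_const_ip[OF assms smooth_e2 smooth_e1 orth(4), of v]
    cov_const_ip[OF assms smooth_e1 smooth_n orth(5), of v]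
    cov_const_ip[OF assms smooth_e2 smooth_n orth(6), of v] by simp_all

text \<open>In the notation of the overview, \<open>comp\<close>, \<open>conn\<close>,
  \<open>dens\<close> and \<open>curv\<close> are a, omega, delta and kappa. No division enters
  them, so they stay smooth across singular points.\<close>

definition comp :: "2 \<Rightarrow> real^2 \<Rightarrow> real^2" where
  "comp j x = ip x (dd F x (axis j 1)) (e1 x) *\<^sub>R axis 1 1 + ip x (dd F x (axis j 1)) (e2 x) *\<^sub>R axis 2 1"

definition conn :: "2 \<Rightarrow> real^2 \<Rightarrow> real" where
  "conn i x = cov e1 x (axis i 1) (e2 x)"

definition dens :: "real^2 \<Rightarrow> real" where
  "dens x = wedge (comp 1 x) (comp 2 x)"

definition curv :: "real^2 \<Rightarrow> real" where
  "curv x = pd 1 (conn 2) x - pd 2 (conn 1) x"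

lemma comp_nth [simp]: "comp j x $ 1 = ip x (dd F x (axis j 1)) (e1 x)" "comp j x $ 2 = ip x (dd F x (axis j 1)) (e2 x)"
  by (simp_all add: comp_def axis_def)

lemma smooth_comp: "smooth_on W (comp j)"
  unfolding comp_def[abs_def]
  by (intro smooth_on_add smooth_on_scaleR smooth_on_const smooth_ip smooth_on_dd smooth_F frame_smooth open_W)

lemma smooth_conn: "smooth_on W (conn i)"
  unfolding conn_def[abs_def] by (intro smooth_cov frame_smooth)

lemma smooth_dens: "smooth_on W dens"
  unfolding dens_def[abs_def] by (intro smooth_on_wedge smooth_comp open_W)

lemma smooth_curv: "smooth_on W curv"
  unfolding curv_def[abs_def] pd_def by (intro smooth_on_diff smooth_on_dd smooth_conn open_W)

text \<open>The right side holds the tangential components of the covariant derivative of the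
  partial derivative \<open>dd F y (axis j 1)\<close>. Differentiating \<open>comp\<close> also
  differentiates the frame, which contributes a rotation since \<open>dd F\<close> has no normal
  part.\<close>

lemma pd_comp:
  assumes x: "x \<in> W"
  shows "pd i (comp j) x + conn i x *\<^sub>R rot (comp j x) =
    cov (\<lambda>y. dd F y (axis j 1)) x (axis i 1) (e1 x) *\<^sub>R axis 1 1
    + cov (\<lambda>y. dd F y (axis j 1)) x (axis i 1) (e2 x) *\<^sub>R axis 2 1"
proof -
  let ?F = "\<lambda>y. dd F y (axis j 1)"
  have sF: "smooth_on W ?F" by (intro smooth_on_dd smooth_F open_W)
  have dF: "?F differentiable (at x)" by (rule smooth_on_imp_differentiable[OF sF x])
  have nth: "pd i (comp j) x $ k = dd (\<lambda>y. comp j y $ k) x (axis i 1)" for k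
    unfolding pd_def
    by (rule bounded_linear.dd_linear[OF bounded_linear_vec_nth, symmetric])
      (rule smooth_on_imp_differentiable[OF smooth_comp x])
  have 1: "pd i (comp j) x $ 1 = cov ?F x (axis i 1) (e1 x) + comp j x $ 2 * conn i x"
    unfolding nth comp_nth
    by (subst dd_ip[OF x dF smooth_on_imp_differentiable[OF smooth_e1 x]],
        subst cov_expand[OF x, of e1 _ "dd F x (axis j 1)"])
      (simp add: cov_skew x conn_def)
  have 2: "pd i (comp j) x $ 2 = cov ?F x (axis i 1) (e2 x) - comp j x $ 1 * conn i x"
    unfolding nth comp_nth
    by (subst dd_ip[OF x dF smooth_on_imp_differentiable[OF smooth_e2 x]],
        subst cov_expand[OF x, of e2 _ "dd F x (axis j 1)"])
      (simp add: cov_skew x conn_def)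
  show ?thesis using 1 2 by (simp add: vec_eq_iff forall_2 axis_def)
qed

lemma metric_curvature_frame:
  assumes V: "open V" "V \<subseteq> W"
    and h: "\<And>x i j. x \<in> V \<Longrightarrow> h x $ i $ j = ip x (dd F x (axis i 1)) (dd F x (axis j 1))"
    and x: "x \<in> V" and nz: "dens x \<noteq> 0"
  shows "metric_curvature h x * dens x = - curv x"
proof -
  have "coframe V comp conn (\<lambda>i j x. pd i (comp j) x + conn i x *\<^sub>R rot (comp j x)) h"
  proof
    fix i j x assume "x \<in> V"
    then have x: "x \<in> W" using V by blast
    show "pd i (comp j) x + conn i x *\<^sub>R rot (comp j x) = pd j (comp i) x + conn j x *\<^sub>R rot (comp i x)"
      \<comment> \<open>By \<open>pd_comp\<close> the first structure equation is the symmetry of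
        the ambient covariant derivative in \<open>i\<close> and \<open>j\<close>.\<close>
      unfolding pd_comp[OF x] cov_torsion_free[OF x, of "axis j 1" "axis i 1"] ..
    show "h x $ i $ j = comp i x \<bullet> comp j x"
      unfolding h[OF \<open>x \<in> V\<close>] ip_expand[OF x, of "dd F x (axis i 1)" "dd F x (axis j 1)"]
      using x by (simp add: inner_vec_def sum_2)
  qed (use V smooth_on_subset[OF smooth_comp V(2)] smooth_on_subset[OF smooth_conn V(2)] in auto)
  from coframe.metric_curvature_coframe[OF this x] nz
  show ?thesis by (simp add: dens_def curv_def)
qed

section \<open>Singular points and the numerator of the curvature\<close>

lemma dF_expand:
  assumes "x \<in> W"
  shows "dd F x v = ip x (dd F x v) (e1 x) *\<^sub>R e1 x + ip x (dd F x v) (e2 x) *\<^sub>R e2 x"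
  using expand[OF assms, of "dd F x v"] assms by simp

lemma dF_axis:
  assumes "x \<in> W"
  shows "dd F x v = v $ 1 *\<^sub>R dd F x (axis 1 1) + v $ 2 *\<^sub>R dd F x (axis 2 1)"
proof -
  have "v = v $ 1 *\<^sub>R axis 1 1 + v $ 2 *\<^sub>R (axis 2 1 :: real^2)"
    by (simp add: vec_eq_iff forall_2 axis_def)
  then have "dd F x v = dd F x (v $ 1 *\<^sub>R axis 1 1 + v $ 2 *\<^sub>R axis 2 1)" by simp
  then show ?thesis using linear_dd[OF F_diff[OF assms]] by (simp add: linear_add linear_cmul)
qed

text \<open>Without a normal component, \<open>dd F x\<close> is represented by the square matrix
  with columns \<open>comp 1 x\<close> and \<open>comp 2 x\<close>, whose determinant is
  \<open>dens x\<close>.\<close>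

lemma dens_eq_0_iff:
  assumes x: "x \<in> W"
  shows "dens x = 0 \<longleftrightarrow> (\<exists>v. v \<noteq> 0 \<and> dd F x v = 0)"
proof
  assume d: "dens x = 0"
  obtain v :: "real^2" where v: "v \<noteq> 0"
    and m: "v $ 1 * comp 1 x $ 1 + v $ 2 * comp 2 x $ 1 = 0" "v $ 1 * comp 1 x $ 2 + v $ 2 * comp 2 x $ 2 = 0"
    using wedge_zero_kernel[OF d[unfolded dens_def]] by blast
  have "ip x (dd F x v) (e1 x) = 0" "ip x (dd F x v) (e2 x) = 0"
    using m unfolding dF_axis[OF x, of v] ip_linear comp_nth by simp_all
  then have "dd F x v = 0" using dF_expand[OF x, of v] by simp
  then show "\<exists>v. v \<noteq> 0 \<and> dd F x v = 0" using v by blast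
next
  assume "\<exists>v. v \<noteq> 0 \<and> dd F x v = 0"
  then obtain v where v: "v \<noteq> 0" "dd F x v = 0" by blast
  have "v $ 1 * comp 1 x $ 1 + v $ 2 * comp 2 x $ 1 = 0" "v $ 1 * comp 1 x $ 2 + v $ 2 * comp 2 x $ 2 = 0"
    using arg_cong[OF v(2), of "\<lambda>z. ip x z (e1 x)"] arg_cong[OF v(2), of "\<lambda>z. ip x z (e2 x)"]
    unfolding dF_axis[OF x, of v] ip_linear comp_nth by simp_all
  then have "v $ 1 * dens x = 0" "v $ 2 * dens x = 0"
    unfolding dens_def wedge_def by algebra+
  then show "dens x = 0" using v(1) by (auto simp: vec_eq_iff forall_2)
qed

text \<open>All second derivatives of \<open>F\<close> and \<open>e1\<close> cancel, because \<open>dd F p b = 0\<close>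
  makes the curvature of the ambient connection drop out.\<close>

lemma curv_singular_direction:
  assumes p: "p \<in> W" and b: "dd F p b = 0"
  shows "dd (\<lambda>x. cov e1 x b (e2 x)) p a - dd (\<lambda>x. cov e1 x a (e2 x)) p b =
    cov n p b (e1 p) * cov n p a (e2 p) - cov n p b (e2 p) * cov n p a (e1 p)"
proof -
  note sd = smooth_on_dd[OF open_W smooth_F] smooth_on_dd[OF open_W smooth_e1]
  note diff = smooth_on_imp_differentiable[OF _ p]
  have split: "dd (\<lambda>x. cov e1 x u (e2 x)) p v =
     dd (\<lambda>x. ip x (dd e1 x u) (e2 x)) p v + dd (\<lambda>x. first_kind x (dd F x u) (e1 x) (e2 x)) p v" for u v
    unfolding cov_def
    by (intro dd_add diff smooth_ip smooth_first_kind sd frame_smooth)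
  \<comment> \<open>Here the field \<open>dd F x b\<close> inside the Christoffel form vanishes at
    \<open>p\<close>; in \<open>t2\<close> the direction of differentiation is the null vector.
    These are the two cases of \<open>dd_dG\<close>.\<close>
  have t1: "dd (\<lambda>x. cov e1 x b (e2 x)) p a =
    ip p (dd e1 p b) (dd e2 p a) + dd e1 p b \<bullet> (dd G (F p) (dd F p a) *v e2 p)
    + ip p (dd (\<lambda>x. dd e1 x b) p a) (e2 p) + first_kind p (dd (\<lambda>x. dd F x b) p a) (e1 p) (e2 p)"
    unfolding split dd_ip_raw[OF p diff[OF sd(2)] diff[OF smooth_e2]]
      dd_first_kind_zero[OF p sd(1) smooth_e1 smooth_e2 b] by simp
  have t2: "dd (\<lambda>x. cov e1 x a (e2 x)) p b =
    ip p (dd e1 p a) (dd e2 p b) + ip p (dd (\<lambda>x. dd e1 x a) p b) (e2 p)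
    + (first_kind p (dd (\<lambda>x. dd F x a) p b) (e1 p) (e2 p) + first_kind p (dd F p a) (dd e1 p b) (e2 p)
      + first_kind p (dd F p a) (e1 p) (dd e2 p b))"
    unfolding split dd_ip_raw[OF p diff[OF sd(2)] diff[OF smooth_e2]]
      dd_first_kind_singular[OF p sd(1) smooth_e1 smooth_e2 b]
    by (simp add: b linear_0[OF linear_dG[OF p]])
  have covb: "cov X p b z = ip p (dd X p b) z" for X z
    by (simp add: cov_def b first_kind_linear[OF p])
  define m where "m = cov e1 p b (e2 p)"
  have "dd (\<lambda>x. cov e1 x b (e2 x)) p a - dd (\<lambda>x. cov e1 x a (e2 x)) p b =
      cov e2 p a (dd e1 p b) - cov e1 p a (dd e2 p b)"
    unfolding t1 t2 dd_commute[OF open_W p smooth_F, of a b] dd_commute[OF open_W p smooth_e1, of a b]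
      first_kind_compat[OF p, symmetric]
    unfolding cov_def by (simp add: ip_commute[OF p, of "dd e1 p b"])
  \<comment> \<open>The vector \<open>dd e1 p b\<close> is the covariant derivative, as
    \<open>b\<close> is null. It has no component along \<open>e1\<close>, its component
    \<open>m\<close> along \<open>e2\<close> meets a vanishing coefficient, and the normal component
    gives the product.\<close>
  also have "cov e2 p a (dd e1 p b) = cov n p b (e1 p) * cov n p a (e2 p) - m * 0 + 0 * cov e2 p a (e1 p)"
    by (subst cov_expand[OF p]) (simp add: covb[symmetric] cov_skew[OF p])
  also have "cov e1 p a (dd e2 p b) = cov n p b (e2 p) * cov n p a (e1 p)"
    by (subst cov_expand[OF p]) (simp add: covb[symmetric] cov_skew[OF p])
  finally show ?thesis by simp
qed

text \<open>For constant vectors the left side is the exterior derivative of the connection form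
  evaluated at \<open>a\<close> and \<open>b\<close>, an alternating bilinear expression.\<close>

lemma curv_bilinear:
  assumes p: "p \<in> W"
  shows "dd (\<lambda>x. cov e1 x b (e2 x)) p a - dd (\<lambda>x. cov e1 x a (e2 x)) p b = wedge a b * curv p"
proof -
  have d: "conn i differentiable (at p)" for i by (rule smooth_on_imp_differentiable[OF smooth_conn p])
  have axis: "v = v $ 1 *\<^sub>R axis 1 1 + v $ 2 *\<^sub>R (axis 2 1 :: real^2)" for v
    by (simp add: vec_eq_iff forall_2 axis_def)
  have cv: "cov e1 x v (e2 x) = v $ 1 * conn 1 x + v $ 2 * conn 2 x" if "x \<in> W" for x v
    by (subst axis[of v])
      (simp add: cov_linear_dir[OF that smooth_on_imp_differentiable[OF smooth_e1 that]] conn_def del: vector_scaleR_component)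
  have dc: "dd (\<lambda>x. cov e1 x v (e2 x)) p u = v $ 1 * (u $ 1 * pd 1 (conn 1) p + u $ 2 * pd 2 (conn 1) p)
      + v $ 2 * (u $ 1 * pd 1 (conn 2) p + u $ 2 * pd 2 (conn 2) p)" for u v
  proof -
    have "dd (\<lambda>x. cov e1 x v (e2 x)) p u = dd (\<lambda>x. v $ 1 * conn 1 x + v $ 2 * conn 2 x) p u"
      by (subst dd_cong[OF open_W p cv]) auto
    also have "\<dots> = v $ 1 * dd (conn 1) p u + v $ 2 * dd (conn 2) p u"
      by (subst dd_eqI[OF has_derivative_add[OF has_derivative_mult_right[OF has_derivative_dd[OF d]]
              has_derivative_mult_right[OF has_derivative_dd[OF d]]]]) simp
    also have "\<dots> = v $ 1 * (u $ 1 * pd 1 (conn 1) p + u $ 2 * pd 2 (conn 1) p)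
      + v $ 2 * (u $ 1 * pd 1 (conn 2) p + u $ 2 * pd 2 (conn 2) p)"
      unfolding pd_def dd_axis[OF linear_dd[OF d], of _ u] ..
    finally show ?thesis .
  qed
  show ?thesis unfolding dc by (simp add: wedge_def curv_def algebra_simps)
qed

lemma curv_eq_0_iff:
  assumes p: "p \<in> W" and b: "dd F p b = 0" and ab: "wedge a b \<noteq> 0"
    and a: "dd F p a \<noteq> 0" and imm: "dd n p b \<noteq> 0"
  shows "curv p = 0 \<longleftrightarrow> cov n p a (dd F p a) = 0"
proof -
  define \<alpha>1 where "\<alpha>1 = ip p (dd F p a) (e1 p)"
  define \<alpha>2 where "\<alpha>2 = ip p (dd F p a) (e2 p)"
  define \<beta>1 where "\<beta>1 = cov n p b (e1 p)"
  define \<beta>2 where "\<beta>2 = cov n p b (e2 p)"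
  define \<gamma>1 where "\<gamma>1 = cov n p a (e1 p)"
  define \<gamma>2 where "\<gamma>2 = cov n p a (e2 p)"
  note sF = smooth_on_dd[OF open_W smooth_F]
  have sym: "cov n p u (dd F p v) = - cov (\<lambda>y. dd F y v) p u (n p)" for u v
    by (rule cov_const_ip[OF p smooth_n sF]) (rule ip_n_dF)
  have "cov n p b (dd F p a) = cov n p a (dd F p b)"
    unfolding sym cov_torsion_free[OF p, of a b] ..
  then have "cov n p b (dd F p a) = 0" by (simp add: b cov_linear[OF p])
  then have ab0: "\<alpha>1 * \<beta>1 + \<alpha>2 * \<beta>2 = 0"
    unfolding \<alpha>1_def \<alpha>2_def \<beta>1_def \<beta>2_def using p by (subst (asm) cov_expand) auto
  have "\<alpha>1 \<noteq> 0 \<or> \<alpha>2 \<noteq> 0"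
    using a dF_expand[OF p, of a] by (auto simp: \<alpha>1_def \<alpha>2_def)
  have covb: "cov n p b z = ip p (dd n p b) z" for z
    by (simp add: cov_def b first_kind_linear[OF p])
  \<comment> \<open>The front condition concerns the plain derivative of \<open>n\<close>. Since
    \<open>dd F p b\<close> vanishes, the Christoffel term drops out and this is the covariant
    derivative, which is tangential because \<open>n\<close> has unit length.\<close>
  have "\<beta>1 \<noteq> 0 \<or> \<beta>2 \<noteq> 0"
    using imm expand[OF p, of "dd n p b"] cov_skew(3)[OF p, of b] by (auto simp: \<beta>1_def \<beta>2_def covb)
  have "wedge a b * curv p = \<beta>1 * \<gamma>2 - \<beta>2 * \<gamma>1"
    unfolding curv_bilinear[OF p, symmetric] curv_singular_direction[OF p b]
    by (simp add: \<beta>1_def \<beta>2_def \<gamma>1_def \<gamma>2_def)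
  then have c: "curv p = 0 \<longleftrightarrow> \<beta>1 * \<gamma>2 - \<beta>2 * \<gamma>1 = 0" using ab by auto
  have g: "cov n p a (dd F p a) = \<alpha>1 * \<gamma>1 + \<alpha>2 * \<gamma>2"
    unfolding \<alpha>1_def \<alpha>2_def \<gamma>1_def \<gamma>2_def using p by (subst cov_expand) auto
  \<comment> \<open>In the plane, the nonzero vectors with components \<open>\<alpha>\<close> and
    \<open>\<beta>\<close> are orthogonal, so \<open>\<beta>\<close> is a multiple of the quarter
    turn of \<open>\<alpha>\<close>. Hence the determinant of \<open>\<beta>\<close> with
    \<open>\<gamma>\<close> and the inner product of \<open>\<alpha>\<close> with
    \<open>\<gamma>\<close> vanish together; these identities avoid naming the multiple.\<close>
  have e: "\<alpha>1 * (\<beta>1 * \<gamma>2 - \<beta>2 * \<gamma>1) = - \<beta>2 * (\<alpha>1 * \<gamma>1 + \<alpha>2 * \<gamma>2)"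
    "\<alpha>2 * (\<beta>1 * \<gamma>2 - \<beta>2 * \<gamma>1) = \<beta>1 * (\<alpha>1 * \<gamma>1 + \<alpha>2 * \<gamma>2)"
    using ab0 by algebra+
  show ?thesis unfolding c g
    using e \<open>\<alpha>1 \<noteq> 0 \<or> \<alpha>2 \<noteq> 0\<close> \<open>\<beta>1 \<noteq> 0 \<or> \<beta>2 \<noteq> 0\<close>
    by (metis mult_eq_0_iff neg_equal_0_iff_equal)
qed

end

section \<open>Change of charts\<close>

lemma chart_at_in_charts:
  assumes "oriented_atlas A"
  shows "chart_at A m \<in> charts_at A m"
proof -
  have "m \<in> (\<Union>c\<in>A. chart_dom c)" using assms by (simp add: oriented_atlas_def)
  then have "\<exists>c. c \<in> charts_at A m" by (auto simp: charts_at_def)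
  then show ?thesis unfolding chart_at_def by (rule someI_ex)
qed

lemma matrix_linear_vec: "linear l \<Longrightarrow> matrix l *v v = (l v :: real^'n)" for l :: "real^'m \<Rightarrow> real^'n"
  by (simp add: matrix_works linear_matrix_vector_mul_eq)

context
  fixes A :: "'m::{t2_space,second_countable_topology} chart set"
  assumes atlas: "oriented_atlas A"
begin

lemma chart_openD:
  assumes "c \<in> A"
  shows "open (chart_dom c)" "open (coord c ` chart_dom c)"
  using atlas assms by (auto simp: oriented_atlas_def topological_chart_def)

lemma chart_inv_coord: "c \<in> A \<Longrightarrow> m \<in> chart_dom c \<Longrightarrow> chart_inv c (coord c m) = m"
  using atlas by (auto simp: oriented_atlas_def topological_chart_def homeomorphism_def)

lemma transition_coord: "c \<in> A \<Longrightarrow> m \<in> chart_dom c \<Longrightarrow> transition c d (coord c m) = coord d m"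
  by (simp add: transition_def chart_inv_coord)

lemma transition_diff:
  assumes c: "c \<in> A" "m \<in> chart_dom c" and d: "d \<in> A" "m \<in> chart_dom d"
  shows "transition c d differentiable (at (coord c m))"
    and "det (jacobian (transition c d) (coord c m)) > 0"
proof -
  have "coord c m \<in> coord c ` (chart_dom c \<inter> chart_dom d)" using c d by blast
  moreover have "smooth_on (coord c ` (chart_dom c \<inter> chart_dom d)) (transition c d)"
    and "\<forall>x\<in>coord c ` (chart_dom c \<inter> chart_dom d). det (jacobian (transition c d) x) > 0"
    using atlas c d unfolding oriented_atlas_def by blast+
  ultimately show "transition c d differentiable (at (coord c m))"
    "det (jacobian (transition c d) (coord c m)) > 0"
    by (auto intro: smooth_on_imp_differentiable)
qed

lemma coord_f_open:
  assumes "open U" "smooth_map A U f" "c \<in> A"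
  shows "open (U \<inter> f -` chart_dom c)"
  using assms chart_openD[of c] by (intro continuous_open_preimage) (auto simp: smooth_map_def)

lemma coord_f_diff:
  assumes "open U" "smooth_map A U f" "c \<in> A" "q \<in> U" "f q \<in> chart_dom c"
  shows "(coord c \<circ> f) differentiable (at q)"
  by (rule smooth_on_imp_differentiable[of "U \<inter> f -` chart_dom c"])
    (use assms in \<open>auto simp: smooth_map_def\<close>)

lemma dmap_transform:
  assumes U: "open U" and f: "smooth_map A U f" and q: "q \<in> U"
    and c: "c \<in> charts_at A (f q)" and d: "d \<in> charts_at A (f q)"
  shows "dmap f q v d = jacobian (transition c d) (coord c (f q)) *v dmap f q v c"
proof -
  have cA: "c \<in> A" "f q \<in> chart_dom c" and dA: "d \<in> A" "f q \<in> chart_dom d"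
    using c d by (auto simp: charts_at_def)
  have o: "open ((U \<inter> f -` chart_dom c) \<inter> (U \<inter> f -` chart_dom d))"
    by (intro open_Int coord_f_open U f cA dA)
  have tr: "transition c d differentiable (at ((coord c \<circ> f) q))"
    using transition_diff(1)[OF cA dA] by simp
  have "dmap f q v d = dd (\<lambda>y. transition c d ((coord c \<circ> f) y)) q v"
    unfolding dmap_def
    by (rule fun_cong[OF dd_cong[OF o]]) (use q cA dA in \<open>auto simp: transition_coord\<close>)
  also have "\<dots> = dd (transition c d) (coord c (f q)) (dmap f q v c)"
    unfolding dmap_def
    by (subst dd_compose[OF coord_f_diff[OF U f cA(1) q cA(2)] tr]) simp
  also have "\<dots> = jacobian (transition c d) (coord c (f q)) *v dmap f q v c"
    using transition_diff(1)[OF cA dA] by (simp add: jacobian_def matrix_linear_vec linear_dd)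
  finally show ?thesis .
qed

lemma tangent_dmap:
  "open U \<Longrightarrow> smooth_map A U f \<Longrightarrow> q \<in> U \<Longrightarrow> tangent_at A (f q) (dmap f q v)"
  unfolding tangent_at_def by (intro ballI dmap_transform)

lemma inner_at_chart:
  assumes g: "riemannian_metric A g" and c: "c \<in> charts_at A m"
    and X: "tangent_at A m X" and Y: "tangent_at A m Y"
  shows "inner_at A g m X Y = X c \<bullet> (g c (coord c m) *v Y c)"
proof -
  define d where "d = chart_at A m"
  have d: "d \<in> charts_at A m" unfolding d_def by (rule chart_at_in_charts[OF atlas])
  have cd: "c \<in> A" "d \<in> A" "m \<in> chart_dom c" "m \<in> chart_dom d"
    using c d by (auto simp: charts_at_def)
  define J where "J = jacobian (transition d c) (coord d m)"
  have J: "X c = J *v X d" "Y c = J *v Y d"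
    using X Y c d unfolding tangent_at_def J_def by blast+
  have "coord d m \<in> coord d ` (chart_dom d \<inter> chart_dom c)" using cd by blast
  then have "g d (coord d m) = transpose J ** g c (transition d c (coord d m)) ** J"
    using g cd unfolding riemannian_metric_def J_def by blast
  then have gd: "g d (coord d m) = transpose J ** g c (coord c m) ** J"
    by (simp add: transition_coord cd)
  have "X c \<bullet> (g c (coord c m) *v Y c) = X d \<bullet> (transpose J *v (g c (coord c m) *v (J *v Y d)))"
    unfolding J by (metis dot_lmul_matrix inner_commute transpose_matrix_vector)
  also have "\<dots> = X d \<bullet> (g d (coord d m) *v Y d)"
    unfolding gd by (simp add: matrix_vector_mul_assoc matrix_mul_assoc)
  finally show ?thesis by (simp add: inner_at_def Let_def d_def)
qed

text \<open>A change of chart multiplies the root of the Gram determinant by the absolute value of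
  the inverse Jacobian and the determinant of the components by the Jacobian. The two cancel because
  the atlas is oriented.\<close>

lemma volume_form_chart:
  assumes g: "riemannian_metric A g" and c: "c \<in> charts_at A m"
    and X: "tangent_at A m X" "tangent_at A m Y" "tangent_at A m Z"
  shows "volume_form A g m X Y Z = sqrt (det (g c (coord c m))) * det (vector [X c, Y c, Z c] :: real^3^3)"
proof -
  define d where "d = chart_at A m"
  have d: "d \<in> charts_at A m" unfolding d_def by (rule chart_at_in_charts[OF atlas])
  have cd: "c \<in> A" "d \<in> A" "m \<in> chart_dom c" "m \<in> chart_dom d"
    using c d by (auto simp: charts_at_def)
  define J where "J = jacobian (transition d c) (coord d m)"
  have J: "X c = J *v X d" "Y c = J *v Y d" "Z c = J *v Z d"
    using X c d unfolding tangent_at_def J_def by blast+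
  have detJ: "det J > 0" unfolding J_def using cd by (intro transition_diff)
  have "coord d m \<in> coord d ` (chart_dom d \<inter> chart_dom c)" using cd by blast
  then have "g d (coord d m) = transpose J ** g c (transition d c (coord d m)) ** J"
    using g cd unfolding riemannian_metric_def J_def by blast
  then have "det (g d (coord d m)) = (det J)\<^sup>2 * det (g c (coord c m))"
    by (simp add: transition_coord cd det_mul power2_eq_square)
  then have s: "sqrt (det (g d (coord d m))) = det J * sqrt (det (g c (coord c m)))"
    using detJ by (simp add: real_sqrt_mult)
  have "(vector [J *v X d, J *v Y d, J *v Z d] :: real^3^3) = vector [X d, Y d, Z d] ** transpose J"
    by (simp add: vec_eq_iff forall_3 matrix_matrix_mult_def matrix_vector_mult_def transpose_def mult.commute)
  then have "det (vector [X c, Y c, Z c] :: real^3^3) = det (vector [X d, Y d, Z d] :: real^3^3) * det J"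
    unfolding J by (simp add: det_mul)
  then show ?thesis by (simp add: volume_form_def Let_def d_def[symmetric] s)
qed

lemma dmap_eq_0_iff:
  assumes U: "open U" and f: "smooth_map A U f" and q: "q \<in> U"
    and c: "c \<in> charts_at A (f q)" and d: "d \<in> charts_at A (f q)"
  shows "dmap f q v d = 0 \<longleftrightarrow> dmap f q v c = 0"
  using dmap_transform[OF U f q c d, of v] dmap_transform[OF U f q d c, of v] by auto

lemma regular_point_iff:
  assumes U: "open U" and f: "smooth_map A U f" and q: "q \<in> U" and c: "c \<in> charts_at A (f q)"
  shows "regular_point A f q \<longleftrightarrow> \<not> (\<exists>v. v \<noteq> 0 \<and> dmap f q v c = 0)"
proof -
  have "inj (\<lambda>v. dmap f q v d) \<longleftrightarrow> (\<forall>v. dmap f q v c = 0 \<longrightarrow> v = 0)" if d: "d \<in> charts_at A (f q)" for d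
  proof -
    have "linear (\<lambda>v. dmap f q v d)"
      unfolding dmap_def using d coord_f_diff[OF U f _ q, of d] by (simp add: charts_at_def linear_dd)
    then show ?thesis by (simp add: linear_injective_0 dmap_eq_0_iff[OF U f q c d])
  qed
  then show ?thesis using c unfolding regular_point_def by blast
qed

lemma dmap_compose:
  assumes U: "open U" and f: "smooth_map A U f" and q: "\<phi> x \<in> U" "\<phi> differentiable (at x)"
    and c: "c \<in> charts_at A (f (\<phi> x))"
  shows "dmap (f \<circ> \<phi>) x v c = dmap f (\<phi> x) (dd \<phi> x v) c"
proof -
  have "dd (\<lambda>y. (coord c \<circ> f) (\<phi> y)) x v = dd (coord c \<circ> f) (\<phi> x) (dd \<phi> x v)"
    by (rule dd_compose[OF q(2) coord_f_diff[OF U f _ q(1)]]) (use c in \<open>auto simp: charts_at_def\<close>)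
  then show ?thesis by (simp add: dmap_def o_def)
qed

text \<open>An affine map whose second axis is sent to the null vector will do. Existence makes the
  choice in \<open>limiting_normal_curvature\<close> meaningful.\<close>

lemma adapted_coordinates_exist:
  assumes U: "open U" and f: "smooth_map A U f" and p: "p \<in> U"
    and c: "c \<in> charts_at A (f p)" and b: "b \<noteq> 0" "dmap f p b c = 0"
  shows "\<exists>\<phi>. adapted_coordinates A U f p \<phi>"
proof -
  \<comment> \<open>This turn of \<open>b\<close> makes \<open>a\<close>, \<open>b\<close> a
    positive basis: its determinant is the squared length of \<open>b\<close>.\<close>
  define a where "a = (vector [b $ 2, - b $ 1] :: real^2)"
  define \<phi> where "\<phi> = (\<lambda>x::real^2. p + (x $ 1 *\<^sub>R a + x $ 2 *\<^sub>R b))"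
  have d: "b $ 1 * b $ 1 + b $ 2 * b $ 2 > 0"
    using b(1) inner_gt_zero_iff[of b] by (simp add: inner_vec_def sum_2)
  have der: "(\<phi> has_derivative (\<lambda>v. v $ 1 *\<^sub>R a + v $ 2 *\<^sub>R b)) (at x)" for x
    unfolding \<phi>_def
    by (auto intro!: derivative_eq_intros bounded_linear.has_derivative[OF bounded_linear_vec_nth])
  have dphi: "dd \<phi> x = (\<lambda>v. v $ 1 *\<^sub>R a + v $ 2 *\<^sub>R b)" for x by (rule dd_eqI[OF der])
  have diff: "\<phi> differentiable (at x)" for x using der by (auto simp: differentiable_def)
  have sm: "open S \<Longrightarrow> smooth_on S \<phi>" for S
    unfolding \<phi>_def by (intro smooth_intros)
  have inj: "inj \<phi>"
  proof (rule injI)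
    fix x y assume "\<phi> x = \<phi> y"
    then have z: "(x - y) $ 1 *\<^sub>R a + (x - y) $ 2 *\<^sub>R b = 0"
      by (simp add: \<phi>_def algebra_simps)
    have "((x - y) $ 1 *\<^sub>R a + (x - y) $ 2 *\<^sub>R b) $ 1 = 0" "((x - y) $ 1 *\<^sub>R a + (x - y) $ 2 *\<^sub>R b) $ 2 = 0"
      unfolding z by simp_all
    then have "(x - y) $ 1 * (b $ 1 * b $ 1 + b $ 2 * b $ 2) = 0"
      "(x - y) $ 2 * (b $ 1 * b $ 1 + b $ 2 * b $ 2) = 0"
      unfolding a_def by (simp_all only: vector_add_component vector_scaleR_component real_scaleR_def vector_2) algebra+
    then show "x = y" using d by (auto simp: vec_eq_iff forall_2)
  qed
  have jac: "det (jacobian \<phi> x) > 0" for x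
    using d by (simp add: det_2 jacobian_def matrix_def dphi a_def axis_def)
  have p0: "\<phi> 0 = p" by (simp add: \<phi>_def)
  have "open (\<phi> -` U)"
    by (rule open_vimage[OF U smooth_on_imp_continuous_on[OF sm]]) simp
  then have "positive_coordinates U p (\<phi> -` U) \<phi>"
    unfolding positive_coordinates_def using sm inj jac p
    by (auto simp: p0 intro: inj_on_subset[OF inj])
  moreover have "partial_map 2 (f \<circ> \<phi>) 0 d = 0" if d: "d \<in> charts_at A (f p)" for d
  proof -
    have "partial_map 2 (f \<circ> \<phi>) 0 d = dmap f p (dd \<phi> 0 (axis 2 1)) d"
      using dmap_compose[OF U f, of \<phi> 0 d] p d diff by (simp add: p0)
    also have "dd \<phi> 0 (axis 2 1) = b" by (simp add: dphi axis_def)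
    also have "dmap f p b d = 0" using dmap_eq_0_iff[OF U f p c d, of b] b by simp
    finally show ?thesis .
  qed
  ultimately show ?thesis unfolding adapted_coordinates_def by blast
qed

end

section \<open>Limiting normal curvature\<close>

lemma pos_def_det_nonzero:
  fixes M :: "real^'n^'n"
  assumes "\<And>v. v \<noteq> 0 \<Longrightarrow> v \<bullet> (M *v v) > 0"
  shows "det M \<noteq> 0"
proof -
  have "M *v v = 0 \<longrightarrow> v = 0" for v using assms[of v] by force
  then have "invertible M"
    unfolding invertible_left_inverse matrix_left_invertible_ker by blast
  then show ?thesis by (simp add: invertible_det_nz)
qed

text \<open>Multiplied with the metric, the second Christoffel symbols turn into the first ones, so that the
  inverse matrix in \<open>christoffel\<close> disappears.\<close>

lemma (in frontal_chart) christoffel_ip: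
  assumes x: "x \<in> W"
  shows "ip x (\<chi> k. \<Sum>i\<in>UNIV. \<Sum>j\<in>UNIV. christoffel G (F x) k i j * u $ i * v $ j) z = first_kind x u v z"
proof -
  let ?y = "F x"
  note y = F_in[OF x]
  define q where "q = (\<lambda>i j l. (pd i (\<lambda>y. G y $ j $ l) ?y + pd j (\<lambda>y. G y $ i $ l) ?y - pd l (\<lambda>y. G y $ i $ j) ?y) / 2)"
  have nz: "det (G ?y) \<noteq> 0" by (intro pos_def_det_nonzero G_pos y)
  have Gd: "G differentiable (at ?y)" by (rule smooth_on_imp_differentiable[OF smooth_G y])
  have pdG: "pd i (\<lambda>y. G y $ j $ l) ?y = dd G ?y (axis i 1) $ j $ l" for i j l
  proof -
    have "dd (\<lambda>y. G y $ j $ l) ?y w = dd (\<lambda>y. G y $ j) ?y w $ l" for w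
      by (rule bounded_linear.dd_linear[OF bounded_linear_vec_nth])
        (rule smooth_on_imp_differentiable[OF smooth_on_nth[OF open_Y smooth_G] y])
    moreover have "dd (\<lambda>y. G y $ j) ?y w = dd G ?y w $ j" for w
      by (rule bounded_linear.dd_linear[OF bounded_linear_vec_nth Gd])
    ultimately show ?thesis by (simp add: pd_def)
  qed
  have ch: "christoffel G ?y k i j = (matrix_inv (G ?y) *v (\<chi> l. q i j l)) $ k" for k i j
    by (simp add: christoffel_def q_def matrix_vector_mult_def sum_distrib_left
        add_divide_distrib diff_divide_distrib algebra_simps)
  have "G ?y *v (\<chi> k. christoffel G ?y k i j) = (\<chi> l. q i j l)" for i j
  proof -
    have "(\<chi> k. christoffel G ?y k i j) = matrix_inv (G ?y) *v (\<chi> l. q i j l)"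
      by (simp add: vec_eq_iff ch)
    then show ?thesis by (simp add: matrix_inv_mult_eq[OF nz])
  qed
  then have low: "ip x (\<chi> k. christoffel G ?y k i j) z = (\<Sum>l\<in>UNIV. q i j l * z $ l)" for i j
    unfolding ip_commute[OF x, of _ z] by (simp add: ip_def inner_vec_def mult.commute)
  have "(\<chi> k. \<Sum>i\<in>UNIV. \<Sum>j\<in>UNIV. christoffel G ?y k i j * u $ i * v $ j) =
      (\<Sum>i\<in>UNIV. \<Sum>j\<in>UNIV. (u $ i * v $ j) *\<^sub>R (\<chi> k. christoffel G ?y k i j))"
    by (simp add: vec_eq_iff algebra_simps)
  moreover have "ip x (\<Sum>i\<in>UNIV. h i) z = (\<Sum>i\<in>UNIV. ip x (h i) z)" for h :: "3 \<Rightarrow> real^3"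
    by (simp add: ip_def inner_sum_left)
  ultimately have L: "ip x (\<chi> k. \<Sum>i\<in>UNIV. \<Sum>j\<in>UNIV. christoffel G ?y k i j * u $ i * v $ j) z =
      (\<Sum>i\<in>UNIV. \<Sum>j\<in>UNIV. u $ i * v $ j * (\<Sum>l\<in>UNIV. q i j l * z $ l))"
    by (simp add: ip_linear low)
  have dG: "v \<bullet> (dd G ?y u *v z) = (\<Sum>i\<in>UNIV. \<Sum>j\<in>UNIV. \<Sum>l\<in>UNIV. u $ i * v $ j * z $ l * (dd G ?y (axis i 1) $ j $ l))"
    for u v z
  proof -
    have "u = (\<Sum>i\<in>UNIV. u $ i *\<^sub>R axis i 1)"
      by (simp add: vec_eq_iff axis_def if_distrib cong: if_cong)
    then have "dd G ?y u = dd G ?y (\<Sum>i\<in>UNIV. u $ i *\<^sub>R axis i 1)" by (rule arg_cong)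
    also have "\<dots> = (\<Sum>i\<in>UNIV. u $ i *\<^sub>R dd G ?y (axis i 1))"
      by (simp add: linear_sum[OF linear_dG[OF x]] linear_cmul[OF linear_dG[OF x]])
    finally show ?thesis
      by (simp add: sum_3 inner_vec_def matrix_vector_mult_def algebra_simps)
  qed
  show ?thesis unfolding L first_kind_def dG q_def pdG by (simp add: sum_3 field_simps)
qed

text \<open>Continuity bounds \<open>c\<close> near \<open>p\<close>, and a bounded factor preserves
  vanishing to first order. With the volume factor as \<open>c\<close>, no square root has to be
  differentiated.\<close>

lemma has_derivative_zero_mult:
  fixes d c :: "'a::real_normed_vector \<Rightarrow> real"
  assumes "(d has_derivative (\<lambda>_. 0)) (at p)" "d p = 0" "isCont c p"
  shows "((\<lambda>x. d x * c x) has_derivative (\<lambda>_. 0)) (at p)"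
proof -
  have "((\<lambda>y. norm (d y) / norm (y - p)) \<longlongrightarrow> 0) (at p)"
    using assms by (simp add: has_derivative_iff_norm)
  moreover have "((\<lambda>y. norm (c y)) \<longlongrightarrow> norm (c p)) (at p)"
    using assms(3) by (intro tendsto_norm) (simp add: isCont_def)
  ultimately have "((\<lambda>y. norm (d y) / norm (y - p) * norm (c y)) \<longlongrightarrow> 0 * norm (c p)) (at p)"
    by (rule tendsto_mult)
  then show ?thesis using assms(2) by (simp add: has_derivative_iff_norm abs_mult)
qed

context framed_chart
begin

text \<open>\<open>dens\<close> is quadratic in the differential of \<open>F\<close>, so it vanishes
  to second order where the differential is zero. Thus non-degeneracy forces rank one.\<close>

lemma dd_dens_zero:
  assumes p: "p \<in> W" and z: "\<And>v. dd F p v = 0"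
  shows "dd dens p = (\<lambda>_. 0)"
proof
  fix v
  have c: "comp j p $ k = 0" for j k
    using exhaust_2[of k] z by (auto simp: ip_linear)
  have d: "(\<lambda>x. comp j x $ k) differentiable (at p)" for j k
    by (rule smooth_on_imp_differentiable[OF smooth_on_nth[OF open_W smooth_comp] p])
  have d2: "(\<lambda>x. comp i x $ k * comp j x $ l) differentiable (at p)" for i j k l
    by (intro differentiable_mult d)
  show "dd dens p v = 0"
    unfolding dens_def[abs_def] wedge_def dd_diff[OF d2 d2] dd_mult[OF d d] c by simp
qed

lemma det_frame:
  assumes x: "x \<in> W"
  shows "det (vector [dd F x (axis 1 1), dd F x (axis 2 1), n x] :: real^3^3) =
    dens x * det (vector [e1 x, e2 x, n x] :: real^3^3)"
proof -
  define \<alpha> where "\<alpha> = (\<lambda>j k. comp j x $ k)"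
  have F: "dd F x (axis j 1) = \<alpha> j 1 *\<^sub>R e1 x + \<alpha> j 2 *\<^sub>R e2 x" for j
    unfolding \<alpha>_def comp_nth by (rule dF_expand[OF x])
  have dens: "dens x = \<alpha> 1 1 * \<alpha> 2 2 - \<alpha> 1 2 * \<alpha> 2 1" by (simp add: dens_def wedge_def \<alpha>_def)
  show ?thesis unfolding F dens by (simp add: det_3 algebra_simps)
qed

lemma smooth_det_frame:
  "smooth_on W (\<lambda>x. det (vector [e1 x, e2 x, n x] :: real^3^3))"
  unfolding det_3 vector_3 by (intro smooth_intros frame_smooth open_W)

lemma smooth_det_G: "smooth_on W (\<lambda>x. det (G (F x)))"
proof -
  have "smooth_on W (\<lambda>x. G (F x))"
    by (rule smooth_on_compose[OF open_W open_Y smooth_F smooth_G F_in])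
  then have "smooth_on W (\<lambda>x. G (F x) $ i $ j)" for i j
    by (intro smooth_on_nth open_W)
  note this[intro]
  show ?thesis unfolding det_3
    by (intro smooth_on_add smooth_on_diff smooth_on_mult open_W) auto
qed

text \<open>A second unit normal field \<open>m\<close> agrees with \<open>n\<close> up to a sign on the dense set of regular
  points, hence everywhere.\<close>

lemma dd_other_normal:
  assumes p: "p \<in> W" and dn: "dd dens p e \<noteq> 0" and V: "open V" "p \<in> V" "V \<subseteq> W"
    and m: "smooth_on V m" "\<And>x. x \<in> V \<Longrightarrow> ip x (m x) (m x) = 1"
      "\<And>x v. x \<in> V \<Longrightarrow> ip x (m x) (dd F x v) = 0"
    and z: "dd n p b = 0"
  shows "dd m p b = 0"
proof -
  interpret V: framed_chart G Y F n V e1 e2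
    by (intro framed_chart.intro frontal_chart_subset V framed_chart_axioms.intro
        smooth_on_subset[OF smooth_e1] smooth_on_subset[OF smooth_e2])
      (use orth V in auto)
  have "isCont (\<lambda>x. dd dens x e) p"
    using smooth_on_imp_continuous_on[OF smooth_on_dd[OF open_W smooth_dens]] p open_W
    by (simp add: continuous_on_eq_continuous_at)
  then obtain s where s: "s > 0" "\<And>x. dist p x < s \<Longrightarrow> dd dens x e \<noteq> 0"
    using continuous_at_avoid[of p "\<lambda>x. dd dens x e" 0] dn by auto
  define B where "B = V \<inter> ball p s"
  have B: "open B" "p \<in> B" "B \<subseteq> V" using V s by (auto simp: B_def)
  have tangential: "ip x (m x) (w x) = 0"
    if x: "x \<in> B" and w: "w = e1 \<or> w = e2" for x w
  proof (rule ccontr)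
    assume nz: "ip x (m x) (w x) \<noteq> 0"
    define t where "t = (\<lambda>x. ip x (m x) (w x))"
    have "smooth_on V t" unfolding t_def using w by (auto intro: V.smooth_ip m V.frame_smooth)
    then have T: "open (V \<inter> t -` (- {0}))"
      by (intro continuous_open_preimage smooth_on_imp_continuous_on V) auto
    have "dens y = 0" if y: "y \<in> V \<inter> t -` (- {0})" for y
    proof -
      have yV: "y \<in> V" and yW: "y \<in> W" and ty: "t y \<noteq> 0" using y V by auto
      have "comp j y $ 1 * ip y (m y) (e1 y) + comp j y $ 2 * ip y (m y) (e2 y) = 0" for j
        using m(3)[OF yV, of "axis j 1"] ip_expand[OF yW, of "dd F y (axis j 1)" "m y"]
          ip_commute[OF yW, of "m y"] yW by simp
      from this[of 1] this[of 2]
      have "dens y * ip y (m y) (e1 y) = 0" "dens y * ip y (m y) (e2 y) = 0"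
        unfolding dens_def wedge_def by algebra+
      then show ?thesis using ty w by (auto simp: t_def)
    qed
    then have "dd dens x = dd (\<lambda>_. 0 :: real) x"
      by (intro dd_cong[OF T]) (use x nz B in \<open>auto simp: t_def\<close>)
    then show False using s(2)[of x] x by (simp add: B_def)
  qed
  define c where "c = (\<lambda>x. ip x (m x) (n x))"
  have mn: "m x = c x *\<^sub>R n x" if "x \<in> B" for x
  proof -
    have "x \<in> W" using that B V by blast
    from expand[OF this, of "m x"] show ?thesis
      using tangential[OF that] by (simp add: c_def)
  qed
  have cc: "c x * c x = 1" if "x \<in> B" for x
  proof -
    have "x \<in> W" "x \<in> V" using that B V by blast+
    then show ?thesis using ip_expand[of x "m x" "m x"] m(2) tangential[OF that] by (simp add: c_def)
  qed
  have pV: "p \<in> V" by fact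
  have smc: "smooth_on V c" unfolding c_def by (intro V.smooth_ip m V.smooth_n)
  have dc: "c differentiable (at p)" by (rule smooth_on_imp_differentiable[OF smc pV])
  \<comment> \<open>Differentiating the square replaces the argument that a continuous sign is
    locally constant.\<close>
  have "dd (\<lambda>x. c x * c x) p b = 0"
    by (subst dd_cong[OF B(1,2) cc]) auto
  then have "c p * dd c p b = 0" by (simp add: dd_mult[OF dc dc])
  then have "dd c p b = 0" using cc[OF B(2)] by auto
  moreover have "dd m p b = dd (\<lambda>x. c x *\<^sub>R n x) p b"
    by (subst dd_cong[OF B(1,2) mn]) auto
  moreover have "dd (\<lambda>x. c x *\<^sub>R n x) p b = c p *\<^sub>R dd n p b + dd c p b *\<^sub>R n p"
    by (rule bounded_bilinear.dd_bilinear[OF bounded_bilinear_scaleR dc smooth_on_imp_differentiable[OF smooth_n p]])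
  ultimately show ?thesis using z by simp
qed

end

lemma framed_chart_exists:
  assumes "frontal_chart G Y F n W" and p: "p \<in> W"
  obtains V e1 e2 where "p \<in> V" "V \<subseteq> W" "framed_chart G Y F n V e1 e2"
proof -
  interpret W: frontal_chart G Y F n W by fact
  obtain V1 e1 where 1: "open V1" "p \<in> V1" "V1 \<subseteq> W" "smooth_on V1 e1"
    "\<And>x. x \<in> V1 \<Longrightarrow> W.ip x (e1 x) (n x) = 0" "\<And>x. x \<in> V1 \<Longrightarrow> W.ip x (e1 x) (e1 x) = 1"
    \<comment> \<open>With the zero field in the role of \<open>m\<close>, the first frame vector is
      only made orthogonal to \<open>n\<close>; the second call uses \<open>e1\<close> as
      \<open>m\<close>.\<close>
    by (rule W.orthonormal_extension[OF p smooth_on_const W.ip_linear(7) disjI1[OF refl]]) (rule that)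
  interpret V1: frontal_chart G Y F n V1 by (rule W.frontal_chart_subset[OF 1(1,3)])
  obtain V e2 where 2: "open V" "p \<in> V" "V \<subseteq> V1" "smooth_on V e2"
    "\<And>x. x \<in> V \<Longrightarrow> V1.ip x (e2 x) (n x) = 0" "\<And>x. x \<in> V \<Longrightarrow> V1.ip x (e2 x) (e1 x) = 0"
    "\<And>x. x \<in> V \<Longrightarrow> V1.ip x (e2 x) (e2 x) = 1"
    using V1.orthonormal_extension[OF 1(2,4,5)] 1(6) by blast
  show ?thesis
  proof (rule that[of V e1 e2])
    show "p \<in> V" "V \<subseteq> W" using 1 2 by auto
    show "framed_chart G Y F n V e1 e2"
      by (intro framed_chart.intro V1.frontal_chart_subset 2 framed_chart_axioms.intro
          smooth_on_subset[OF 1(4)]) (use 1 2 in auto)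
  qed
qed

text \<open>The reparametrized map with the reparametrized normal is again a frontal, so
  \<open>cov_const_ip\<close> moves the derivative onto the normal. The second derivatives of
  \<open>\<phi>\<close> disappear, and the coordinates matter only through
  \<open>dd \<phi> x v\<close>.\<close>

lemma (in frontal_chart) second_fundamental_form_pullback:
  fixes v :: "real^2"
  assumes S: "open S" "x \<in> S" and phi: "smooth_on S \<phi>" "\<And>y. y \<in> S \<Longrightarrow> \<phi> y \<in> W"
  defines "E \<equiv> \<lambda>y. dd (F \<circ> \<phi>) y v"
  shows "ip (\<phi> x) (dd E x v + (\<chi> k. \<Sum>i\<in>UNIV. \<Sum>j\<in>UNIV. christoffel G (F (\<phi> x)) k i j * E x $ i * E x $ j)) (n (\<phi> x))
    = - cov n (\<phi> x) (dd \<phi> x v) (dd F (\<phi> x) (dd \<phi> x v))"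
proof -
  have d: "\<phi> differentiable (at y)" if "y \<in> S" for y
    by (rule smooth_on_imp_differentiable[OF phi(1) that])
  have dFphi: "dd (F \<circ> \<phi>) y w = dd F (\<phi> y) (dd \<phi> y w)" if "y \<in> S" for y w
    unfolding o_def by (intro dd_compose d that F_diff phi)
  have dnphi: "dd (n \<circ> \<phi>) y w = dd n (\<phi> y) (dd \<phi> y w)" if "y \<in> S" for y w
    unfolding o_def by (intro dd_compose d that smooth_on_imp_differentiable[OF smooth_n] phi)
  interpret R: frontal_chart G Y "F \<circ> \<phi>" "n \<circ> \<phi>" S
  proof
    show "smooth_on S (F \<circ> \<phi>)" "smooth_on S (n \<circ> \<phi>)"
      unfolding o_def
      by (rule smooth_on_compose[OF S(1) open_W phi(1) smooth_F phi(2)], assumption)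
        (rule smooth_on_compose[OF S(1) open_W phi(1) smooth_n phi(2)])
  qed (use open_Y smooth_G G_sym G_pos S F_in phi unit_n normal_n dFphi in auto)
  have ip: "R.ip x = ip (\<phi> x)" and fk: "R.first_kind x = first_kind (\<phi> x)"
    by (simp_all add: fun_eq_iff R.ip_def ip_def R.first_kind_def first_kind_def)
  have smE: "smooth_on S E" unfolding E_def by (rule smooth_on_dd[OF S(1) R.smooth_F])
  have "ip (\<phi> x) (dd E x v + (\<chi> k. \<Sum>i\<in>UNIV. \<Sum>j\<in>UNIV. christoffel G (F (\<phi> x)) k i j * E x $ i * E x $ j)) (n (\<phi> x))
    = R.cov E x v ((n \<circ> \<phi>) x)"
    using R.christoffel_ip[OF S(2), of "E x" "E x" "n (\<phi> x)"]
    by (simp add: R.cov_def ip ip_linear fk E_def)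
  also have "\<dots> = - R.cov (n \<circ> \<phi>) x v (E x)"
  proof (rule R.cov_const_ip[OF S(2) smE R.smooth_n])
    show "R.ip y (E y) ((n \<circ> \<phi>) y) = 0" if "y \<in> S" for y
      unfolding R.ip_commute[OF that, of "E y"] unfolding R.ip_def E_def by (rule R.normal_n[OF that])
  qed
  also have "R.cov (n \<circ> \<phi>) x v (E x) = cov n (\<phi> x) (dd \<phi> x v) (dd F (\<phi> x) (dd \<phi> x v))"
    by (simp add: R.cov_def cov_def ip fk E_def dFphi dnphi S)
  finally show ?thesis .
qed

theorem theorem2:
  fixes A :: "'m::{t2_space,second_countable_topology} chart set"
    and g :: "'m metric_coeffs"
    and U N :: "(real^2) set"
    and f :: "real^2 \<Rightarrow> 'm"
    and \<nu> :: "real^2 \<Rightarrow> 'm tvec"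
    and p :: "real^2"
  assumes "oriented_riemannian_3_manifold A g"
    and "open U" and "connected U"
    and "front A g U f"
    and "p \<in> U"
    and "open N" and "p \<in> N" and "N \<subseteq> U" and "unit_normal_field A g f N \<nu>"
    and "nondegenerate_singular_point A g f \<nu> p"
  shows "curvature_rationally_bounded A g U f p \<longleftrightarrow>
    limiting_normal_curvature A g U f \<nu> p = 0"
proof -
  have atlas: "oriented_atlas A" and metric: "riemannian_metric A g"
    using assms(1) by (simp_all add: oriented_riemannian_3_manifold_def)
  have U: "open U" and f: "smooth_map A U f" using assms by (simp_all add: front_def)
  \<comment> \<open>This is the chart that \<open>inner_at\<close> uses at \<open>f p\<close>. Inner
    products at \<open>p\<close> can thus be unfolded later without first showing that the covariant
    derivative is a tangent vector.\<close>
  define c where "c = chart_at A (f p)"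
  have cin: "c \<in> charts_at A (f p)" unfolding c_def by (rule chart_at_in_charts[OF atlas])
  then have cA: "c \<in> A" "f p \<in> chart_dom c" by (auto simp: charts_at_def)
  define F where "F = coord c \<circ> f"
  define n where "n = (\<lambda>q. \<nu> q c)"
  define W where "W = N \<inter> f -` chart_dom c"
  have WU: "q \<in> U" "q \<in> N" "c \<in> charts_at A (f q)" "f q \<in> chart_dom c" if "q \<in> W" for q
    using that assms(8) cA by (auto simp: W_def charts_at_def)
  have dF: "dd F q v = dmap f q v c" for q v by (simp add: F_def dmap_def)
  have tan: "tangent_at A (f q) (dmap f q v)" if "q \<in> W" for q v
    by (rule tangent_dmap[OF atlas U f WU(1)[OF that]])
  have tan\<nu>: "tangent_at A (f q) (\<nu> q)" if "q \<in> W" for q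
    using assms(9) WU(2)[OF that] by (simp add: unit_normal_field_def smooth_field_along_def)
  have inner: "inner_at A g (f q) X Z = X c \<bullet> (g c (F q) *v Z c)"
    if "q \<in> W" "tangent_at A (f q) X" "tangent_at A (f q) Z" for q X Z
    using inner_at_chart[OF atlas metric WU(3)[OF that(1)] that(2,3)] by (simp add: F_def)
  have open_W: "open W"
    unfolding W_def using f assms(6,8) chart_openD(1)[OF atlas cA(1)]
    by (intro continuous_open_preimage) (auto simp: smooth_map_def intro: continuous_on_subset)
  have fc: "frontal_chart (g c) (coord c ` chart_dom c) F n W"
  proof
    show "open (coord c ` chart_dom c)" by (rule chart_openD(2)[OF atlas cA(1)])
    show "smooth_on (coord c ` chart_dom c) (g c)"
      "\<And>y. y \<in> coord c ` chart_dom c \<Longrightarrow> transpose (g c y) = g c y"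
      "\<And>y v. y \<in> coord c ` chart_dom c \<Longrightarrow> v \<noteq> 0 \<Longrightarrow> v \<bullet> (g c y *v v) > 0"
      using metric cA by (auto simp: riemannian_metric_def)
    show "open W" by fact
    have "smooth_on (U \<inter> f -` chart_dom c) F" using f cA by (simp add: smooth_map_def F_def)
    then show "smooth_on W F" by (rule smooth_on_subset) (use assms(8) in \<open>auto simp: W_def\<close>)
    show "smooth_on W n" using assms(9) cA
      by (simp add: unit_normal_field_def smooth_field_along_def W_def n_def)
    fix q assume q: "q \<in> W"
    then show "F q \<in> coord c ` chart_dom c" using WU(4) by (auto simp: F_def)
    show "n q \<bullet> (g c (F q) *v n q) = 1"
      using inner[OF q tan\<nu>[OF q] tan\<nu>[OF q]] assms(9) WU(2)[OF q]
      by (simp add: n_def unit_normal_field_def)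
    show "n q \<bullet> (g c (F q) *v dd F q v) = 0" for v
      using inner[OF q tan\<nu>[OF q] tan[OF q]] assms(9) WU(2)[OF q]
      by (simp add: n_def unit_normal_field_def dF)
  qed
  have "p \<in> W" using assms(7) cA by (simp add: W_def)
  then obtain V e1 e2 where pV: "p \<in> V" and VW: "V \<subseteq> W"
    and framed: "framed_chart (g c) (coord c ` chart_dom c) F n V e1 e2"
    using framed_chart_exists[OF fc] by blast
  interpret framed_chart "g c" "coord c ` chart_dom c" F n V e1 e2 by (fact framed)
  have inner: "inner_at A g (f q) X Z = ip q (X c) (Z c)"
    if "q \<in> V" "tangent_at A (f q) X" "tangent_at A (f q) Z" for q X Z
    using inner[OF _ that(2,3)] that(1) VW by (auto simp: ip_def)
  have regular: "regular_point A f q \<longleftrightarrow> dens q \<noteq> 0" if "q \<in> V" for q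
    using regular_point_iff[OF atlas U f WU(1,3)] dens_eq_0_iff[OF that] that VW by (auto simp: dF)

  have curvature: "gaussian_curvature A g f q * dens q = - curv q" if "q \<in> V" "dens q \<noteq> 0" for q
    unfolding gaussian_curvature_def
  proof (rule metric_curvature_frame[OF open_W order_refl _ that])
    show "induced_metric A g f x $ i $ j = ip x (dd F x (axis i 1)) (dd F x (axis j 1))" if "x \<in> V" for x i j
      using inner[OF that] tan that VW by (auto simp: induced_metric_def dF)
  qed

  have sing: "\<not> regular_point A f p"
    and dsad: "dd (signed_area_density A g f \<nu>) p \<noteq> (\<lambda>_. 0)"
    using assms(10) by (auto simp: nondegenerate_singular_point_def)
  have dens_p: "dens p = 0" using sing regular[OF pV] by simp
  have ddens: "dd dens p \<noteq> (\<lambda>_. 0)"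
  proof
    assume z: "dd dens p = (\<lambda>_. 0)"
    \<comment> \<open>Near \<open>p\<close> the signed area density is \<open>dens\<close> times
      \<open>vol\<close>. If the derivative of \<open>dens\<close> vanished at \<open>p\<close>,
      where \<open>dens\<close> is zero, then so would that of the product.\<close>
    define vol where "vol = (\<lambda>q. sqrt (det (g c (F q))) * det (vector [e1 q, e2 q, n q] :: real^3^3))"
    have "isCont (\<lambda>q. det (g c (F q))) p" "isCont (\<lambda>q. det (vector [e1 q, e2 q, n q] :: real^3^3)) p"
      using smooth_on_imp_continuous_on[OF smooth_det_G] smooth_on_imp_continuous_on[OF smooth_det_frame]
        open_W pV by (simp_all add: continuous_on_eq_continuous_at)
    then have "isCont vol p" unfolding vol_def by (intro continuous_intros)
    moreover have "(dens has_derivative (\<lambda>_. 0)) (at p)"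
      using smooth_on_has_derivative[OF smooth_dens pV] z by simp
    ultimately have "((\<lambda>q. dens q * vol q) has_derivative (\<lambda>_. 0)) (at p)"
      using dens_p by (intro has_derivative_zero_mult)
    then have "dd (\<lambda>q. dens q * vol q) p = (\<lambda>_. 0)" by (rule dd_eqI)
    moreover have "signed_area_density A g f \<nu> q = dens q * vol q" if "q \<in> V" for q
    proof -
      have q: "q \<in> W" using that VW by blast
      have "signed_area_density A g f \<nu> q = sqrt (det (g c (F q))) *
          det (vector [dd F q (axis 1 1), dd F q (axis 2 1), n q] :: real^3^3)"
        unfolding signed_area_density_def
        by (subst volume_form_chart[OF atlas metric WU(3)[OF q] tan[OF q] tan[OF q] tan\<nu>[OF q]])
          (use o_apply[of "coord c" f q] in \<open>simp add: dF[symmetric] n_def flip: F_def\<close>)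
      then show ?thesis unfolding det_frame[OF that] by (simp add: vol_def)
    qed
    then have "dd (signed_area_density A g f \<nu>) p = dd (\<lambda>q. dens q * vol q) p"
      by (rule dd_cong[OF open_W pV])
    ultimately show False using dsad by simp
  qed

  obtain r where r: "r > 0" "ball p r \<subseteq> V" using open_W pV openE by metis
  \<comment> \<open>The numerator carries the minus sign from the second structure equation.\<close>
  have sm: "smooth_on (ball p r) dens" "smooth_on (ball p r) (\<lambda>q. - curv q)"
    by (rule smooth_on_subset[OF smooth_dens r(2)],
        rule smooth_on_subset[OF smooth_on_minus[OF open_W smooth_curv] r(2)])
  have rb: "curvature_rationally_bounded A g U f p \<longleftrightarrow> curv p = 0"
  proof
    assume "curvature_rationally_bounded A g U f p"
    then obtain W' where W': "rationally_bounded p W' {q\<in>W'. regular_point A f q} (gaussian_curvature A g f)"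
      unfolding curvature_rationally_bounded_def by blast
    \<comment> \<open>The given neighborhood may reach beyond the ball on which the frame exists;
      the comparison with \<open>dens\<close> and \<open>curv\<close> is made only inside the
      ball.\<close>
    have "- curv p = 0"
      by (rule rationally_bounded_imp_numerator_zero[OF r(1) sm dens_p ddens W'])
        (use r(2) regular curvature in auto)
    then show "curv p = 0" by simp
  next
    assume "curv p = 0"
    then have z: "- curv p = 0" by simp
    obtain W' where W': "W' \<subseteq> ball p r"
      and rb: "rationally_bounded p W' (W' \<inter> {q. regular_point A f q}) (gaussian_curvature A g f)"
      using rationally_bounded_if_numerator_zero[OF r(1) sm dens_p z ddens,
          of "{q. regular_point A f q}" "gaussian_curvature A g f"] r(2) regular curvature by blast
    have "W' \<subseteq> U" using W' r(2) VW WU(1) by blast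
    moreover have "W' \<inter> {q. regular_point A f q} = {q\<in>W'. regular_point A f q}" by blast
    ultimately show "curvature_rationally_bounded A g U f p"
      using rb unfolding curvature_rationally_bounded_def by auto
  qed

  obtain b0 where b0: "b0 \<noteq> 0" "dmap f p b0 c = 0"
    using dens_p dens_eq_0_iff[OF pV] by (auto simp: dF)
  \<comment> \<open>The very coordinates picked in \<open>limiting_normal_curvature\<close>; only
    their being adapted is used.\<close>
  define \<phi> where "\<phi> = (SOME \<phi>. adapted_coordinates A U f p \<phi>)"
  have "adapted_coordinates A U f p \<phi>"
    unfolding \<phi>_def by (rule someI_ex[OF adapted_coordinates_exist[OF atlas U f assms(5) cin b0]])
  then obtain V' where V': "open V'" "0 \<in> V'" "smooth_on V' \<phi>" and p0: "\<phi> 0 = p"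
    and jac: "det (jacobian \<phi> 0) > 0" and null: "partial_map 2 (f \<circ> \<phi>) 0 c = 0"
    using cin unfolding adapted_coordinates_def positive_coordinates_def by blast
  define S where "S = V' \<inter> \<phi> -` V"
  have S: "open S" "0 \<in> S" "S \<subseteq> V'"
    unfolding S_def using V' pV p0 open_W
    by (auto intro!: continuous_open_preimage smooth_on_imp_continuous_on)
  have smphi: "smooth_on S \<phi>" by (rule smooth_on_subset[OF V'(3) S(3)])
  have dphi: "\<phi> differentiable (at 0)" by (rule smooth_on_imp_differentiable[OF smphi S(2)])
  define a where "a = dd \<phi> 0 (axis 1 1)"
  define b where "b = dd \<phi> 0 (axis 2 1)"
  have ab: "wedge a b \<noteq> 0"
    using jac by (simp add: det_2 jacobian_def matrix_def wedge_def a_def b_def mult.commute)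
  have chain: "dmap (f \<circ> \<phi>) 0 v c = dd F p (dd \<phi> 0 v)" for v
    using dmap_compose[OF atlas U f, of \<phi> 0 c] assms(5) dphi cin by (simp add: p0 dF)
  have db: "dd F p b = 0" using null chain[of "axis 2 1"] by (simp add: b_def)
  have lin: "linear (dd F p)" by (rule linear_dd[OF F_diff[OF pV]])
  have da: "dd F p a \<noteq> 0"
  proof
    assume z: "dd F p a = 0"
    have "dd F p v = 0" for v
    proof -
      \<comment> \<open>Cramer's identity: \<open>a\<close> and \<open>b\<close> span the plane, so
        if both were null, the differential of \<open>F\<close> would be zero at \<open>p\<close>,
        contrary to \<open>dd_dens_zero\<close>.\<close>
      have "wedge a b *\<^sub>R v = wedge v b *\<^sub>R a + wedge a v *\<^sub>R b"
        by (simp add: vec_eq_iff forall_2 wedge_def algebra_simps)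
      then have "dd F p (wedge a b *\<^sub>R v) = dd F p (wedge v b *\<^sub>R a + wedge a v *\<^sub>R b)"
        by (rule arg_cong)
      then have "wedge a b *\<^sub>R dd F p v = 0"
        by (simp add: linear_add[OF lin] linear_cmul[OF lin] z db)
      then show ?thesis using ab by simp
    qed
    then show False using dd_dens_zero[OF pV] ddens by blast
  qed
  have imm: "dd n p b \<noteq> 0"
  proof
    assume z: "dd n p b = 0"
    \<comment> \<open>The normal field from the definition of a front may differ from
      \<open>\<nu>\<close>, so a vanishing derivative of \<open>n\<close> is first carried over to
      it by \<open>dd_other_normal\<close>.\<close>
    obtain N' \<nu>' where N': "open N'" "p \<in> N'" "N' \<subseteq> U" and \<nu>': "unit_normal_field A g f N' \<nu>'"
      and immersion: "\<forall>y\<in>N'. field_immersion_at A f \<nu>' y"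
      using assms(4,5) unfolding front_def by blast
    define m where "m = (\<lambda>q. \<nu>' q c)"
    define V2 where "V2 = V \<inter> N'"
    have V2: "open V2" "p \<in> V2" "V2 \<subseteq> V" using N' pV open_W by (auto simp: V2_def)
    have tan': "tangent_at A (f q) (\<nu>' q)" if "q \<in> V2" for q
      using \<nu>' that by (simp add: V2_def unit_normal_field_def smooth_field_along_def)
    have "smooth_on (N' \<inter> f -` chart_dom c) m"
      using \<nu>' cA by (simp add: unit_normal_field_def smooth_field_along_def m_def)
    then have smm: "smooth_on V2 m"
      by (rule smooth_on_subset) (use VW in \<open>auto simp: V2_def W_def\<close>)
    have m1: "ip q (m q) (m q) = 1" if "q \<in> V2" for q
      using inner[OF _ tan'[OF that] tan'[OF that]] \<nu>' that
      by (simp add: V2_def unit_normal_field_def m_def)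
    have m2: "ip q (m q) (dd F q v) = 0" if "q \<in> V2" for q v
    proof -
      have q: "q \<in> V" "q \<in> W" "q \<in> N'" using that VW by (auto simp: V2_def)
      show ?thesis
        using inner[OF q(1) tan'[OF that] tan[OF q(2), of v]] \<nu>' q(3)
        by (simp add: unit_normal_field_def m_def dF)
    qed
    obtain e where "dd dens p e \<noteq> 0" using ddens by auto
    then have dm: "dd m p b = 0" by (rule dd_other_normal[OF pV _ V2 smm m1 m2 z])
    have "inj (dd (\<lambda>y. (coord c (f y), m y)) p)"
      using immersion N'(2) cin by (simp add: field_immersion_at_def m_def)
    moreover have "dd (\<lambda>y. (coord c (f y), m y)) p = (\<lambda>v. (dd F p v, dd m p v))"
      using has_derivative_Pair[OF has_derivative_dd[OF F_diff[OF pV]]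
          smooth_on_has_derivative[OF smm V2(2)]]
      by (intro dd_eqI) (simp add: F_def)
    ultimately have "inj (\<lambda>v. (dd F p v, dd m p v))" by simp
    moreover have "dd F p 0 = 0" "dd m p 0 = 0"
      using linear_0[OF lin] linear_0[OF linear_dd_smooth[OF smm V2(2)]] by auto
    \<comment> \<open>Both the map and the normal have zero derivative along \<open>b\<close>, which
      contradicts the immersion property as \<open>b\<close> is nonzero.\<close>
    ultimately have "b = 0" using db dm by (auto dest!: injD[of _ b 0])
    then show False using ab by (simp add: wedge_def)
  qed

  have "limiting_normal_curvature A g U f \<nu> p =
      - cov n p a (dd F p a) / ip p (dd F p a) (dd F p a)"
  proof -
    define E where "E = (\<lambda>y. dd (F \<circ> \<phi>) y (axis 1 1))"
    have E: "partial_map 1 (f \<circ> \<phi>) y c = E y" for y by (simp add: E_def F_def dmap_def o_assoc)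
    have E0: "E 0 = dd F p a" using E[of 0] chain[of "axis 1 1"] by (simp add: a_def)
    have X: "cov_deriv g (f \<circ> \<phi>) 1 (partial_map 1 (f \<circ> \<phi>)) 0 c = dd E 0 (axis 1 1) +
        (\<chi> k. \<Sum>i\<in>UNIV. \<Sum>j\<in>UNIV. christoffel (g c) (F p) k i j * E 0 $ i * E 0 $ j)"
      by (simp add: cov_deriv_def E pd_def p0 F_def)
    have "ip p (cov_deriv g (f \<circ> \<phi>) 1 (partial_map 1 (f \<circ> \<phi>)) 0 c) (n p) = - cov n p a (dd F p a)"
      unfolding X using second_fundamental_form_pullback[OF S(1,2) smphi, of "axis 1 1"]
      by (simp add: S_def p0 E_def a_def)
    \<comment> \<open>This holds for arbitrary \<open>X\<close> and \<open>Z\<close> by the choice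
      of \<open>c\<close>.\<close>
    moreover have "inner_at A g (f p) X Z = ip p (X c) (Z c)" for X Z
      by (simp add: inner_at_def Let_def c_def[symmetric] ip_def) (simp add: F_def)
    moreover have "\<nu> p c = n p" by (simp add: n_def)
    ultimately show ?thesis
      by (simp add: limiting_normal_curvature_def Let_def \<phi>_def[symmetric] E E0)
  qed
  moreover have "ip p (dd F p a) (dd F p a) > 0" by (rule ip_pos[OF pV da])
  ultimately have "limiting_normal_curvature A g U f \<nu> p = 0 \<longleftrightarrow> cov n p a (dd F p a) = 0" by simp
  then show ?thesis using rb curv_eq_0_iff[OF pV db ab da imm] by simp
qed

end
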